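(* Let $\Omega$ be a biased expansion of a $2$-connected simple graph $\Delta$, and let $X$ be the set of links $e$ joining nonadjacent nodes of $\Delta$ such that $\Omega$ extends to $e$. Then $\Omega$ has a unique maximal extension (unique up to an isomorphism that is the identity on $\Omega$ and commutes with projections), and its base graph is $\Delta\cup X$.
   Context: A biased graph is a graph with a set of circles, called balanced, such that no theta subgraph contains exactly two balanced circles. A biased expansion of $\Delta$ is a biased graph $\Omega$ with surjective $p:\|\Omega\|\to\Delta$, identity on nodes, no balanced digon in any fiber, and the circle lifting property (for every circle $e_1\cdots e_l$ of $\Delta$ and any $\tilde e_i\in p^{-1}(e_i)$, $i<l$, exactly one $\tilde e_l\in p^{-1}(e_l)$ makes $\tilde e_1\cdots\tilde e_l$ balanced). An extension of $\Omega\downarrow_p\Delta$ is a biased expansion $\Omega'\downarrow_{p'}\Delta'$ with $\Delta$ a spanning subgraph of $\Delta'$ and $p'^{-1}(\Delta)$ (inherited balance and projection) equal to $\Omega$; $\Omega$ extends to an edge $e$ if it has an extension to $\Delta\cup\{e\}$. An extension is simple if $\Delta'$ is simple; an extension is maximal if it has no proper simple extension. A graph is $2$-connected if any two edges lie on a common circle. The graph may be infinite.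
   Formalization: 2-connected is taken to include connected (with isolated nodes uniqueness fails, e.g. two isolated nodes), and a maximal extension is itself required to be simple (otherwise every non-simple extension is vacuously maximal and uniqueness fails). *)

theory Defs
  imports Main
begin

section \<open>Graphs, circles and theta graphs\<close>

text \<open>Graphs may be infinite and may have multiple edges; an edge is a loop or a link according to
  whether it has one end or two.\<close>

record ('v, 'e) mgraph =
  verts :: "'v set"
  edges :: "'e set"
  ends :: "'e \<Rightarrow> 'v set"

definition wf_graph :: "('v, 'e, 'z) mgraph_scheme \<Rightarrow> bool" where
  "wf_graph G \<longleftrightarrow> (\<forall>e\<in>edges G. ends G e \<subseteq> verts G \<and> card (ends G e) \<in> {1, 2})"

definition path_seq :: "('v, 'e, 'z) mgraph_scheme \<Rightarrow> 'v list \<Rightarrow> 'e list \<Rightarrow> bool" where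
  "path_seq G vs es \<longleftrightarrow>
     length vs = Suc (length es) \<and> distinct vs \<and> set vs \<subseteq> verts G \<and> set es \<subseteq> edges G \<and>
     (\<forall>i<length es. ends G (es ! i) = {vs ! i, vs ! Suc i})"

text \<open>The list \<open>es\<close> is the cyclic sequence of edges of a circle. A loop is a circle of length 1;
  distinctness of the edges only matters for digons.\<close>

definition circle_seq :: "('v, 'e, 'z) mgraph_scheme \<Rightarrow> 'e list \<Rightarrow> bool" where
  "circle_seq G es \<longleftrightarrow>
     es \<noteq> [] \<and> distinct es \<and> set es \<subseteq> edges G \<and>
     (\<exists>vs. length vs = length es \<and> distinct vs \<and> set vs \<subseteq> verts G \<and>
        (\<forall>i<length es. ends G (es ! i) = {vs ! i, vs ! (Suc i mod length es)}))"

text \<open>Circles and theta graphs are identified with their edge sets.\<close>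

definition circles :: "('v, 'e, 'z) mgraph_scheme \<Rightarrow> 'e set set" where
  "circles G = {set es | es. circle_seq G es}"

definition theta :: "('v, 'e, 'z) mgraph_scheme \<Rightarrow> 'e set \<Rightarrow> bool" where
  "theta G T \<longleftrightarrow>
     (\<exists>u v vs1 es1 vs2 es2 vs3 es3. u \<noteq> v \<and>
        (\<forall>(vs, es) \<in> {(vs1, es1), (vs2, es2), (vs3, es3)}.
           path_seq G vs es \<and> hd vs = u \<and> last vs = v) \<and>
        set vs1 \<inter> set vs2 = {u, v} \<and> set vs1 \<inter> set vs3 = {u, v} \<and> set vs2 \<inter> set vs3 = {u, v} \<and>
        set es1 \<inter> set es2 = {} \<and> set es1 \<inter> set es3 = {} \<and> set es2 \<inter> set es3 = {} \<and>
        T = set es1 \<union> set es2 \<union> set es3)"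

definition connected_graph :: "('v, 'e, 'z) mgraph_scheme \<Rightarrow> bool" where
  "connected_graph G \<longleftrightarrow>
     (\<forall>u\<in>verts G. \<forall>v\<in>verts G. \<exists>vs es. path_seq G vs es \<and> hd vs = u \<and> last vs = v)"

text \<open>Connectedness serves only to exclude isolated nodes, about which a condition on pairs of edges
  says nothing. A single node and a single link are 2-connected.\<close>

definition two_connected :: "('v, 'e, 'z) mgraph_scheme \<Rightarrow> bool" where
  "two_connected G \<longleftrightarrow> connected_graph G \<and>
     (\<forall>e\<in>edges G. \<forall>f\<in>edges G. e \<noteq> f \<longrightarrow> (\<exists>C\<in>circles G. e \<in> C \<and> f \<in> C))"

text \<open>In a simple graph a link is named by its pair of ends, so that the links joining nonadjacent
  nodes exist independently of the graph. Fixing \<open>ends\<close> outside the edge set as well makes equality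
  of simple graphs amount to equality of node and edge sets.\<close>

definition simple_graph :: "('v, 'v set) mgraph \<Rightarrow> bool" where
  "simple_graph G \<longleftrightarrow> wf_graph G \<and> ends G = (\<lambda>e. e) \<and> (\<forall>e\<in>edges G. card e = 2)"

definition nonadjacent_link :: "('v, 'v set) mgraph \<Rightarrow> 'v set \<Rightarrow> bool" where
  "nonadjacent_link G e \<longleftrightarrow>
     (\<exists>u\<in>verts G. \<exists>v\<in>verts G. u \<noteq> v \<and> e = {u, v}) \<and> e \<notin> edges G"

definition add_links :: "('v, 'v set) mgraph \<Rightarrow> 'v set set \<Rightarrow> ('v, 'v set) mgraph" where
  "add_links G X = G\<lparr>edges := edges G \<union> X\<rparr>"

definition spanning_subgraph :: "('v, 'e) mgraph \<Rightarrow> ('v, 'e) mgraph \<Rightarrow> bool" where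
  "spanning_subgraph G H \<longleftrightarrow>
     verts G = verts H \<and> edges G \<subseteq> edges H \<and> (\<forall>e\<in>edges G. ends G e = ends H e)"


section \<open>Biased graphs and biased expansions\<close>

record ('v, 'f) biased_graph = "('v, 'f) mgraph" +
  balanced :: "'f set set"

definition is_biased_graph :: "('v, 'f) biased_graph \<Rightarrow> bool" where
  "is_biased_graph \<Omega> \<longleftrightarrow> wf_graph \<Omega> \<and> balanced \<Omega> \<subseteq> circles \<Omega> \<and>
     (\<forall>T. theta \<Omega> T \<longrightarrow> card {C \<in> balanced \<Omega>. C \<subseteq> T} \<noteq> 2)"

definition biased_expansion ::
  "('v, 'f) biased_graph \<Rightarrow> ('f \<Rightarrow> 'e) \<Rightarrow> ('v, 'e) mgraph \<Rightarrow> bool" where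
  "biased_expansion \<Omega> p \<Delta> \<longleftrightarrow>
     is_biased_graph \<Omega> \<and> wf_graph \<Delta> \<and>
     verts \<Omega> = verts \<Delta> \<and> p ` edges \<Omega> = edges \<Delta> \<and>
     (\<forall>f\<in>edges \<Omega>. ends \<Delta> (p f) = ends \<Omega> f) \<and>
     (\<forall>f\<in>edges \<Omega>. \<forall>g\<in>edges \<Omega>. f \<noteq> g \<and> p f = p g \<longrightarrow> {f, g} \<notin> balanced \<Omega>) \<and>
     (\<forall>es e fs. circle_seq \<Delta> (es @ [e]) \<and> set fs \<subseteq> edges \<Omega> \<and> map p fs = es \<longrightarrow>
        (\<exists>!f. f \<in> edges \<Omega> \<and> p f = e \<and> set (fs @ [f]) \<in> balanced \<Omega>))"

text \<open>Isomorphism of biased expansions that is the identity on nodes and on the base.\<close>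

definition expansion_iso ::
  "('f \<Rightarrow> 'g) \<Rightarrow> ('v, 'f) biased_graph \<Rightarrow> ('f \<Rightarrow> 'e) \<Rightarrow> ('v, 'g) biased_graph \<Rightarrow> ('g \<Rightarrow> 'e) \<Rightarrow> bool"
  where
  "expansion_iso \<phi> \<Omega> p \<Omega>' p' \<longleftrightarrow>
     verts \<Omega> = verts \<Omega>' \<and> bij_betw \<phi> (edges \<Omega>) (edges \<Omega>') \<and>
     (\<forall>f\<in>edges \<Omega>. ends \<Omega>' (\<phi> f) = ends \<Omega> f \<and> p' (\<phi> f) = p f) \<and>
     balanced \<Omega>' = (`) \<phi> ` balanced \<Omega>"

definition proj_preimage ::
  "('v, 'f) biased_graph \<Rightarrow> ('f \<Rightarrow> 'e) \<Rightarrow> ('v, 'e) mgraph \<Rightarrow> ('v, 'f) biased_graph" where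
  "proj_preimage \<Omega> p \<Delta> =
     \<lparr>verts = verts \<Delta>, edges = {f \<in> edges \<Omega>. p f \<in> edges \<Delta>}, ends = ends \<Omega>,
      balanced = {C \<in> balanced \<Omega>. C \<subseteq> {f \<in> edges \<Omega>. p f \<in> edges \<Delta>}}\<rparr>"


section \<open>Extensions\<close>

text \<open>The edges of \<open>\<Omega>'\<close> may be of another type than those of \<open>\<Omega>\<close>, since the type of the latter
  need not have room for new edges. Hence \<open>\<Omega>\<close> is identified with the preimage of \<open>\<Delta>\<close> in \<open>\<Omega>'\<close> by
  means of the inclusion map \<open>i\<close>.\<close>

definition extension ::
  "('f \<Rightarrow> 'g) \<Rightarrow> ('v, 'f) biased_graph \<Rightarrow> ('f \<Rightarrow> 'e) \<Rightarrow> ('v, 'e) mgraph \<Rightarrow>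
   ('v, 'g) biased_graph \<Rightarrow> ('g \<Rightarrow> 'e) \<Rightarrow> ('v, 'e) mgraph \<Rightarrow> bool" where
  "extension i \<Omega> p \<Delta> \<Omega>' p' \<Delta>' \<longleftrightarrow>
     biased_expansion \<Omega>' p' \<Delta>' \<and> spanning_subgraph \<Delta> \<Delta>' \<and>
     expansion_iso i \<Omega> p (proj_preimage \<Omega>' p' \<Delta>) p'"

text \<open>In the next two definitions the edges of the extension are of type \<open>'v set \<times> 'f\<close>, where \<open>'f\<close>
  is the type of the edges of the expansion being extended. This is no restriction. A proper simple
  extension restricts to one that adds a single link \<open>e\<close>. If \<open>e\<close> lies on a circle, the length of
  which is at least 3, the circle lifting property and the theta property make the fiber of \<open>e\<close>
  equipotent to that of another edge of the circle, so it has a copy in \<open>{e} \<times> UNIV\<close>. If \<open>e\<close> lies on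
  no circle, the fiber may be cut down to a single edge. The old edges \<open>f\<close> become \<open>(p f, f)\<close>.\<close>

definition extends_to ::
  "('v, 'f) biased_graph \<Rightarrow> ('f \<Rightarrow> 'v set) \<Rightarrow> ('v, 'v set) mgraph \<Rightarrow> 'v set \<Rightarrow> bool" where
  "extends_to \<Omega> p \<Delta> e \<longleftrightarrow>
     (\<exists>i (\<Omega>' :: ('v, 'v set \<times> 'f) biased_graph) p'. extension i \<Omega> p \<Delta> \<Omega>' p' (add_links \<Delta> {e}))"

definition has_proper_simple_extension ::
  "('v, 'f) biased_graph \<Rightarrow> ('f \<Rightarrow> 'v set) \<Rightarrow> ('v, 'v set) mgraph \<Rightarrow> bool" where
  "has_proper_simple_extension \<Omega> p \<Delta> \<longleftrightarrow>
     (\<exists>i (\<Omega>' :: ('v, 'v set \<times> 'f) biased_graph) p' \<Delta>'.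
        extension i \<Omega> p \<Delta> \<Omega>' p' \<Delta>' \<and> simple_graph \<Delta>' \<and> \<Delta>' \<noteq> \<Delta>)"

text \<open>A maximal extension is itself required to be simple: an extension that is not simple has no
  simple extension at all.\<close>

definition maximal_extension ::
  "('f \<Rightarrow> 'g) \<Rightarrow> ('v, 'f) biased_graph \<Rightarrow> ('f \<Rightarrow> 'v set) \<Rightarrow> ('v, 'v set) mgraph \<Rightarrow>
   ('v, 'g) biased_graph \<Rightarrow> ('g \<Rightarrow> 'v set) \<Rightarrow> ('v, 'v set) mgraph \<Rightarrow> bool" where
  "maximal_extension i \<Omega> p \<Delta> \<Omega>' p' \<Delta>' \<longleftrightarrow>
     extension i \<Omega> p \<Delta> \<Omega>' p' \<Delta>' \<and> simple_graph \<Delta>' \<and> \<not> has_proper_simple_extension \<Omega>' p' \<Delta>'"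

end

theory Submission
  imports Defs
begin

text \<open>
  Write \<open>\<Delta>\<close> for the base graph and let \<open>e\<close> join nonadjacent nodes \<open>u\<close>, \<open>v\<close>. An extension to \<open>e\<close> sends each
  lift of a path from \<open>u\<close> to \<open>v\<close> in \<open>\<Delta>\<close> to the edge over \<open>e\<close> that closes it to a balanced circle. If two
  such paths differ by an exchange along one circle of \<open>\<Delta>\<close>, the theta property in \<open>\<Omega>\<close> itself decides
  whether the images agree; finitely many exchanges lead from any path to a fixed pair of internally
  disjoint ones, so the extension to \<open>e\<close> is unique. A circle with several new links is split by a path
  of \<open>\<Delta>\<close> into circles with fewer of them, so an extension is determined by its restrictions to single
  links.

  Conversely, let extensions to \<open>e\<close> and to \<open>f\<close> be given. A circle through both is cut by some path \<open>R\<close> of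
  \<open>\<Delta>\<close> into a circle through \<open>e\<close> and one through \<open>f\<close>; a lift of it is called balanced if \<open>R\<close> has a lift
  that balances both. This does not depend on \<open>R\<close>, again by exchanges, and it yields an extension to
  both links. Hence, by induction and uniqueness, there is an extension to any finite set of links in
  \<open>X\<close>, and since circles and theta graphs are finite, also to \<open>X\<close>.
\<close>

subsection \<open>Paths, circles and thetas as edge sets\<close>

text \<open>What shapes the proof is that two chords of a circle may overlap in any manner, and a
  lift prescribed on one then constrains the other. So they are not compared directly: each is moved
  to one of two chords without a common edge, whose lifts can be prescribed independently. Each
  exchange circle lies in \<Delta>, where the two balance classes at hand agree with that of
  \<Omega>; one changed label therefore makes it balanced for both at once, and the exchange
  preserves balance on the side of \<open>e\<close> and on that of \<open>f\<close> together.
  Uniqueness over one link is the same comparison with \<open>e = f\<close>. Gluing moves new links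
  into the base, so there 2-connectedness enters in a form that survives the addition of links.
  Because the base is simple, its paths, circles and thetas are sets of links; edge sequences and
  parallel edges return only in the translation to and from biased expansions.\<close>

inductive upath :: "'v \<Rightarrow> 'v \<Rightarrow> 'v set \<Rightarrow> 'v set set \<Rightarrow> bool" where
  upath_refl: "upath a a {a} {}"
| upath_step: "upath b c W D \<Longrightarrow> a \<notin> W \<Longrightarrow> upath a c (insert a W) (insert {a, b} D)"

lemma upath_ends: "upath a b W D \<Longrightarrow> a \<in> W \<and> b \<in> W"
  by (induction rule: upath.induct) auto

lemma upath_finite: "upath a b W D \<Longrightarrow> finite W \<and> finite D"
  by (induction rule: upath.induct) auto

lemma upath_edge: "upath a b W D \<Longrightarrow> d \<in> D \<Longrightarrow> d \<subseteq> W \<and> card d = 2"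
  by (induction rule: upath.induct) (auto dest: upath_ends simp: card_insert_if)

lemma upath_avoid: "upath b c W D \<Longrightarrow> a \<notin> W \<Longrightarrow> d \<in> D \<Longrightarrow> a \<notin> d"
  using upath_edge[of b c W D d] by auto

lemma upath_Union: "upath a b W D \<Longrightarrow> \<Union>D \<subseteq> W"
  using upath_edge[of a b W D] by blast

lemma upath_verts: "upath a b W D \<Longrightarrow> W \<subseteq> insert a (\<Union>D)"
  by (induction rule: upath.induct) (auto dest: upath_ends)

lemma upath_loop: "upath a a W D \<Longrightarrow> W = {a} \<and> D = {}"
  by (erule upath.cases) (auto dest: upath_ends)

lemma upath_single: "a \<noteq> b \<Longrightarrow> upath a b {a, b} {{a, b}}"
  using upath_step[OF upath_refl, of a b] by auto

lemma upath_append: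
  "upath a b W1 D1 \<Longrightarrow> upath b c W2 D2 \<Longrightarrow> W1 \<inter> W2 = {b} \<Longrightarrow> upath a c (W1 \<union> W2) (D1 \<union> D2)"
proof (induction rule: upath.induct)
  case (upath_refl a)
  then show ?case by (simp add: insert_absorb upath_ends)
next
  case (upath_step x y W D a)
  have "W \<inter> W2 = {y}" "a \<notin> W2"
    using upath_step.prems upath_step.hyps upath_ends by fastforce+
  then have "upath x c (W \<union> W2) (D \<union> D2)" "a \<notin> W \<union> W2"
    using upath_step by auto
  then show ?case using upath.upath_step by fastforce
qed

lemma upath_rev: "upath a b W D \<Longrightarrow> upath b a W D"
proof (induction rule: upath.induct)
  case (upath_refl a) then show ?case by (rule upath.upath_refl)
next
  case (upath_step b c W D a)
  have "upath b a {b, a} {{b, a}}" using upath_step upath_ends by (metis upath_single)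
  moreover have "W \<inter> {b, a} = {b}" using upath_step upath_ends by fastforce
  ultimately have "upath c a (W \<union> {b, a}) (D \<union> {{b, a}})" using upath_step.IH upath_append by metis
  moreover have "W \<union> {b, a} = insert a W" using upath_step upath_ends by fastforce
  ultimately show ?case by (simp add: insert_commute)
qed

lemma upath_cons: "upath b c W D \<Longrightarrow> a \<notin> W \<Longrightarrow> {a, b} = e \<Longrightarrow> upath a c (insert a W) (insert e D)"
  using upath_step by metis

lemma upath_first:
  "upath a b W D \<Longrightarrow> a \<noteq> b \<Longrightarrow>
    \<exists>c W' D'. upath c b W' D' \<and> a \<notin> W' \<and> W = insert a W' \<and> D = insert {a, c} D'"
  by (erule upath.cases) auto

lemma upath_split:
  "upath a c W D \<Longrightarrow> b \<in> W \<Longrightarrow>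
    \<exists>W1 D1 W2 D2. upath a b W1 D1 \<and> upath b c W2 D2 \<and> W = W1 \<union> W2 \<and> W1 \<inter> W2 = {b} \<and> D = D1 \<union> D2"
proof (induction rule: upath.induct)
  case (upath_refl a)
  then show ?case using upath.upath_refl[of a] by blast
next
  case (upath_step x c W D a)
  show ?case
  proof (cases "b = a")
    case True
    then show ?thesis using upath.upath_refl[of a] upath.upath_step[OF upath_step.hyps] by blast
  next
    case False
    then obtain W1 D1 W2 D2 where *: "upath x b W1 D1" "upath b c W2 D2" "W = W1 \<union> W2"
      "W1 \<inter> W2 = {b}" "D = D1 \<union> D2" using upath_step by blast
    have "upath a b (insert a W1) (insert {a, x} D1)"
      using * upath_step.hyps upath.upath_step by auto
    then show ?thesis using * upath_step.hyps by blast
  qed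
qed

text \<open>The path is followed only as far as its first node in \<open>S\<close>, which is why the
  initial part meets \<open>S\<close> in that node alone.\<close>

lemma upath_hit:
  "upath a c W D \<Longrightarrow> c \<in> S \<Longrightarrow>
    \<exists>b W1 D1 W2 D2. upath a b W1 D1 \<and> upath b c W2 D2 \<and> W = W1 \<union> W2 \<and> W1 \<inter> W2 = {b} \<and>
      D = D1 \<union> D2 \<and> W1 \<inter> S = {b}"
proof (induction rule: upath.induct)
  case (upath_refl a)
  then show ?case using upath.upath_refl[of a] by blast
next
  case (upath_step x c W D a)
  show ?case
  proof (cases "a \<in> S")
    case True
    then show ?thesis using upath.upath_refl[of a] upath.upath_step[OF upath_step.hyps] by blast
  next
    case False
    then obtain b W1 D1 W2 D2 where *: "upath x b W1 D1" "upath b c W2 D2" "W = W1 \<union> W2"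
      "W1 \<inter> W2 = {b}" "D = D1 \<union> D2" "W1 \<inter> S = {b}" using upath_step by blast
    have "upath a b (insert a W1) (insert {a, x} D1)"
      using * upath_step.hyps upath.upath_step by auto
    then show ?thesis using * upath_step.hyps False by blast
  qed
qed

lemma upath_edge_split:
  "upath a b W D \<Longrightarrow> d \<in> D \<Longrightarrow>
    \<exists>x y W1 D1 W2 D2. d = {x, y} \<and> upath a x W1 D1 \<and> upath y b W2 D2 \<and> W = W1 \<union> W2 \<and>
      W1 \<inter> W2 = {} \<and> D = insert d (D1 \<union> D2) \<and> d \<notin> D1 \<and> d \<notin> D2"
proof (induction rule: upath.induct)
  case (upath_refl a)
  then show ?case by simp
next
  case (upath_step x c W D a)
  show ?case
  proof (cases "d = {a, x}")
    case True
    then have "d \<notin> D" using upath_avoid[OF upath_step.hyps, of d] by auto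
    then show ?thesis using True upath_step.hyps upath.upath_refl[of a] by blast
  next
    case False
    then obtain y z W1 D1 W2 D2 where *: "d = {y, z}" "upath x y W1 D1" "upath z c W2 D2" "W = W1 \<union> W2"
      "W1 \<inter> W2 = {}" "D = insert d (D1 \<union> D2)" "d \<notin> D1" "d \<notin> D2" using upath_step by blast
    have "upath a y (insert a W1) (insert {a, x} D1)"
      using * upath_step.hyps upath.upath_step by auto
    moreover have "insert a W1 \<inter> W2 = {}" "d \<notin> insert {a, x} D1"
      using * upath_step.hyps False by auto
    ultimately show ?thesis using * by blast
  qed
qed

text \<open>A common edge would bring two common nodes.\<close>

lemma upath_disj: "upath a b W1 D1 \<Longrightarrow> upath c d W2 D2 \<Longrightarrow> W1 \<inter> W2 \<subseteq> {x} \<Longrightarrow> D1 \<inter> D2 = {}"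
proof (rule ccontr)
  assume *: "upath a b W1 D1" "upath c d W2 D2" "W1 \<inter> W2 \<subseteq> {x}" "D1 \<inter> D2 \<noteq> {}"
  then obtain e where "e \<subseteq> W1 \<inter> W2" "card e = 2" using upath_edge by (metis disjoint_iff le_inf_iff)
  then show False using *(3) card_mono[of "{x}" e] by (auto dest: order_trans)
qed

lemma upath_direct: "upath a b W D \<Longrightarrow> {a, b} \<in> D \<Longrightarrow> W = {a, b} \<and> D = {{a, b}}"
proof -
  assume *: "upath a b W D" "{a, b} \<in> D"
  then have "a \<noteq> b" using upath_loop by fastforce
  then obtain c W' D' where c: "upath c b W' D'" "a \<notin> W'" "W = insert a W'" "D = insert {a, c} D'"
    using upath_first *(1) by metis
  then have "c = b" using *(2) upath_edge by (metis doubleton_eq_iff insert_iff insert_subset)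
  then have "W' = {b} \<and> D' = {}" using c(1) upath_loop by metis
  then show ?thesis using c \<open>c = b\<close> by simp
qed

text \<open>A shared link has both ends in \<open>{a, b}\<close>, and a path that contains the link
  between its own ends is that link. This is the one way in which internally disjoint paths fail to
  be edge-disjoint.\<close>

lemma upath_meet:
  assumes "upath a b W1 D1" "upath a b W2 D2" "W1 \<inter> W2 = {a, b}" "d \<in> D1 \<inter> D2"
  shows "d = {a, b} \<and> D1 = {{a, b}} \<and> D2 = {{a, b}} \<and> W1 = {a,b} \<and> W2 = {a,b}"
proof -
  have "d \<subseteq> {a, b}" "card d = 2" using assms upath_edge by (metis Int_iff le_inf_iff)+
  moreover have "card {a, b} \<le> 2" by (simp add: card_insert_if)
  ultimately have "d = {a, b}" using card_seteq[of "{a, b}" d] by simp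
  moreover have "d \<in> D1" "d \<in> D2" using assms(4) by blast+
  ultimately show ?thesis using upath_direct[OF assms(1)] upath_direct[OF assms(2)] by simp
qed

text \<open>Only one link of the whole path is incident with its first node, so two decompositions
  at \<open>q\<close> start alike, and induction removes that link. The lemma matches pieces
  obtained by cutting one edge set in different ways.\<close>

lemma upath_split_unique:
  "upath a q W1 D1 \<Longrightarrow> upath q b W2 D2 \<Longrightarrow> W1 \<inter> W2 = {q} \<Longrightarrow>
   upath a q W1' D1' \<Longrightarrow> upath q b W2' D2' \<Longrightarrow> W1' \<inter> W2' = {q} \<Longrightarrow> D1 \<union> D2 = D1' \<union> D2' \<Longrightarrow>
   W1 = W1' \<and> D1 = D1'"
proof (induction arbitrary: W1' D1' rule: upath.induct)
  case (upath_refl a)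
  then show ?case using upath_loop[OF upath_refl.prems(3)] by simp
next
  case (upath_step x q W D a)
  have "q \<in> W" using upath_step.hyps upath_ends by metis
  then have aq: "a \<noteq> q" using upath_step.hyps by blast
  obtain y W' D' where y: "upath y q W' D'" "a \<notin> W'" "W1' = insert a W'" "D1' = insert {a, y} D'"
    using upath_first upath_step.prems(3) aq by metis
  have q': "q \<in> W'" "x \<in> W" "y \<in> W'" using y upath_ends upath_step.hyps by metis+
  have a2: "a \<notin> W2" "a \<notin> W2'" using upath_step.prems aq y by auto
  have na: "\<forall>d \<in> D \<union> D2. a \<notin> d" "\<forall>d \<in> D' \<union> D2'. a \<notin> d"
    using upath_avoid[OF upath_step.hyps(1,2)] upath_avoid[OF upath_step.prems(1) a2(1)]
      upath_avoid[OF y(1,2)] upath_avoid[OF upath_step.prems(4) a2(2)] by auto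
  have "{a, x} \<in> insert {a, x} D \<union> D2" by simp
  then have "{a, x} \<in> D1' \<union> D2'" unfolding upath_step.prems(6) .
  then have "{a, x} = {a, y}" using y(4) na(2) by auto
  then have xy: "x = y" by (metis doubleton_eq_iff)
  have "D \<union> D2 = D' \<union> D2'"
  proof -
    have "insert {a, x} (D \<union> D2) = insert {a, x} (D' \<union> D2')" using upath_step.prems(6) y(4) xy by simp
    moreover have "{a, x} \<notin> D \<union> D2" "{a, x} \<notin> D' \<union> D2'" using na by auto
    ultimately show ?thesis by (simp add: insert_ident)
  qed
  moreover have "W \<inter> W2 = {q}" "W' \<inter> W2' = {q}" using upath_step.prems y a2 \<open>q \<in> W\<close> q' by auto
  ultimately have "W = W' \<and> D = D'"
    using upath_step.IH upath_step.prems(1,4) y xy by blast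
  then show ?case using y xy by simp
qed

section \<open>Circles of length at least 3\<close>

definition circ :: "'v set set \<Rightarrow> bool" where
  "circ C \<longleftrightarrow> (\<exists>a b W D. upath a b W D \<and> a \<noteq> b \<and> {a, b} \<notin> D \<and> C = insert {a, b} D)"

lemma circ_paths:
  assumes "upath a b W1 D1" "upath a b W2 D2" "W1 \<inter> W2 = {a, b}" "D1 \<inter> D2 = {}" "a \<noteq> b"
  shows "circ (D1 \<union> D2)"
proof -
  obtain c W D where c: "upath c b W D" "a \<notin> W" "W1 = insert a W" "D1 = insert {a, c} D"
    using upath_first[OF assms(1,5)] by metis
  have "W \<inter> W2 = {b}" using c(2,3) assms(3) upath_ends[OF c(1)] by auto
  then have "upath c a (W \<union> W2) (D \<union> D2)" using upath_append[OF c(1) upath_rev[OF assms(2)]] by simp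
  moreover have "{a, c} \<notin> D \<union> D2" using upath_avoid[OF c(1,2), of "{a, c}"] c(4) assms(4) by auto
  moreover have "c \<noteq> a" using c upath_ends by metis
  ultimately show ?thesis unfolding circ_def using c
    by (metis Un_insert_left insert_commute)
qed

text \<open>The path is cut at \<open>e\<close>; its two pieces, joined through the former closing
  link, form the path that \<open>e\<close> closes. Thus the link singled out in the definition of
  \<open>circ\<close> can be any link of the circle.\<close>

lemma circ_edge:
  assumes "circ C" "e \<in> C"
  obtains a b W D where "e = {a, b}" "a \<noteq> b" "upath a b W D" "e \<notin> D" "C = insert e D"
proof -
  obtain a b W D where c: "upath a b W D" "a \<noteq> b" "{a, b} \<notin> D" "C = insert {a, b} D"
    using assms circ_def by metis
  show thesis
  proof (cases "e = {a, b}")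
    case True then show ?thesis using c that by metis
  next
    case False
    then have "e \<in> D" using assms(2) c(4) by simp
    then obtain x y W1 D1 W2 D2 where d: "e = {x, y}" "upath a x W1 D1" "upath y b W2 D2"
      "W = W1 \<union> W2" "W1 \<inter> W2 = {}" "D = insert e (D1 \<union> D2)" "e \<notin> D1" "e \<notin> D2"
      using upath_edge_split[OF c(1)] by metis
    have aW: "a \<notin> W2" "a \<in> W1" using d upath_ends by (metis disjoint_iff)+
    have "upath a y (insert a W2) (insert {a, b} D2)"
      using upath_step[OF upath_rev[OF d(3)] aW(1)] .
    moreover have "W1 \<inter> insert a W2 = {a}" using d aW by auto
    ultimately have "upath x y (W1 \<union> insert a W2) (D1 \<union> insert {a, b} D2)"
      using upath_append upath_rev[OF d(2)] by metis
    moreover have "e \<notin> D1 \<union> insert {a, b} D2" using d False by auto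
    moreover have "x \<noteq> y" using d upath_ends by (metis disjoint_iff)
    moreover have "C = insert e (D1 \<union> insert {a, b} D2)" using c d by auto
    ultimately show ?thesis using that d by metis
  qed
qed

lemma circ_edge_at:
  assumes "circ C" "e \<in> C" "a \<in> e"
  obtains c W D where "e = {a, c}" "a \<noteq> c" "upath a c W D" "e \<notin> D" "C = insert e D"
proof -
  obtain x y W D where c: "e = {x, y}" "x \<noteq> y" "upath x y W D" "e \<notin> D" "C = insert e D"
    using circ_edge assms(1,2) by metis
  show thesis
  proof (cases "a = x")
    case True then show ?thesis using c that by metis
  next
    case False
    then have "e = {a, x}" "a = y" using c(1) assms(3) by auto
    then show ?thesis using c that upath_rev[OF c(3)] by metis
  qed
qed

lemma circ_two_edges:
  assumes "circ C" "e \<in> C" "f \<in> C" "e \<noteq> f"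
  obtains u v x y P DP Q DQ where "e = {u, v}" "f = {x, y}" "upath v x P DP" "upath y u Q DQ"
    "P \<inter> Q = {}" "C = insert e (insert f (DP \<union> DQ))" "e \<notin> DP \<union> DQ" "f \<notin> DP \<union> DQ"
proof -
  obtain v u W D where c: "e = {v, u}" "upath v u W D" "e \<notin> D" "C = insert e D"
    using circ_edge[OF assms(1,2)] by (metis insert_commute upath_rev)
  then have "f \<in> D" using assms(3,4) by simp
  then obtain x y W1 D1 W2 D2 where d: "f = {x, y}" "upath v x W1 D1" "upath y u W2 D2"
      "W = W1 \<union> W2" "W1 \<inter> W2 = {}" "D = insert f (D1 \<union> D2)" "f \<notin> D1" "f \<notin> D2"
    using upath_edge_split[OF c(2)] by metis
  show thesis
    by (rule that[of u v x y W1 D1 W2 D2]) (use c d in auto)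
qed

lemma circ_card2: "circ C \<Longrightarrow> e \<in> C \<Longrightarrow> card e = 2"
  by (auto simp: circ_def dest: upath_edge)

lemma circ_finite: "circ C \<Longrightarrow> finite C"
  by (auto simp: circ_def dest: upath_finite)

lemma circ_two_verts:
  assumes "circ C" "a \<in> \<Union>C" "b \<in> \<Union>C" "a \<noteq> b"
  obtains W1 D1 W2 D2 where "upath a b W1 D1" "upath a b W2 D2" "W1 \<inter> W2 = {a, b}" "D1 \<inter> D2 = {}"
    "C = D1 \<union> D2"
proof -
  obtain e where e: "e \<in> C" "a \<in> e" using assms(2) by auto
  obtain c W D where c: "e = {a, c}" "upath a c W D" "a \<noteq> c" "e \<notin> D" "C = insert e D"
    using circ_edge_at[OF assms(1) e] by metis
  have "c \<in> W" "a \<in> W" using upath_ends[OF c(2)] by auto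
  then have "\<Union>C \<subseteq> W" using c(1,5) upath_Union[OF c(2)] by auto
  then have "b \<in> W" using assms(3) by auto
  then obtain W1 D1 W2 D2 where d: "upath a b W1 D1" "upath b c W2 D2" "W = W1 \<union> W2"
    "W1 \<inter> W2 = {b}" "D = D1 \<union> D2" using upath_split[OF c(2)] by metis
  have "a \<notin> W2" using d(4) assms(4) upath_ends[OF d(1)] by auto
  then have "upath a b (insert a W2) (insert e D2)"
    using upath_step[OF upath_rev[OF d(2)]] c(1) by simp
  moreover have "W1 \<inter> insert a W2 = {a, b}" using d(4) upath_ends[OF d(1)] by auto
  moreover have "D1 \<inter> insert e D2 = {}" using c(4) d(4,5) upath_disj[OF d(1,2), of b] by auto
  ultimately show ?thesis using that d c by (metis Un_insert_right)
qed

lemma circ_degree: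
  assumes "circ C" "e \<in> C" "x \<in> e"
  shows "\<exists>!f. f \<in> C \<and> f \<noteq> e \<and> x \<in> f"
proof -
  obtain c W D where c: "e = {x, c}" "upath x c W D" "x \<noteq> c" "e \<notin> D" "C = insert e D"
    using circ_edge_at[OF assms] by metis
  obtain d W' D' where d: "upath d c W' D'" "x \<notin> W'" "W = insert x W'" "D = insert {x, d} D'"
    using upath_first[OF c(2,3)] by metis
  have "\<forall>g\<in>D'. x \<notin> g" using upath_avoid[OF d(1,2)] by auto
  then have "g \<in> D \<and> x \<in> g \<longleftrightarrow> g = {x, d}" for g using d(4) by auto
  then have "g \<in> C \<and> g \<noteq> e \<and> x \<in> g \<longleftrightarrow> g = {x, d}" for g using c(4,5) by blast
  then show ?thesis by auto
qed

text \<open>Edge-disjointness is a separate requirement because two of the paths could otherwise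
  both be the link from \<open>a\<close> to \<open>b\<close>.\<close>

definition utheta where
  "utheta a b W1 D1 W2 D2 W3 D3 \<longleftrightarrow> a \<noteq> b \<and>
     upath a b W1 D1 \<and> upath a b W2 D2 \<and> upath a b W3 D3 \<and>
     W1 \<inter> W2 = {a, b} \<and> W1 \<inter> W3 = {a, b} \<and> W2 \<inter> W3 = {a, b} \<and>
     D1 \<inter> D2 = {} \<and> D1 \<inter> D3 = {} \<and> D2 \<inter> D3 = {}"

lemma utheta_perm:
  assumes "utheta a b W1 D1 W2 D2 W3 D3"
  shows "utheta a b W2 D2 W1 D1 W3 D3" "utheta a b W1 D1 W3 D3 W2 D2" "utheta a b W3 D3 W2 D2 W1 D1"
    "utheta a b W2 D2 W3 D3 W1 D1" "utheta a b W3 D3 W1 D1 W2 D2" "utheta b a W1 D1 W2 D2 W3 D3"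
  using assms unfolding utheta_def by (simp_all add: Int_commute insert_commute upath_rev) auto

lemma utheta_circ:
  assumes "utheta a b W1 D1 W2 D2 W3 D3"
  shows "circ (D1 \<union> D2)" "circ (D1 \<union> D3)" "circ (D2 \<union> D3)"
  using assms circ_paths unfolding utheta_def by metis+

lemma upath_nonempty: "upath a b W D \<Longrightarrow> a \<noteq> b \<Longrightarrow> D \<noteq> {}"
  using upath_first by (metis insert_not_empty)

text \<open>A circle that comes in through \<open>d\<close> must leave \<open>y\<close> by a second
  link, and the last hypothesis leaves only the next link of the path; this repeats until
  \<open>b\<close>.\<close>

lemma circ_follow:
  "upath y b W D \<Longrightarrow> circ C \<Longrightarrow> d \<in> C \<Longrightarrow> d \<inter> W = {y} \<Longrightarrow>
    \<forall>x\<in>W - {b}. \<forall>g\<in>C. x \<in> g \<longrightarrow> g \<in> insert d D \<Longrightarrow> D \<subseteq> C"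
proof (induction arbitrary: d rule: upath.induct)
  case (upath_refl a)
  then show ?case by simp
next
  case (upath_step y' b W D y)
  have yb: "y \<noteq> b" using upath_step.hyps(2) upath_ends[OF upath_step.hyps(1)] by auto
  have yd: "y \<in> d" using upath_step.prems by blast
  obtain g where g: "g \<in> C" "g \<noteq> d" "y \<in> g" using circ_degree[OF upath_step.prems(1,2) yd] by metis
  then have "g \<in> insert {y, y'} D" using upath_step.prems(4) yb by blast
  then have gy: "g = {y, y'}" using g(3) upath_avoid[OF upath_step.hyps] by auto
  have y': "y' \<in> W" using upath_ends[OF upath_step.hyps(1)] by auto
  have "D \<subseteq> C"
  proof (rule upath_step.IH[of g])
    show "g \<inter> W = {y'}" using gy y' upath_step.hyps by auto
    show "\<forall>x\<in>W - {b}. \<forall>h\<in>C. x \<in> h \<longrightarrow> h \<in> insert g D"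
    proof (intro ballI impI)
      fix x h assume x: "x \<in> W - {b}" "h \<in> C" "x \<in> h"
      then have "h \<in> insert d (insert {y, y'} D)" using upath_step.prems(4) by blast
      moreover have "x \<notin> d" using x(1) upath_step.prems(3) upath_step.hyps(2) by auto
      ultimately show "h \<in> insert g D" using x gy by blast
    qed
  qed (use upath_step.prems g in auto)
  then show ?case using g gy by auto
qed

text \<open>From \<open>d\<close> the circle is followed in both directions, to \<open>b\<close> and
  to \<open>a\<close>.\<close>

lemma circ_through:
  assumes "upath a b W D" "circ C" "d \<in> C" "d \<in> D"
    and "\<forall>x\<in>W - {a, b}. \<forall>g\<in>C. x \<in> g \<longrightarrow> g \<in> D"
  shows "D \<subseteq> C"
proof -
  obtain x y W1 D1 W2 D2 where d: "d = {x, y}" "upath a x W1 D1" "upath y b W2 D2"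
      "W = W1 \<union> W2" "W1 \<inter> W2 = {}" "D = insert d (D1 \<union> D2)"
    using upath_edge_split[OF assms(1,4)] by metis
  have e: "x \<in> W1" "y \<in> W2" "a \<in> W1" "b \<in> W2" using upath_ends[OF d(2)] upath_ends[OF d(3)] by auto
  have dj: "z \<in> W1 \<Longrightarrow> z \<notin> W2" for z using d(5) by auto
  have *: "\<forall>z\<in>W1. \<forall>g\<in>D2. z \<notin> g" "\<forall>z\<in>W2. \<forall>g\<in>D1. z \<notin> g"
    using upath_avoid[OF d(3)] upath_avoid[OF d(2)] dj by metis+
  have "D2 \<subseteq> C"
  proof (rule circ_follow[OF d(3) assms(2,3)])
    show "d \<inter> W2 = {y}" using d e by auto
    show "\<forall>z\<in>W2 - {b}. \<forall>g\<in>C. z \<in> g \<longrightarrow> g \<in> insert d D2"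
    proof (intro ballI impI)
      fix z g assume z: "z \<in> W2 - {b}" "g \<in> C" "z \<in> g"
      then have "z \<in> W - {a, b}" using d(4,5) e by auto
      then have "g \<in> D" using assms(5) z by blast
      then show "g \<in> insert d D2" using *(2) z d(6) by auto
    qed
  qed
  moreover have "D1 \<subseteq> C"
  proof (rule circ_follow[OF upath_rev[OF d(2)] assms(2,3)])
    show "d \<inter> W1 = {x}" using d e by auto
    show "\<forall>z\<in>W1 - {a}. \<forall>g\<in>C. z \<in> g \<longrightarrow> g \<in> insert d D1"
    proof (intro ballI impI)
      fix z g assume z: "z \<in> W1 - {a}" "g \<in> C" "z \<in> g"
      then have "z \<in> W - {a, b}" using d(4,5) e by auto
      then have "g \<in> D" using assms(5) z by blast
      then show "g \<in> insert d D1" using *(1) z d(6) by auto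
    qed
  qed
  ultimately show ?thesis using d assms by auto
qed

lemma utheta_inner:
  assumes "utheta a b W1 D1 W2 D2 W3 D3" "x \<in> W1 - {a, b}" "g \<in> D1 \<union> D2 \<union> D3" "x \<in> g"
  shows "g \<in> D1"
proof -
  have "x \<notin> W2" "x \<notin> W3" using assms by (auto simp: utheta_def)
  then show ?thesis using assms upath_avoid[of _ _ W2 D2 x g] upath_avoid[of _ _ W3 D3 x g]
    unfolding utheta_def by auto
qed

lemma upath_edge_at: "upath a b W D \<Longrightarrow> a \<noteq> b \<Longrightarrow> \<exists>!d. d \<in> D \<and> a \<in> d"
proof -
  assume *: "upath a b W D" "a \<noteq> b"
  obtain c W' D' where c: "upath c b W' D'" "a \<notin> W'" "D = insert {a, c} D'"
    using upath_first[OF *] by metis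
  have "\<forall>g\<in>D'. a \<notin> g" using upath_avoid[OF c(1,2)] by auto
  then have "d \<in> D \<and> a \<in> d \<longleftrightarrow> d = {a, c}" for d using c(3) by auto
  then show ?thesis by auto
qed

text \<open>Each of the three paths is contained in \<open>C\<close> or disjoint from it, because
  \<open>C\<close> cannot leave a path at an inner node. At \<open>a\<close> the circle uses exactly
  two links, hence exactly two of the paths.\<close>

lemma utheta_circles:
  assumes T: "utheta a b W1 D1 W2 D2 W3 D3" and C: "circ C" "C \<subseteq> D1 \<union> D2 \<union> D3"
  shows "C = D1 \<union> D2 \<or> C = D1 \<union> D3 \<or> C = D2 \<union> D3"
proof -
  have whole: "D1 \<inter> C = {} \<or> D1 \<subseteq> C"
    if "utheta a b W1 D1 W2 D2 W3 D3" "C \<subseteq> D1 \<union> D2 \<union> D3" for W1 D1 W2 D2 W3 D3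
  proof (cases "D1 \<inter> C = {}")
    case False
    then obtain d where "d \<in> D1" "d \<in> C" by blast
    moreover have "upath a b W1 D1" using that(1) by (simp add: utheta_def)
    moreover have "\<forall>x\<in>W1 - {a, b}. \<forall>g\<in>C. x \<in> g \<longrightarrow> g \<in> D1"
      using utheta_inner[OF that(1)] that(2) by blast
    ultimately show ?thesis using circ_through C(1) by metis
  qed blast
  have w: "D1 \<inter> C = {} \<or> D1 \<subseteq> C" "D2 \<inter> C = {} \<or> D2 \<subseteq> C" "D3 \<inter> C = {} \<or> D3 \<subseteq> C"
    using whole[OF T] whole[OF utheta_perm(1)[OF T]] whole[OF utheta_perm(3)[OF T]] C by blast+
  obtain d1 d2 d3 where d: "d1 \<in> D1" "a \<in> d1" "d2 \<in> D2" "a \<in> d2" "d3 \<in> D3" "a \<in> d3"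
    using T upath_edge_at[of a b] unfolding utheta_def by metis
  have u: "\<And>d. d \<in> D1 \<and> a \<in> d \<Longrightarrow> d = d1" "\<And>d. d \<in> D2 \<and> a \<in> d \<Longrightarrow> d = d2"
     "\<And>d. d \<in> D3 \<and> a \<in> d \<Longrightarrow> d = d3"
    using T upath_edge_at[of a b] d unfolding utheta_def by metis+
  have ne: "d1 \<noteq> d2" "d1 \<noteq> d3" "d2 \<noteq> d3" using d T by (auto simp: utheta_def)
  have "C \<noteq> {}" using C by (auto simp: circ_def)
  then consider "d1 \<in> C" | "d2 \<in> C" | "d3 \<in> C" using w d C(2) by blast
  then have a1: "\<exists>f f'. f \<noteq> f' \<and> f \<in> C \<and> f' \<in> C \<and> a \<in> f \<and> a \<in> f'"
    by cases (use circ_degree[OF C(1)] d in metis)+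
  have a2: "\<not> (d1 \<in> C \<and> d2 \<in> C \<and> d3 \<in> C)" using circ_degree[OF C(1), of d1 a] d ne by metis
  have a3: "\<And>f. f \<in> C \<Longrightarrow> a \<in> f \<Longrightarrow> f = d1 \<or> f = d2 \<or> f = d3" using C(2) u by blast
  have a4: "(d1 \<in> C \<and> d2 \<in> C) \<or> (d1 \<in> C \<and> d3 \<in> C) \<or> (d2 \<in> C \<and> d3 \<in> C)" using a1 a3 by metis
  have i: "d1 \<in> C \<longleftrightarrow> D1 \<subseteq> C" "d2 \<in> C \<longleftrightarrow> D2 \<subseteq> C" "d3 \<in> C \<longleftrightarrow> D3 \<subseteq> C" using w d by blast+
  have j: "d1 \<notin> C \<longleftrightarrow> D1 \<inter> C = {}" "d2 \<notin> C \<longleftrightarrow> D2 \<inter> C = {}" "d3 \<notin> C \<longleftrightarrow> D3 \<inter> C = {}" using w d by blast+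
  show ?thesis using a2 a4 i j C(2) by blast
qed

text \<open>Starting from a common link \<open>e\<close>, the smaller circle has to run through the
  whole rest of the larger one.\<close>

lemma circ_subset_circ:
  assumes "circ C" "circ C'" "C \<subseteq> C'"
  shows "C = C'"
proof -
  obtain e where e: "e \<in> C" using assms by (auto simp: circ_def)
  then obtain a b W D where c: "e = {a, b}" "a \<noteq> b" "upath a b W D" "e \<notin> D" "C' = insert e D"
    using circ_edge[OF assms(2)] assms(3) by (metis subsetD)
  obtain g where g: "g \<in> C" "g \<noteq> e" using circ_degree[OF assms(1) e, of a] c(1) by auto
  then have "g \<in> D" using assms(3) c(5) by auto
  moreover have "\<forall>x\<in>W - {a, b}. \<forall>g\<in>C. x \<in> g \<longrightarrow> g \<in> D" using assms(3) c(1,5) by auto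
  ultimately have "D \<subseteq> C" using circ_through[OF c(3) assms(1) g(1)] by simp
  then show ?thesis using c(5) e assms(3) by auto
qed

subsection \<open>Balance as a predicate on sections\<close>

text \<open>An edge over a link \<open>e\<close> is encoded by a label in \<open>K e\<close>. Since a balanced circle contains no two
  parallel edges, it is given by a circle \<open>C\<close> of the base and a section \<open>s\<close> that picks a label over
  each link of \<open>C\<close>; \<open>b C s\<close> says that this lift of \<open>C\<close> is balanced. Nothing is said about \<open>b\<close> outside
  \<open>E\<close>, so that restriction to a subgraph does not change \<open>b\<close>.\<close>

definition theta_prop where
  "theta_prop K E b \<longleftrightarrow>
     (\<forall>C s t. (\<forall>e\<in>C. s e = t e) \<longrightarrow> b C s = b C t) \<and>
     (\<forall>x y W1 D1 W2 D2 W3 D3 s. utheta x y W1 D1 W2 D2 W3 D3 \<longrightarrow> D1 \<union> D2 \<union> D3 \<subseteq> E \<longrightarrow>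
        (\<forall>d\<in>D1 \<union> D2 \<union> D3. s d \<in> K d) \<longrightarrow> b (D1 \<union> D2) s \<longrightarrow> b (D1 \<union> D3) s \<longrightarrow> b (D2 \<union> D3) s)"

text \<open>Lifting is required at every link of the circle, since a set of links has no last
  member.\<close>

definition bexp :: "('v set \<Rightarrow> 'k set) \<Rightarrow> 'v set set \<Rightarrow> ('v set set \<Rightarrow> ('v set \<Rightarrow> 'k) \<Rightarrow> bool) \<Rightarrow> bool" where
  "bexp K E b \<longleftrightarrow> theta_prop K E b \<and>
     (\<forall>C e s. circ C \<longrightarrow> C \<subseteq> E \<longrightarrow> e \<in> C \<longrightarrow> (\<forall>d\<in>C - {e}. s d \<in> K d) \<longrightarrow>
        (\<exists>!k. k \<in> K e \<and> b C (s(e := k))))"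

definition agree where
  "agree K E b b' \<longleftrightarrow> (\<forall>C s. circ C \<longrightarrow> C \<subseteq> E \<longrightarrow> (\<forall>d\<in>C. s d \<in> K d) \<longrightarrow> b C s = b' C s)"

lemma theta_prop_cong: "theta_prop K E b \<Longrightarrow> (\<And>e. e \<in> C \<Longrightarrow> s e = t e) \<Longrightarrow> b C s = b C t"
  by (simp add: theta_prop_def)

lemma theta_prop_theta:
  "theta_prop K E b \<Longrightarrow> utheta x y W1 D1 W2 D2 W3 D3 \<Longrightarrow> D1 \<union> D2 \<union> D3 \<subseteq> E \<Longrightarrow>
   (\<And>d. d \<in> D1 \<union> D2 \<union> D3 \<Longrightarrow> s d \<in> K d) \<Longrightarrow> b (D1 \<union> D2) s \<Longrightarrow> b (D1 \<union> D3) s \<Longrightarrow> b (D2 \<union> D3) s"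
  unfolding theta_prop_def by meson

text \<open>This is the exchange of \<open>D2\<close> for \<open>D3\<close>: the theta property is
  applied in both directions, and \<open>D2 \<union> D3\<close> is the circle that decides.\<close>

lemma theta_prop_iff:
  assumes "theta_prop K E b" "utheta x y W1 D1 W2 D2 W3 D3" "D1 \<union> D2 \<union> D3 \<subseteq> E"
    "\<And>d. d \<in> D1 \<union> D2 \<union> D3 \<Longrightarrow> s d \<in> K d" "b (D2 \<union> D3) s"
  shows "b (D1 \<union> D2) s = b (D1 \<union> D3) s"
proof
  assume "b (D1 \<union> D2) s"
  show "b (D1 \<union> D3) s"
  proof (rule theta_prop_theta[OF assms(1) utheta_perm(1)[OF assms(2)]])
    show "b (D2 \<union> D1) s" using \<open>b (D1 \<union> D2) s\<close> by (simp add: Un_commute)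
  qed (use assms(3-5) in auto)
next
  assume "b (D1 \<union> D3) s"
  show "b (D1 \<union> D2) s"
  proof (rule theta_prop_theta[OF assms(1) utheta_perm(5)[OF assms(2)]])
    show "b (D3 \<union> D1) s" "b (D3 \<union> D2) s" using \<open>b (D1 \<union> D3) s\<close> assms(5) by (simp_all add: Un_commute)
  qed (use assms(3,4) in auto)
qed

lemma bexp_lift:
  assumes "bexp K E b" "circ C" "C \<subseteq> E" "e \<in> C" "\<And>d. d \<in> C - {e} \<Longrightarrow> s d \<in> K d"
  shows "\<exists>!k. k \<in> K e \<and> b C (s(e := k))"
  using assms(1)[unfolded bexp_def, THEN conjunct2, rule_format, OF assms(2-4)] assms(5) by simp

lemma bexp_theta_prop: "bexp K E b \<Longrightarrow> theta_prop K E b"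
  by (simp add: bexp_def)

text \<open>In \<open>N\<close>, paths from \<open>u\<close> to \<open>w\<close> and to \<open>w'\<close>, with edge sets \<open>A\<close> and \<open>A'\<close>, that part at
  a vertex \<open>c\<close>; \<open>J\<close> consists of the edges after \<open>c\<close>.\<close>

definition fork where
  "fork N u w w' A A' J \<longleftrightarrow> (\<exists>c WT T W1 J1 W2 J2. upath u c WT T \<and> upath c w W1 J1 \<and> upath c w' W2 J2 \<and>
     WT \<inter> W1 = {c} \<and> WT \<inter> W2 = {c} \<and> W1 \<inter> W2 = {c} \<and> WT \<subseteq> N \<and> W1 \<subseteq> N \<and> W2 \<subseteq> N \<and>
     A = T \<union> J1 \<and> A' = T \<union> J2 \<and> J = J1 \<union> J2)"

lemma fork_refl: "upath u w W D \<Longrightarrow> W \<subseteq> N \<Longrightarrow> fork N u w w D D {}"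
  unfolding fork_def
  by (rule exI[of _ w], rule exI[of _ W], rule exI[of _ D], rule exI[of _ "{w}"], rule exI[of _ "{}"],
      rule exI[of _ "{w}"], rule exI[of _ "{}"]) (use upath_ends[of u w W D] upath_refl[of w] in auto)

lemma fork_same: "fork N u w w A A' J \<Longrightarrow> A = A'"
proof -
  assume "fork N u w w A A' J"
  then obtain c WT T W1 J1 W2 J2 where *: "upath c w W1 J1" "upath c w W2 J2" "W1 \<inter> W2 = {c}"
    "A = T \<union> J1" "A' = T \<union> J2" unfolding fork_def by blast
  have "w = c" using *(3) upath_ends[OF *(1)] upath_ends[OF *(2)] by auto
  then have "J1 = {}" "J2 = {}" using *(1,2) upath_loop[of c] by auto
  then show ?thesis using * by simp
qed

lemma fork_path:
  assumes "fork N u w w' A A' J"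
  shows "\<exists>W. upath u w' W A' \<and> W \<subseteq> N"
proof -
  obtain c WT T W1 J1 W2 J2 where *: "upath u c WT T" "upath c w' W2 J2" "WT \<inter> W2 = {c}"
    "A' = T \<union> J2" "WT \<subseteq> N" "W2 \<subseteq> N" using assms unfolding fork_def by blast
  then show ?thesis using upath_append[OF *(1,2,3)] by (metis Un_least)
qed

text \<open>As seen from \<open>u\<close> the paths to \<open>q\<close> and \<open>q'\<close> part
  at \<open>q'\<close>, as seen from \<open>y\<close> they part at \<open>q\<close>. In both views
  the branches beyond the parting node amount to the segment between \<open>q\<close> and
  \<open>q'\<close>, so one set \<open>J\<close> serves both forks.\<close>

lemma fork_between_beyond:
  assumes y: "upath y q Qy Dy" "upath q u Qu Du" "Qy \<inter> Qu = {q}"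
    and y': "upath y q' Qy' Dy'" "upath q' u Qu' Du'" "Qy' \<inter> Qu' = {q'}"
    and eq: "Dy \<union> Du = Dy' \<union> Du'" and q': "q' \<in> Qu" and N: "Qy \<subseteq> N" "Qu \<subseteq> N"
  shows "\<exists>J. fork N u q q' Du Du' J \<and> fork N y q q' Dy Dy' J"
proof -
  obtain WJ J WT T where j: "upath q q' WJ J" "upath q' u WT T" "Qu = WJ \<union> WT" "WJ \<inter> WT = {q'}" "Du = J \<union> T"
    using upath_split[OF y(2) q'] by metis
  have q: "q \<in> WJ" "q' \<in> WJ" "q' \<in> WT" using upath_ends[OF j(1)] upath_ends[OF j(2)] by auto
  have a: "Qy \<inter> WJ = {q}" using y(3) j(3) q by auto
  have b: "upath y q' (Qy \<union> WJ) (Dy \<union> J)" using upath_append[OF y(1) j(1) a] .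
  have c: "(Qy \<union> WJ) \<inter> WT = {q'}" using y(3) j(3,4) q by auto
  have "Dy \<union> J = Dy'" using upath_split_unique[OF b j(2) c y'] eq j(5) by auto
  moreover have "T = Du'"
    using upath_split_unique[OF upath_rev[OF j(2)] upath_rev[OF b] _ upath_rev[OF y'(2)] upath_rev[OF y'(1)]]
      c y'(3) eq j(5) by (auto simp: Int_commute Un_commute Un_left_commute)
  moreover have "fork N u q q' (T \<union> J) T J" unfolding fork_def
    by (rule exI[of _ q'], rule exI[of _ WT], rule exI[of _ T], rule exI[of _ WJ], rule exI[of _ J],
        rule exI[of _ "{q'}"], rule exI[of _ "{}"])
       (use upath_rev[OF j(2)] upath_rev[OF j(1)] upath_refl[of q'] j(3,4) q N in auto)
  moreover have "fork N y q q' Dy (Dy \<union> J) J" unfolding fork_def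
    by (rule exI[of _ q], rule exI[of _ Qy], rule exI[of _ Dy], rule exI[of _ "{q}"], rule exI[of _ "{}"],
        rule exI[of _ WJ], rule exI[of _ J])
       (use y(1) j(1) upath_refl[of q] j(3) q a N in auto)
  ultimately show ?thesis using j(5) by (metis Un_commute)
qed

text \<open>If \<open>q'\<close> lies on the side of \<open>y\<close>, the path is read
  backwards.\<close>

lemma fork_between:
  assumes y: "upath y q Qy Dy" "upath q u Qu Du" "Qy \<inter> Qu = {q}"
    and y': "upath y q' Qy' Dy'" "upath q' u Qu' Du'" "Qy' \<inter> Qu' = {q'}"
    and eq: "Dy \<union> Du = Dy' \<union> Du'" and q': "Qy \<union> Qu = Qy' \<union> Qu'" and N: "Qy \<union> Qu \<subseteq> N"
  shows "\<exists>J. fork N u q q' Du Du' J \<and> fork N y q q' Dy Dy' J"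
proof -
  have "q' \<in> Qy \<union> Qu" using q' upath_ends[OF y'(1)] by auto
  then show ?thesis
  proof
    assume "q' \<in> Qu" then show ?thesis using fork_between_beyond[OF y y' eq] N by auto
  next
    assume "q' \<in> Qy"
    then show ?thesis
      using fork_between_beyond[OF upath_rev[OF y(2)] upath_rev[OF y(1)] _ upath_rev[OF y'(2)] upath_rev[OF y'(1)], of N]
        y(3) y'(3) eq N by (auto simp: Int_commute Un_commute)
  qed
qed

lemma disjoint_insert_Un2:
  "e \<notin> X \<union> Y \<union> Z \<Longrightarrow> A \<inter> X = {} \<Longrightarrow> A \<inter> Y = {} \<Longrightarrow> A \<inter> Z = {} \<Longrightarrow>
   B \<inter> X = {} \<Longrightarrow> B \<inter> Y = {} \<Longrightarrow> B \<inter> Z = {} \<Longrightarrow> (insert e A \<union> B) \<inter> (X \<union> Y \<union> Z) = {}"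
  by blast

text \<open>The forks are the rails of a ladder joined at one end by \<open>e\<close>, and
  \<open>R\<close>, \<open>S\<close> are its rungs. The two circles through \<open>e\<close> share
  the part from the parting node \<open>c\<close> through \<open>e\<close> to the parting node
  \<open>d\<close>. So \<open>c\<close> and \<open>d\<close> are the ends of the theta, and its
  third circle, made of the branches and the rungs, avoids \<open>e\<close>.\<close>

lemma ladder_theta:
  assumes fu: "fork N u w w' A A' J" and fv: "fork M v z z' B B' L" and NM: "N \<inter> M = {}"
    and r: "upath w z WR R" "WR \<inter> N = {w}" "WR \<inter> M = {z}"
    and s: "upath w' z' WS S" "WS \<inter> N = {w'}" "WS \<inter> M = {z'}"
    and RS: "WR \<inter> WS \<subseteq> N \<union> M" "R \<inter> S = {}"
    and e: "e = {u, v}" "e \<notin> A \<union> A' \<union> B \<union> B' \<union> R \<union> S"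
  obtains c d W0 D0 W1 D1 W2 D2 where "utheta c d W0 D0 W1 D1 W2 D2"
    "D0 \<union> D1 = insert e (A \<union> B \<union> R)" "D0 \<union> D2 = insert e (A' \<union> B' \<union> S)" "D1 \<union> D2 = J \<union> L \<union> R \<union> S"
    "S \<subseteq> D2"
proof -
  obtain c WT T W1 J1 W2 J2 where c: "upath u c WT T" "upath c w W1 J1" "upath c w' W2 J2"
     "WT \<inter> W1 = {c}" "WT \<inter> W2 = {c}" "W1 \<inter> W2 = {c}" "WT \<subseteq> N" "W1 \<subseteq> N" "W2 \<subseteq> N"
     "A = T \<union> J1" "A' = T \<union> J2" "J = J1 \<union> J2" using fu unfolding fork_def by metis
  obtain d VT U V1 L1 V2 L2 where d: "upath v d VT U" "upath d z V1 L1" "upath d z' V2 L2"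
     "VT \<inter> V1 = {d}" "VT \<inter> V2 = {d}" "V1 \<inter> V2 = {d}" "VT \<subseteq> M" "V1 \<subseteq> M" "V2 \<subseteq> M"
     "B = U \<union> L1" "B' = U \<union> L2" "L = L1 \<union> L2" using fv unfolding fork_def by metis
  have i: "u \<in> WT" "c \<in> WT" "c \<in> W1" "c \<in> W2" "w \<in> W1" "w' \<in> W2" "v \<in> VT" "d \<in> VT" "d \<in> V1" "d \<in> V2" "z \<in> V1" "z' \<in> V2"
    "w \<in> WR" "z \<in> WR" "w' \<in> WS" "z' \<in> WS"
    using upath_ends[OF c(1)] upath_ends[OF c(2)] upath_ends[OF c(3)] upath_ends[OF d(1)] upath_ends[OF d(2)]
      upath_ends[OF d(3)] upath_ends[OF r(1)] upath_ends[OF s(1)] by auto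
  have cap: "\<And>x. x \<in> N \<Longrightarrow> x \<in> M \<Longrightarrow> False" "\<And>x. x \<in> WR \<Longrightarrow> x \<in> N \<Longrightarrow> x = w" "\<And>x. x \<in> WR \<Longrightarrow> x \<in> M \<Longrightarrow> x = z"
     "\<And>x. x \<in> WS \<Longrightarrow> x \<in> N \<Longrightarrow> x = w'" "\<And>x. x \<in> WS \<Longrightarrow> x \<in> M \<Longrightarrow> x = z'" "\<And>x. x \<in> WR \<Longrightarrow> x \<in> WS \<Longrightarrow> x \<in> N \<or> x \<in> M"
     "\<And>x. x \<in> WT \<Longrightarrow> x \<in> W1 \<Longrightarrow> x = c" "\<And>x. x \<in> WT \<Longrightarrow> x \<in> W2 \<Longrightarrow> x = c" "\<And>x. x \<in> W1 \<Longrightarrow> x \<in> W2 \<Longrightarrow> x = c"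
     "\<And>x. x \<in> VT \<Longrightarrow> x \<in> V1 \<Longrightarrow> x = d" "\<And>x. x \<in> VT \<Longrightarrow> x \<in> V2 \<Longrightarrow> x = d" "\<And>x. x \<in> V1 \<Longrightarrow> x \<in> V2 \<Longrightarrow> x = d"
     "\<And>x. x \<in> WT \<Longrightarrow> x \<in> N" "\<And>x. x \<in> W1 \<Longrightarrow> x \<in> N" "\<And>x. x \<in> W2 \<Longrightarrow> x \<in> N"
     "\<And>x. x \<in> VT \<Longrightarrow> x \<in> M" "\<And>x. x \<in> V1 \<Longrightarrow> x \<in> M" "\<And>x. x \<in> V2 \<Longrightarrow> x \<in> M"
    using NM r(2,3) s(2,3) RS(1) c(4-9) d(4-9) by auto
  have "v \<notin> WT" using cap(1,13,16) i by metis
  then have p0a: "upath v c (insert v WT) (insert e T)" using upath_cons[OF c(1), of v e] e(1) by (simp add: insert_commute)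
  have "insert v WT \<inter> VT = {v}" using cap(1,13,16) i by blast
  then have p0: "upath c d (insert v WT \<union> VT) (insert e T \<union> U)"
    using upath_append[OF upath_rev[OF p0a] d(1)] by simp
  have path: "upath c d (Wa \<union> X \<union> Va) (Ja \<union> Y \<union> La)" if "upath c a Wa Ja" "upath a a' X Y" "upath d a' Va La"
    "Wa \<inter> X = {a}" "X \<inter> Va = {a'}" "Wa \<inter> Va = {}" for a a' Wa Ja X Y Va La
  proof -
    have "upath c a' (Wa \<union> X) (Ja \<union> Y)" using upath_append that by metis
    moreover have "(Wa \<union> X) \<inter> Va = {a'}" using that(5,6) by auto
    ultimately show ?thesis using upath_append upath_rev[OF that(3)] by metis
  qed
  have p1: "upath c d (W1 \<union> WR \<union> V1) (J1 \<union> R \<union> L1)"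
  proof (rule path[OF c(2) r(1) d(2)])
    show "W1 \<inter> WR = {w}" using cap(2,14) i by blast
    show "WR \<inter> V1 = {z}" using cap(3,17) i by blast
    show "W1 \<inter> V1 = {}" using cap(1,14,17) by blast
  qed
  have p2: "upath c d (W2 \<union> WS \<union> V2) (J2 \<union> S \<union> L2)"
  proof (rule path[OF c(3) s(1) d(3)])
    show "W2 \<inter> WS = {w'}" using cap(4,15) i by blast
    show "WS \<inter> V2 = {z'}" using cap(5,18) i by blast
    show "W2 \<inter> V2 = {}" using cap(1,15,18) by blast
  qed
  have q01: "(insert v WT \<union> VT) \<inter> (W1 \<union> WR \<union> V1) = {c, d}"
  proof (intro equalityI subsetI)
    fix x assume x: "x \<in> (insert v WT \<union> VT) \<inter> (W1 \<union> WR \<union> V1)"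
    then have "x \<in> WT \<or> x \<in> VT" "x \<in> W1 \<or> x \<in> WR \<or> x \<in> V1" using i by auto
    then have "x = c \<or> x = d" using i cap by metis
    then show "x \<in> {c, d}" by simp
  next
    fix x assume "x \<in> {c, d}" then show "x \<in> (insert v WT \<union> VT) \<inter> (W1 \<union> WR \<union> V1)" using i by auto
  qed
  have q02: "(insert v WT \<union> VT) \<inter> (W2 \<union> WS \<union> V2) = {c, d}"
  proof (intro equalityI subsetI)
    fix x assume x: "x \<in> (insert v WT \<union> VT) \<inter> (W2 \<union> WS \<union> V2)"
    then have "x \<in> WT \<or> x \<in> VT" "x \<in> W2 \<or> x \<in> WS \<or> x \<in> V2" using i by auto
    then have "x = c \<or> x = d" using i cap by metis
    then show "x \<in> {c, d}" by simp
  next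
    fix x assume "x \<in> {c, d}" then show "x \<in> (insert v WT \<union> VT) \<inter> (W2 \<union> WS \<union> V2)" using i by auto
  qed
  have q12: "(W1 \<union> WR \<union> V1) \<inter> (W2 \<union> WS \<union> V2) = {c, d}"
  proof (intro equalityI subsetI)
    fix x assume x: "x \<in> (W1 \<union> WR \<union> V1) \<inter> (W2 \<union> WS \<union> V2)"
    then have "x \<in> W1 \<or> x \<in> WR \<or> x \<in> V1" "x \<in> W2 \<or> x \<in> WS \<or> x \<in> V2" using i by auto
    then have "x = c \<or> x = d" using i cap by metis
    then show "x \<in> {c, d}" by simp
  next
    fix x assume "x \<in> {c, d}" then show "x \<in> (W1 \<union> WR \<union> V1) \<inter> (W2 \<union> WS \<union> V2)" using i by auto
  qed
  have cd: "c \<noteq> d" using i cap(1,13,16) by metis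
  have e0: "e \<notin> J1 \<union> R \<union> L1" "e \<notin> J2 \<union> S \<union> L2" using e(2) c(10,11) d(10,11) by auto
  have j: "T \<inter> J1 = {}" "T \<inter> J2 = {}" "U \<inter> L1 = {}" "U \<inter> L2 = {}" "J1 \<inter> J2 = {}" "L1 \<inter> L2 = {}"
    using upath_disj[OF c(1,2), of c] upath_disj[OF c(1,3), of c] upath_disj[OF d(1,2), of d]
      upath_disj[OF d(1,3), of d] upath_disj[OF c(2,3), of c] upath_disj[OF d(2,3), of d] c(4-6) d(4-6) by auto
  have j2: "T \<inter> L1 = {}" "T \<inter> L2 = {}" "U \<inter> J1 = {}" "U \<inter> J2 = {}" "J1 \<inter> L2 = {}" "J2 \<inter> L1 = {}"
    by (rule upath_disj[OF c(1) d(2)] upath_disj[OF c(1) d(3)] upath_disj[OF d(1) c(2)] upath_disj[OF d(1) c(3)]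
      upath_disj[OF c(2) d(3)] upath_disj[OF c(3) d(2)]; use cap(1,13-18) in blast)+
  have ni: "WT \<inter> WR \<subseteq> {w}" "WT \<inter> WS \<subseteq> {w'}" "W2 \<inter> WR \<subseteq> {w}" "W1 \<inter> WS \<subseteq> {w'}"
    using r(2) s(2) c(7-9) by auto
  have mi: "VT \<inter> WR \<subseteq> {z}" "VT \<inter> WS \<subseteq> {z'}" "V2 \<inter> WR \<subseteq> {z}" "V1 \<inter> WS \<subseteq> {z'}"
    using r(3) s(3) d(7-9) by auto
  have j3: "T \<inter> R = {}" "T \<inter> S = {}" "J2 \<inter> R = {}" "J1 \<inter> S = {}"
    by (rule upath_disj[OF c(1) r(1) ni(1)] upath_disj[OF c(1) s(1) ni(2)]
      upath_disj[OF c(3) r(1) ni(3)] upath_disj[OF c(2) s(1) ni(4)])+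
  have j4: "U \<inter> R = {}" "U \<inter> S = {}" "L2 \<inter> R = {}" "L1 \<inter> S = {}"
    by (rule upath_disj[OF d(1) r(1) mi(1)] upath_disj[OF d(1) s(1) mi(2)]
      upath_disj[OF d(3) r(1) mi(3)] upath_disj[OF d(2) s(1) mi(4)])+
  have k1: "(insert e T \<union> U) \<inter> (J1 \<union> R \<union> L1) = {}"
    by (rule disjoint_insert_Un2[OF e0(1) j(1) j3(1) j2(1) j2(3) j4(1) j(3)])
  have k2: "(insert e T \<union> U) \<inter> (J2 \<union> S \<union> L2) = {}"
    by (rule disjoint_insert_Un2[OF e0(2) j(2) j3(2) j2(2) j2(4) j4(2) j(4)])
  have k3: "(J2 \<union> S \<union> L2) \<inter> (J1 \<union> R \<union> L1) = {}"
    using j(5,6) j2(5,6) j3(3,4) j4(3,4) RS(2) by (simp add: Int_Un_distrib Int_Un_distrib2 Int_commute)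
  show thesis
  proof (rule that)
    show "utheta c d (insert v WT \<union> VT) (insert e T \<union> U) (W1 \<union> WR \<union> V1) (J1 \<union> R \<union> L1) (W2 \<union> WS \<union> V2) (J2 \<union> S \<union> L2)"
      unfolding utheta_def using cd p0 p1 p2 q01 q02 q12 k1 k2 k3 by (simp add: Int_commute)
  qed (auto simp: c(10-12) d(10-12))
qed

subsection \<open>Exchange of chords\<close>

lemma theta_prop_upd:
  assumes "theta_prop K E b" "d \<notin> C"
  shows "b C (s(d := k)) = b C s"
  by (rule theta_prop_cong[OF assms(1)]) (use assms(2) in auto)

lemma fork_subset: "fork N u w w' A A' J \<Longrightarrow> J \<subseteq> A \<union> A'"
  unfolding fork_def by auto

text \<open>The deciding circle \<open>J \<union> L \<union> R \<union> S\<close> lies in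
  \<open>E\<close>, so its balance does not involve the new link. As \<open>S\<close> misses the
  first circle, its labels can be adjusted without disturbing the balance of that circle.\<close>

lemma ladder_balance:
  assumes be: "theta_prop K (insert e E) be" and K: "\<And>d. s d \<in> K d"
    and fu: "fork N u w w' A A' J" and fv: "fork M v z z' B B' L" and NM: "N \<inter> M = {}"
    and r: "upath w z WR R" "WR \<inter> N = {w}" "WR \<inter> M = {z}"
    and s: "upath w' z' WS S" "WS \<inter> N = {w'}" "WS \<inter> M = {z'}"
    and RS: "WR \<inter> WS \<subseteq> N \<union> M" "R \<inter> S = {}"
    and e: "e = {u, v}" "e \<notin> E" "A \<union> A' \<union> B \<union> B' \<union> R \<union> S \<subseteq> E"
  shows "circ (J \<union> L \<union> R \<union> S)" "J \<union> L \<union> R \<union> S \<subseteq> E" "S \<inter> insert e (A \<union> B \<union> R) = {}"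
    "be (J \<union> L \<union> R \<union> S) s \<Longrightarrow> be (insert e (A \<union> B \<union> R)) s = be (insert e (A' \<union> B' \<union> S)) s"
    "be (insert e (A \<union> B \<union> R)) s \<Longrightarrow> be (insert e (A' \<union> B' \<union> S)) s \<Longrightarrow> be (J \<union> L \<union> R \<union> S) s"
proof -
  have "e \<notin> A \<union> A' \<union> B \<union> B' \<union> R \<union> S" using e(2,3) by auto
  then obtain c d W0 D0 W1 D1 W2 D2 where th: "utheta c d W0 D0 W1 D1 W2 D2"
    and un: "D0 \<union> D1 = insert e (A \<union> B \<union> R)" "D0 \<union> D2 = insert e (A' \<union> B' \<union> S)" "D1 \<union> D2 = J \<union> L \<union> R \<union> S"
    and S: "S \<subseteq> D2"
    using ladder_theta[OF fu fv NM r s RS e(1)] by metis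
  show "circ (J \<union> L \<union> R \<union> S)" using utheta_circ(3)[OF th] un(3) by simp
  show JL: "J \<union> L \<union> R \<union> S \<subseteq> E" using fork_subset[OF fu] fork_subset[OF fv] e(3) by auto
  have "D0 \<inter> D2 = {}" "D1 \<inter> D2 = {}" using th by (auto simp: utheta_def)
  then show "S \<inter> insert e (A \<union> B \<union> R) = {}" using S unfolding un(1)[symmetric] by auto
  have sub: "D0 \<union> D1 \<union> D2 \<subseteq> insert e E"
    using un e(3) by (metis (no_types, lifting) Un_least insert_mono le_sup_iff)
  show "be (J \<union> L \<union> R \<union> S) s \<Longrightarrow> be (insert e (A \<union> B \<union> R)) s = be (insert e (A' \<union> B' \<union> S)) s"
    using theta_prop_iff[OF be th sub K] un by simp
  show "be (insert e (A \<union> B \<union> R)) s \<Longrightarrow> be (insert e (A' \<union> B' \<union> S)) s \<Longrightarrow> be (J \<union> L \<union> R \<union> S) s"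
    using theta_prop_theta[OF be th sub K] un by simp
qed

text \<open>In a circle that consists of \<open>e = {u, v}\<close>, a path \<open>P\<close> from \<open>v\<close> to \<open>x\<close>, \<open>f = {x, y}\<close> and a path \<open>Q\<close>
  from \<open>y\<close> to \<open>u\<close>, the chord \<open>R\<close> separates \<open>e\<close> from \<open>f\<close>. The side of \<open>e\<close> is \<open>insert e (Du \<union> Dv)\<close>, that of
  \<open>f\<close> is \<open>insert f (Dy \<union> Dx)\<close>.\<close>

definition is_chord where
  "is_chord E u v x y P DP Q DQ q p W R Dy Du Dv Dx \<longleftrightarrow>
     upath q p W R \<and> R \<subseteq> E \<and> W \<inter> Q = {q} \<and> W \<inter> P = {p} \<and>
     (\<exists>Qy Qu. upath y q Qy Dy \<and> upath q u Qu Du \<and> Qy \<inter> Qu = {q} \<and> Qy \<union> Qu = Q \<and> Dy \<union> Du = DQ) \<and>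
     (\<exists>Pv Px. upath v p Pv Dv \<and> upath p x Px Dx \<and> Pv \<inter> Px = {p} \<and> Pv \<union> Px = P \<and> Dv \<union> Dx = DP)"

text \<open>The case \<open>e = f\<close> is included; \<open>be\<close> and \<open>bf\<close> are then two balance classes on one graph.\<close>

locale chord_frame =
  fixes K :: "'v set \<Rightarrow> 'k set" and E :: "'v set set" and b0 be bf e f u v x y P DP Q DQ
  assumes b0: "bexp K E b0" and be: "theta_prop K (insert e E) be" and bf: "theta_prop K (insert f E) bf"
    and agree_e: "agree K E be b0" and agree_f: "agree K E bf b0"
    and e: "e = {u, v}" "e \<notin> E" and f: "f = {x, y}" "f \<notin> E"
    and P: "upath v x P DP" and Q: "upath y u Q DQ" and PQ: "P \<inter> Q = {}" "DP \<union> DQ \<subseteq> E"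
begin

text \<open>One label on \<open>S\<close> is chosen so that the deciding circle becomes balanced in
  \<open>b0\<close>, hence for \<open>be\<close> and for \<open>bf\<close>. The forks from
  \<open>u\<close> and \<open>y\<close> have the same branches \<open>J\<close>, those from
  \<open>v\<close> and \<open>x\<close> the same branches \<open>L\<close>; so this one circle
  decides the exchange on the side of \<open>e\<close> and on that of \<open>f\<close>.\<close>

lemma ladder_step:
  assumes K: "\<And>d. s d \<in> K d"
    and fu: "fork N u w w' DU DU' J" and fy: "fork N y w w' DY DY' J"
    and fv: "fork M v z z' DV DV' L" and fx: "fork M x z z' DX DX' L" and NM: "N \<inter> M = {}"
    and r: "upath w z WR R" "WR \<inter> N = {w}" "WR \<inter> M = {z}"
    and s: "upath w' z' WS S" "WS \<inter> N = {w'}" "WS \<inter> M = {z'}"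
    and RS: "WR \<inter> WS \<subseteq> N \<union> M"
    and E: "DU \<union> DU' \<union> DV \<union> DV' \<union> R \<union> S \<subseteq> E" "DY \<union> DY' \<union> DX \<union> DX' \<union> R \<union> S \<subseteq> E"
  shows "\<exists>s'. (\<forall>d. s' d \<in> K d) \<and> (\<forall>d. d \<notin> S \<longrightarrow> s' d = s d) \<and>
    be (insert e (DU \<union> DV \<union> R)) s = be (insert e (DU' \<union> DV' \<union> S)) s' \<and>
    bf (insert f (DY \<union> DX \<union> R)) s = bf (insert f (DY' \<union> DX' \<union> S)) s'"
proof (cases "R \<inter> S = {}")
  case True
  have f': "f = {y, x}" using f(1) by (simp add: insert_commute)
  note le = ladder_balance[OF be _ fu fv NM r s RS True e E(1)]
  note lf = ladder_balance[OF bf _ fy fx NM r s RS True f' f(2) E(2)]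
  let ?Z = "J \<union> L \<union> R \<union> S"
  have "w' \<noteq> z'" using s(2,3) NM by auto
  then obtain d where d: "d \<in> S" using upath_nonempty[OF s(1)] by auto
  then have "d \<in> ?Z" by simp
  then obtain k where k: "k \<in> K d" "b0 ?Z (s(d := k))"
    using bexp_lift[OF b0 le(1)[OF K] le(2)[OF K], of d s] K by auto
  let ?s = "s(d := k)"
  have K': "?s c \<in> K c" for c using K k by simp
  have Z: "be ?Z ?s" "bf ?Z ?s"
    using agree_e agree_f k(2) le(1)[OF K] le(2)[OF K] K' unfolding agree_def by metis+
  have "d \<notin> insert e (DU \<union> DV \<union> R)" "d \<notin> insert f (DY \<union> DX \<union> R)"
    using le(3)[OF K] lf(3)[OF K] d by blast+
  then have "be (insert e (DU \<union> DV \<union> R)) s = be (insert e (DU \<union> DV \<union> R)) ?s"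
     "bf (insert f (DY \<union> DX \<union> R)) s = bf (insert f (DY \<union> DX \<union> R)) ?s"
    using theta_prop_upd[OF be] theta_prop_upd[OF bf] by metis+
  then show ?thesis using le(4)[OF K' Z(1)] lf(4)[OF K' Z(2)] K' d by (intro exI[of _ ?s]) auto
next
  \<comment> \<open>Common nodes of the rungs lie in \<open>N\<close> or \<open>M\<close>, where
    each rung has only its ends. A common edge is therefore the whole of both rungs, the two circles
    coincide on each side, and \<open>s\<close> itself serves.\<close>
  case False
  then obtain g where g: "g \<in> R" "g \<in> S" by auto
  have g2: "g \<subseteq> WR" "g \<subseteq> WS" "card g = 2" using upath_edge[OF r(1) g(1)] upath_edge[OF s(1) g(2)] by auto
  then have "g \<subseteq> (WR \<inter> N) \<union> (WR \<inter> M)" "g \<subseteq> (WS \<inter> N) \<union> (WS \<inter> M)" using RS by auto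
  then have gs: "g \<subseteq> {w, z}" "g \<subseteq> {w', z'}" unfolding r(2,3) s(2,3) by auto
  have "g = {w, z}" "g = {w', z'}"
    using gs g2(3) by (auto simp: card_2_iff doubleton_eq_iff)
  moreover have "w \<in> N" "w' \<in> N" "z \<in> M" "z' \<in> M" using r(2,3) s(2,3) by auto
  ultimately have eq: "w' = w" "z' = z" "g = {w, z}" using NM by (auto simp: doubleton_eq_iff)
  have "R = {{w, z}}" "S = {{w, z}}" using upath_direct[OF r(1)] upath_direct[OF s(1)] g eq by auto
  moreover have "DU = DU'" "DV = DV'" "DY = DY'" "DX = DX'"
    using fork_same fu fv fy fx unfolding eq by metis+
  ultimately show ?thesis using K by (intro exI[of _ s]) simp
qed

text \<open>The chord with final part \<open>DR\<close> is changed step by step into the one with final part \<open>DS\<close>, following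
  the latter from \<open>N\<close> to the first vertex that lies on the former or on \<open>P\<close>.\<close>

lemma transfer_aux:
  assumes "upath w' p' WS DS" "upath w p WR DR"
    and "fork N u w w' DU DU' J" "fork N y w w' DY DY' J"
    and "N \<inter> P = {}" "WR \<inter> N = {w}" "WS \<inter> N = {w'}" "WR \<inter> P = {p}" "WS \<inter> P = {p'}"
    and "DU \<union> DU' \<union> DY \<union> DY' \<union> DR \<union> DS \<subseteq> E" "\<And>d. s d \<in> K d"
    and p: "upath v p Pv Dv" "upath p x Px Dx" "Pv \<inter> Px = {p}" "Pv \<union> Px = P" "Dv \<union> Dx = DP"
    and p': "upath v p' Pv' Dv'" "upath p' x Px' Dx'" "Pv' \<inter> Px' = {p'}" "Pv' \<union> Px' = P" "Dv' \<union> Dx' = DP"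
  shows "\<exists>s'. (\<forall>d. s' d \<in> K d) \<and> (\<forall>d. d \<notin> DS \<longrightarrow> s' d = s d) \<and>
    be (insert e (DU \<union> Dv \<union> DR)) s = be (insert e (DU' \<union> Dv' \<union> DS)) s' \<and>
    bf (insert f (DY \<union> Dx \<union> DR)) s = bf (insert f (DY' \<union> Dx' \<union> DS)) s'"
  using assms(1-11)
\<comment> \<open>The measure is the length of the part of the target still to be followed.
  \<open>N\<close> and the forks vary because \<open>N\<close> absorbs the part already
  followed.\<close>
proof (induction "card DS" arbitrary: DS WS w' WR DR w N DU DU' DY DY' J s rule: less_induct)
  case less
  note S = less.prems(1) and R = less.prems(2) and fu = less.prems(3) and fy = less.prems(4)
    and NP = less.prems(5) and RN = less.prems(6) and SN = less.prems(7) and RP = less.prems(8)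
    and SP = less.prems(9) and sub = less.prems(10) and K = less.prems(11)
  have wp: "w' \<noteq> p'" using SN SP NP by auto
  \<comment> \<open>The first link is taken off because \<open>w'\<close> itself may lie on the old
    chord, namely if \<open>w' = w\<close>; \<open>z\<close> is to be the first meeting after
    it.\<close>
  obtain w2 W2 D2 where w2: "upath w2 p' W2 D2" "w' \<notin> W2" "WS = insert w' W2" "DS = insert {w', w2} D2"
    using upath_first[OF S wp] by metis
  have p'P: "p' \<in> WR \<union> P" using SP by auto
  obtain z Wa Da Wb Db where z: "upath w2 z Wa Da" "upath z p' Wb Db" "W2 = Wa \<union> Wb" "Wa \<inter> Wb = {z}"
    "D2 = Da \<union> Db" "Wa \<inter> (WR \<union> P) = {z}" using upath_hit[OF w2(1) p'P] by metis
  have zin: "z \<in> Wa" "z \<in> Wb" "p' \<in> Wb" using upath_ends[OF z(1)] upath_ends[OF z(2)] by auto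
  have subP: "Dv \<union> Dx \<subseteq> E" "Dv' \<union> Dx' \<subseteq> E" using PQ(2) p(5) p'(5) by auto
  show ?case
  proof (cases "z \<in> P")
    \<comment> \<open>The target meets nothing of the old chord before it reaches \<open>P\<close>,
      so a single exchange completes the transfer.\<close>
    case True
    then have zp: "z = p'" using SP w2(3) z(3) zin by auto
    then have "Wb = {p'}" "Db = {}" using upath_loop z(2) by metis+
    then have W2: "W2 = Wa" using z(3) zin zp by auto
    have RS: "WR \<inter> WS \<subseteq> N \<union> P" using w2(3) W2 z(6) SN True by auto
    obtain L where L: "fork P x p p' Dx Dx' L" "fork P v p p' Dv Dv' L"
      using fork_between[OF p(1-3) p'(1-3), of P] p(4,5) p'(4,5) by auto
    show ?thesis
      by (rule ladder_step[OF K fu fy L(2,1) NP R RN RP S SN SP RS]) (use sub subP in auto)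
  next
    \<comment> \<open>The target has run into the old chord at \<open>z\<close>. The rest
      \<open>W4\<close> of that chord is counted to the side of \<open>P\<close>, and only the part
      before \<open>z\<close> is exchanged.\<close>
    case False
    then have "z \<in> WR" using z(6) by auto
    then obtain W3 D3 W4 D4 where R34: "upath w z W3 D3" "upath z p W4 D4" "WR = W3 \<union> W4" "W3 \<inter> W4 = {z}"
      "DR = D3 \<union> D4" using upath_split[OF R] by metis
    have Rin: "w \<in> W3" "z \<in> W3" "z \<in> W4" "p \<in> W4" using upath_ends[OF R34(1)] upath_ends[OF R34(2)] by auto
    have zN: "z \<notin> N" using SN w2(2,3) z(3) zin by auto
    have wN: "w \<in> N" "w' \<in> N" using RN SN by auto
    have w4: "W4 \<inter> N = {}" using RN R34(3,4) Rin zN wN by auto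
    have pz: "p \<notin> W3" using R34(4) Rin RP False by auto
    define Ws where "Ws = insert w' Wa"
    define Ds where "Ds = insert {w', w2} Da"
    define M where "M = P \<union> W4"
    have w'P: "w' \<notin> P" using NP wN by auto
    have s1: "upath w' z Ws Ds" unfolding Ws_def Ds_def using upath_step[OF z(1)] w2(2) z(3) by simp
    have NM: "N \<inter> M = {}" using NP w4 unfolding M_def by auto
    have pv: "Pv \<inter> W4 = {p}" "Px \<inter> W4 = {p}"
      using RP R34(3) p(4) Rin upath_ends[OF p(1)] upath_ends[OF p(2)] by auto
    \<comment> \<open>Old and new part both end at \<open>z\<close>, so nothing branches on the side
      of \<open>P\<close>.\<close>
    have fv: "fork M v z z (Dv \<union> D4) (Dv \<union> D4) {}" "fork M x z z (Dx \<union> D4) (Dx \<union> D4) {}"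
      using fork_refl[OF upath_append[OF p(1) upath_rev[OF R34(2)] pv(1)], of M]
        fork_refl[OF upath_append[OF upath_rev[OF p(2)] upath_rev[OF R34(2)] pv(2)], of M] p(4) unfolding M_def by auto
    have r1: "W3 \<inter> N = {w}" using RN R34(3) Rin by auto
    have "W3 \<inter> P = {}" using RP R34(3) pz by auto
    then have r2: "W3 \<inter> M = {z}" using R34(4) unfolding M_def by auto
    have s2: "Ws \<inter> N = {w'}" unfolding Ws_def using SN w2(3) z(3) by auto
    have "w' \<notin> W4" using w4 wN by auto
    then have s3: "Ws \<inter> M = {z}" unfolding Ws_def M_def using z(6) w'P R34(3) Rin by auto
    have rs: "W3 \<inter> Ws \<subseteq> N \<union> M" using z(6) R34(3) Rin wN unfolding Ws_def M_def by auto
    have Ds: "Ds \<subseteq> DS" "Db \<subseteq> DS" "DS = Ds \<union> Db" unfolding Ds_def using w2(4) z(5) by auto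
    have D34: "D3 \<subseteq> E" "D4 \<subseteq> E" using sub R34(5) by auto
    obtain s1 where st: "\<And>d. s1 d \<in> K d" "\<And>d. d \<notin> Ds \<Longrightarrow> s1 d = s d"
      "be (insert e (DU \<union> (Dv \<union> D4) \<union> D3)) s = be (insert e (DU' \<union> (Dv \<union> D4) \<union> Ds)) s1"
      "bf (insert f (DY \<union> (Dx \<union> D4) \<union> D3)) s = bf (insert f (DY' \<union> (Dx \<union> D4) \<union> Ds)) s1"
    proof -
      have "\<exists>s'. (\<forall>d. s' d \<in> K d) \<and> (\<forall>d. d \<notin> Ds \<longrightarrow> s' d = s d) \<and>
        be (insert e (DU \<union> (Dv \<union> D4) \<union> D3)) s = be (insert e (DU' \<union> (Dv \<union> D4) \<union> Ds)) s' \<and>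
        bf (insert f (DY \<union> (Dx \<union> D4) \<union> D3)) s = bf (insert f (DY' \<union> (Dx \<union> D4) \<union> Ds)) s'"
        by (rule ladder_step[OF K fu fy fv NM R34(1) r1 r2 s1 s2 s3 rs])
           (use sub subP D34 Ds in auto)
      then show ?thesis using that by metis
    qed
    \<comment> \<open>The link at \<open>w'\<close> has been used up, so the remaining target is
      strictly shorter.\<close>
    have "{w', w2} \<notin> Db" using upath_avoid[OF z(2), of w' "{w', w2}"] w2(2) z(3) by auto
    then have psub: "Db \<subset> DS" using w2(4) Ds(2) by auto
    have card: "card Db < card DS" using psub upath_finite[OF S] psubset_card_mono by metis
    obtain WU where WU: "upath u w' WU DU'" "WU \<subseteq> N" using fork_path[OF fu] by metis
    obtain WY where WY: "upath y w' WY DY'" "WY \<subseteq> N" using fork_path[OF fy] by metis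
    have wuy: "WU \<inter> Ws = {w'}" "WY \<inter> Ws = {w'}"
      using s2 WU(2) WY(2) upath_ends[OF WU(1)] upath_ends[OF WY(1)] by auto
    \<comment> \<open>After the exchange both chords begin at \<open>z\<close>, so the forks in the
      enlarged \<open>N\<close> are trivial; it remains to transfer from \<open>W4\<close> to
      \<open>Wb\<close>.\<close>
    let ?N = "N \<union> Ws"
    have fu': "fork ?N u z z (DU' \<union> Ds) (DU' \<union> Ds) {}" "fork ?N y z z (DY' \<union> Ds) (DY' \<union> Ds) {}"
      using fork_refl[OF upath_append[OF WU(1) s1 wuy(1)], of ?N] fork_refl[OF upath_append[OF WY(1) s1 wuy(2)], of ?N]
        WU(2) WY(2) by auto
    have n1: "?N \<inter> P = {}" unfolding Ws_def using NP w'P z(6) False by auto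
    have n2: "W4 \<inter> ?N = {z}" using w4 s3 Rin \<open>w' \<notin> W4\<close> unfolding M_def by auto
    have "Wb \<inter> N = {}" using SN w2(2,3) z(3) by auto
    then have n3: "Wb \<inter> ?N = {z}" unfolding Ws_def using z(3,4) w2(2) by auto
    have n4: "W4 \<inter> P = {p}" using RP R34(3) Rin by auto
    have "p' \<in> P" using SP by auto
    then have n5: "Wb \<inter> P = {p'}" using SP w2(3) z(3) zin by auto
    have n6: "DU' \<union> Ds \<union> (DU' \<union> Ds) \<union> (DY' \<union> Ds) \<union> (DY' \<union> Ds) \<union> D4 \<union> Db \<subseteq> E" using sub Ds D34 by auto
    obtain s2 where st2: "\<And>d. s2 d \<in> K d" "\<And>d. d \<notin> Db \<Longrightarrow> s2 d = s1 d"
      "be (insert e (DU' \<union> Ds \<union> Dv \<union> D4)) s1 = be (insert e (DU' \<union> Ds \<union> Dv' \<union> Db)) s2"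
      "bf (insert f (DY' \<union> Ds \<union> Dx \<union> D4)) s1 = bf (insert f (DY' \<union> Ds \<union> Dx' \<union> Db)) s2"
      using less.hyps[OF card z(2) R34(2) fu' n1 n2 n3 n4 n5 n6 st(1)] by metis
    have e1: "DU \<union> (Dv \<union> D4) \<union> D3 = DU \<union> Dv \<union> DR" "DY \<union> (Dx \<union> D4) \<union> D3 = DY \<union> Dx \<union> DR"
      "DU' \<union> (Dv \<union> D4) \<union> Ds = DU' \<union> Ds \<union> Dv \<union> D4" "DY' \<union> (Dx \<union> D4) \<union> Ds = DY' \<union> Ds \<union> Dx \<union> D4"
      "DU' \<union> Ds \<union> Dv' \<union> Db = DU' \<union> Dv' \<union> DS" "DY' \<union> Ds \<union> Dx' \<union> Db = DY' \<union> Dx' \<union> DS"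
      using R34(5) Ds(3) by auto
    show ?thesis
      using st(3,4) st2(1,3,4) st2(2) st(2) Ds(1,2) unfolding e1 by (intro exI[of _ s2]) (metis subsetD)
  qed
qed

abbreviation "chord \<equiv> is_chord E u v x y P DP Q DQ"

lemma chord_forks:
  assumes "chord q p W R Dy Du Dv Dx" "chord q' p' W' R' Dy' Du' Dv' Dx'"
  obtains J L where "fork Q u q q' Du Du' J" "fork Q y q q' Dy Dy' J"
    "fork P v p p' Dv Dv' L" "fork P x p p' Dx Dx' L"
proof -
  obtain Qy Qu where q: "upath y q Qy Dy" "upath q u Qu Du" "Qy \<inter> Qu = {q}" "Qy \<union> Qu = Q" "Dy \<union> Du = DQ"
    using assms(1) unfolding is_chord_def by metis
  obtain Qy' Qu' where q': "upath y q' Qy' Dy'" "upath q' u Qu' Du'" "Qy' \<inter> Qu' = {q'}" "Qy' \<union> Qu' = Q" "Dy' \<union> Du' = DQ"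
    using assms(2) unfolding is_chord_def by metis
  obtain Pv Px where p: "upath v p Pv Dv" "upath p x Px Dx" "Pv \<inter> Px = {p}" "Pv \<union> Px = P" "Dv \<union> Dx = DP"
    using assms(1) unfolding is_chord_def by metis
  obtain Pv' Px' where p': "upath v p' Pv' Dv'" "upath p' x Px' Dx'" "Pv' \<inter> Px' = {p'}" "Pv' \<union> Px' = P" "Dv' \<union> Dx' = DP"
    using assms(2) unfolding is_chord_def by metis
  obtain J where J: "fork Q u q q' Du Du' J" "fork Q y q q' Dy Dy' J"
    using fork_between[OF q(1-3) q'(1-3), of Q] q(4,5) q'(4,5) by auto
  obtain L where L: "fork P x p p' Dx Dx' L" "fork P v p p' Dv Dv' L"
    using fork_between[OF p(1-3) p'(1-3), of P] p(4,5) p'(4,5) by auto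
  show thesis using that J L by metis
qed

text \<open>Here \<open>N\<close> is \<open>Q\<close> itself. Labels change on the new chord
  \<open>R'\<close> only, and a chord has no link on the circle, so the section stays fixed
  there.\<close>

lemma chord_transfer:
  assumes c: "chord q p W R Dy Du Dv Dx" and c': "chord q' p' W' R' Dy' Du' Dv' Dx'" and K: "\<And>d. s d \<in> K d"
  obtains s' where "\<And>d. s' d \<in> K d" "\<And>d. d \<notin> R' \<Longrightarrow> s' d = s d"
    "be (insert e (Du \<union> Dv \<union> R)) s = be (insert e (Du' \<union> Dv' \<union> R')) s'"
    "bf (insert f (Dy \<union> Dx \<union> R)) s = bf (insert f (Dy' \<union> Dx' \<union> R')) s'"
proof -
  obtain J L where J: "fork Q u q q' Du Du' J" "fork Q y q q' Dy Dy' J" using chord_forks[OF c c'] by metis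
  obtain Pv Px where p: "upath v p Pv Dv" "upath p x Px Dx" "Pv \<inter> Px = {p}" "Pv \<union> Px = P" "Dv \<union> Dx = DP"
    using c unfolding is_chord_def by metis
  obtain Pv' Px' where p': "upath v p' Pv' Dv'" "upath p' x Px' Dx'" "Pv' \<inter> Px' = {p'}" "Pv' \<union> Px' = P" "Dv' \<union> Dx' = DP"
    using c' unfolding is_chord_def by metis
  have r: "upath q p W R" "R \<subseteq> E" "W \<inter> Q = {q}" "W \<inter> P = {p}" "Dy \<union> Du = DQ" using c unfolding is_chord_def by auto
  have r': "upath q' p' W' R'" "R' \<subseteq> E" "W' \<inter> Q = {q'}" "W' \<inter> P = {p'}" "Dy' \<union> Du' = DQ" using c' unfolding is_chord_def by auto
  have QP: "Q \<inter> P = {}" using PQ by auto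
  have "Du \<union> Du' \<union> Dy \<union> Dy' \<union> R \<union> R' \<subseteq> E" using PQ(2) r(2,5) r'(2,5) by auto
  from transfer_aux[OF r'(1) r(1) J QP r(3) r'(3) r(4) r'(4) this K p p'] show thesis using that by metis
qed

text \<open>Balance on the two sides of a chord is consistent for any two chords: both are compared
  with two chords \<open>R1\<close>, \<open>R2\<close> that meet only on \<open>P \<union> Q\<close>.\<close>

lemma chord_independent:
  assumes c1: "chord q1 p1 W1 R1 Dy1 Du1 Dv1 Dx1" and c2: "chord q2 p2 W2 R2 Dy2 Du2 Dv2 Dx2"
    and dis: "W1 \<inter> W2 \<subseteq> Q \<union> P" "R1 \<inter> R2 = {}"
    and c: "chord q p W R Dy Du Dv Dx" and c': "chord q' p' W' R' Dy' Du' Dv' Dx'"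
    and K: "\<And>d. s d \<in> K d" and K': "\<And>d. s' d \<in> K d"
    and eq: "\<And>d. d \<in> insert e (insert f (DP \<union> DQ)) \<Longrightarrow> s d = s' d"
    and b: "be (insert e (Du \<union> Dv \<union> R)) s" "bf (insert f (Dy \<union> Dx \<union> R)) s" "be (insert e (Du' \<union> Dv' \<union> R')) s'"
  shows "bf (insert f (Dy' \<union> Dx' \<union> R')) s'"
proof -
  have QP: "Q \<inter> P = {}" using PQ by auto
  have off: "R' \<inter> insert e (insert f (DP \<union> DQ)) = {}" if "chord q' p' W' R' Dy' Du' Dv' Dx'"
    for q' p' W' R' Dy' Du' Dv' Dx'
  proof -
    have r: "upath q' p' W' R'" "R' \<subseteq> E" "W' \<inter> Q = {q'}" "W' \<inter> P = {p'}" using that unfolding is_chord_def by auto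
    have "R' \<inter> DP = {}" "R' \<inter> DQ = {}" using upath_disj[OF r(1) P, of p'] upath_disj[OF r(1) Q, of q'] r(3,4) by auto
    then show ?thesis using r(2) e(2) f(2) by auto
  qed
  have on: "Dy' \<union> Du' = DQ" "Dv' \<union> Dx' = DP" "R' \<subseteq> E" if "chord q' p' W' R' Dy' Du' Dv' Dx'"
    for q' p' W' R' Dy' Du' Dv' Dx'
    using that unfolding is_chord_def by auto
  obtain t where t: "\<And>d. t d \<in> K d" "\<And>d. d \<notin> R1 \<Longrightarrow> t d = s d"
     "be (insert e (Du \<union> Dv \<union> R)) s = be (insert e (Du1 \<union> Dv1 \<union> R1)) t"
     "bf (insert f (Dy \<union> Dx \<union> R)) s = bf (insert f (Dy1 \<union> Dx1 \<union> R1)) t"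
    using chord_transfer[OF c c1 K] by metis
  obtain t' where t': "\<And>d. t' d \<in> K d" "\<And>d. d \<notin> R2 \<Longrightarrow> t' d = s' d"
     "be (insert e (Du' \<union> Dv' \<union> R')) s' = be (insert e (Du2 \<union> Dv2 \<union> R2)) t'"
     "bf (insert f (Dy' \<union> Dx' \<union> R')) s' = bf (insert f (Dy2 \<union> Dx2 \<union> R2)) t'"
    using chord_transfer[OF c' c2 K'] by metis
  \<comment> \<open>\<open>t\<close> and \<open>t'\<close> agree on the circle, since
    \<open>s\<close> and \<open>s'\<close> do and the transfers change labels only on
    \<open>R1\<close> and \<open>R2\<close>; as these are disjoint, one section carries both
    lifts.\<close>
  define r where "r = (\<lambda>d. if d \<in> R2 then t' d else t d)"
  have Kr: "r d \<in> K d" for d using t(1) t'(1) by (simp add: r_def)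
  have r1: "r d = t d" if "d \<in> insert e (insert f (DP \<union> DQ)) \<union> R1" for d
    using that off[OF c2] dis(2) unfolding r_def by auto
  have r2: "r d = t' d" if "d \<in> insert e (insert f (DP \<union> DQ)) \<union> R2" for d
  proof (cases "d \<in> R2")
    case False
    then have d: "d \<in> insert e (insert f (DP \<union> DQ))" using that by auto
    then have "d \<notin> R1" "d \<notin> R2" using off[OF c1] off[OF c2] by auto
    then show ?thesis using t(2) t'(2) eq[OF d] unfolding r_def by simp
  qed (simp add: r_def)
  have "be (insert e (Du1 \<union> Dv1 \<union> R1)) r = be (insert e (Du1 \<union> Dv1 \<union> R1)) t"
    by (rule theta_prop_cong[OF be]) (use r1 on[OF c1] in auto)
  then have b1: "be (insert e (Du1 \<union> Dv1 \<union> R1)) r" using t(3) b(1) by simp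
  have "bf (insert f (Dy1 \<union> Dx1 \<union> R1)) r = bf (insert f (Dy1 \<union> Dx1 \<union> R1)) t"
    by (rule theta_prop_cong[OF bf]) (use r1 on[OF c1] in auto)
  then have b2: "bf (insert f (Dy1 \<union> Dx1 \<union> R1)) r" using t(4) b(2) by simp
  have "be (insert e (Du2 \<union> Dv2 \<union> R2)) r = be (insert e (Du2 \<union> Dv2 \<union> R2)) t'"
    by (rule theta_prop_cong[OF be]) (use r2 on[OF c2] in auto)
  then have b3: "be (insert e (Du2 \<union> Dv2 \<union> R2)) r" using t'(3) b(3) by simp
  obtain J L where J: "fork Q u q1 q2 Du1 Du2 J" "fork Q y q1 q2 Dy1 Dy2 J"
    "fork P v p1 p2 Dv1 Dv2 L" "fork P x p1 p2 Dx1 Dx2 L" using chord_forks[OF c1 c2] by metis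
  have f': "f = {y, x}" using f(1) by (simp add: insert_commute)
  have u1: "upath q1 p1 W1 R1" "W1 \<inter> Q = {q1}" "W1 \<inter> P = {p1}" using c1 unfolding is_chord_def by auto
  have u2: "upath q2 p2 W2 R2" "W2 \<inter> Q = {q2}" "W2 \<inter> P = {p2}" using c2 unfolding is_chord_def by auto
  have E: "Du1 \<union> Du2 \<union> Dv1 \<union> Dv2 \<union> R1 \<union> R2 \<subseteq> E" "Dy1 \<union> Dy2 \<union> Dx1 \<union> Dx2 \<union> R1 \<union> R2 \<subseteq> E"
    using on[OF c1] on[OF c2] PQ(2) by auto
  note le = ladder_balance[where s = r, OF be Kr J(1,3) QP u1 u2 dis e E(1)]
  note lf = ladder_balance[where s = r, OF bf Kr J(2,4) QP u1 u2 dis f' f(2) E(2)]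
  \<comment> \<open>This circle lies in \<open>E\<close>, so here the argument can pass from
    \<open>be\<close> to \<open>bf\<close>.\<close>
  have "be (J \<union> L \<union> R1 \<union> R2) r" using le(5)[OF b1 b3] .
  then have "bf (J \<union> L \<union> R1 \<union> R2) r" using agree_e agree_f le(1,2) Kr unfolding agree_def by metis
  then have "bf (insert f (Dy2 \<union> Dx2 \<union> R2)) r" using lf(4) b2 by simp
  moreover have "bf (insert f (Dy2 \<union> Dx2 \<union> R2)) r = bf (insert f (Dy2 \<union> Dx2 \<union> R2)) t'"
    by (rule theta_prop_cong[OF bf]) (use r2 on[OF c2] in auto)
  ultimately show ?thesis using t'(4) by simp
qed

end

subsection \<open>Connectivity\<close>

definition conn where
  "conn V E \<longleftrightarrow> (\<forall>a\<in>V. \<forall>b\<in>V. \<exists>W D. upath a b W D \<and> D \<subseteq> E)"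

definition three_conn_path where
  "three_conn_path V E \<longleftrightarrow> (\<forall>a\<in>V. \<forall>b\<in>V. \<forall>c\<in>V. a \<noteq> b \<longrightarrow> a \<noteq> c \<longrightarrow> b \<noteq> c \<longrightarrow>
     (\<exists>W D. upath a b W D \<and> D \<subseteq> E \<and> c \<in> W))"

lemma conn_mono: "conn V E \<Longrightarrow> E \<subseteq> E' \<Longrightarrow> conn V E'"
  unfolding conn_def by (meson order_trans)

text \<open>Unlike the existence of a circle through any two edges, this form of 2-connectedness is evidently
  inherited by graphs with more links.\<close>

lemma three_conn_path_mono: "three_conn_path V E \<Longrightarrow> E \<subseteq> E' \<Longrightarrow> three_conn_path V E'"
  unfolding three_conn_path_def by (meson order_trans)

lemma connecting_path:
  assumes "upath a b W D" "a \<in> Q" "b \<in> P"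
  obtains q p W' D' where "upath q p W' D'" "W' \<subseteq> W" "D' \<subseteq> D" "W' \<inter> Q = {q}" "W' \<inter> P = {p}"
proof -
  obtain p W1 D1 W2 D2 where p: "upath a p W1 D1" "upath p b W2 D2" "W = W1 \<union> W2" "D = D1 \<union> D2" "W1 \<inter> P = {p}"
    using upath_hit[OF assms(1,3)] by metis
  obtain q W3 D3 W4 D4 where q: "upath p q W3 D3" "upath q a W4 D4" "W1 = W3 \<union> W4" "D1 = D3 \<union> D4" "W3 \<inter> Q = {q}"
    using upath_hit[OF upath_rev[OF p(1)] assms(2)] by metis
  have "W3 \<inter> P = {p}" using p(5) q(3) upath_ends[OF q(1)] by auto
  then show thesis using that[OF upath_rev[OF q(1)]] q p by auto
qed

text \<open>Cutting a path from \<open>a\<close> to \<open>b\<close> at an intermediate node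
  \<open>c\<close> gives two paths from \<open>Q\<close> to \<open>P\<close> that share only
  \<open>c\<close>, and each of them contains a connecting path.\<close>

lemma two_connecting_paths:
  assumes 3: "three_conn_path V E" and a: "a \<in> Q" "b \<in> Q" "a \<noteq> b" and c: "c \<in> P"
    and PQ: "P \<inter> Q = {}" "P \<union> Q \<subseteq> V"
  obtains q1 p1 W1 R1 q2 p2 W2 R2 where
    "upath q1 p1 W1 R1" "R1 \<subseteq> E" "W1 \<inter> Q = {q1}" "W1 \<inter> P = {p1}"
    "upath q2 p2 W2 R2" "R2 \<subseteq> E" "W2 \<inter> Q = {q2}" "W2 \<inter> P = {p2}"
    "W1 \<inter> W2 \<subseteq> P" "R1 \<inter> R2 = {}"
proof -
  have "a \<noteq> c" "b \<noteq> c" "a \<in> V" "b \<in> V" "c \<in> V" using a c PQ by auto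
  then obtain W D where W: "upath a b W D" "D \<subseteq> E" "c \<in> W" using 3 a(3) unfolding three_conn_path_def by metis
  obtain Wa Da Wb Db where s: "upath a c Wa Da" "upath c b Wb Db" "W = Wa \<union> Wb" "Wa \<inter> Wb = {c}" "D = Da \<union> Db"
    using upath_split[OF W(1,3)] by metis
  obtain q1 p1 W1 R1 where 1: "upath q1 p1 W1 R1" "W1 \<subseteq> Wa" "R1 \<subseteq> Da" "W1 \<inter> Q = {q1}" "W1 \<inter> P = {p1}"
    using connecting_path[OF s(1) a(1) c] by metis
  obtain q2 p2 W2 R2 where 2: "upath q2 p2 W2 R2" "W2 \<subseteq> Wb" "R2 \<subseteq> Db" "W2 \<inter> Q = {q2}" "W2 \<inter> P = {p2}"
    using connecting_path[OF upath_rev[OF s(2)] a(2) c] by metis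
  have m: "W1 \<inter> W2 \<subseteq> {c}" using 1(2) 2(2) s(4) by auto
  have "R1 \<subseteq> E" "R2 \<subseteq> E" using 1(3) 2(3) s(5) W(2) by auto
  moreover have "W1 \<inter> W2 \<subseteq> P" using m c by auto
  ultimately show thesis using that 1 2 upath_disj[OF 1(1) 2(1) m] by metis
qed

text \<open>The stretch between \<open>x\<close> and \<open>y\<close> is replaced by the ear,
  traversed in the direction in which the path meets its ends.\<close>

lemma upath_ear:
  assumes "upath a b W1 D1" "upath x y WE DE" "WE \<inter> W1 = {x, y}" "x \<noteq> y"
  shows "\<exists>W D. upath a b W D \<and> D \<subseteq> D1 \<union> DE \<and> WE \<subseteq> W"
proof -
  have *: "\<exists>W D. upath a b W D \<and> D \<subseteq> D1 \<union> DE \<and> WE \<subseteq> W"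
    if x: "upath x y WE DE" "WE \<inter> W1 = {x, y}" "x \<noteq> y" and
      s: "upath a x Wa Da" "upath x b Wb Db" "W1 = Wa \<union> Wb" "Wa \<inter> Wb = {x}" "D1 = Da \<union> Db" and y: "y \<in> Wb"
    for x y Wa Da Wb Db
  proof -
    obtain Wc Dc Wd Dd where t: "upath x y Wc Dc" "upath y b Wd Dd" "Wb = Wc \<union> Wd" "Wc \<inter> Wd = {y}" "Db = Dc \<union> Dd"
      using upath_split[OF s(2) y] by metis
    have i: "x \<in> Wa" "x \<in> Wc" "y \<in> Wd" "x \<in> WE" "y \<in> WE"
      using upath_ends[OF s(1)] upath_ends[OF t(1)] upath_ends[OF t(2)] upath_ends[OF x(1)] by auto
    have xd: "x \<notin> Wd" using t(4) i x(3) by auto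
    have ya: "y \<notin> Wa" using s(4) y x(3) by auto
    have "Wa \<inter> WE = {x}" using x(2) s(3) i ya by auto
    note p = upath_append[OF s(1) x(1) this]
    have "Wa \<inter> Wd = {}" using s(4) t(3) xd by auto
    moreover have "WE \<inter> Wd = {y}" using x(2) s(3) t(3) i xd by auto
    ultimately have "(Wa \<union> WE) \<inter> Wd = {y}" by (simp add: Int_Un_distrib2)
    note upath_append[OF p t(2) this]
    then show ?thesis using s(5) t(5) by (intro exI conjI) auto
  qed
  have "x \<in> W1" using assms(3) by auto
  then obtain Wa Da Wb Db where s: "upath a x Wa Da" "upath x b Wb Db" "W1 = Wa \<union> Wb" "Wa \<inter> Wb = {x}" "D1 = Da \<union> Db"
    using upath_split[OF assms(1)] by metis
  have "y \<in> Wa \<or> y \<in> Wb" using assms(3) s(3) by auto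
  then show ?thesis
  proof
    assume "y \<in> Wb" then show ?thesis using *[OF assms(2-4) s] by simp
  next
    assume y: "y \<in> Wa"
    obtain Wc Dc Wd Dd where t: "upath a y Wc Dc" "upath y x Wd Dd" "Wa = Wc \<union> Wd" "Wc \<inter> Wd = {y}" "Da = Dc \<union> Dd"
      using upath_split[OF s(1) y] by metis
    have i: "x \<in> Wd" "x \<in> Wb" "y \<in> Wc" "y \<in> Wd"
      using upath_ends[OF s(2)] upath_ends[OF t(1)] upath_ends[OF t(2)] by auto
    have d: "Wd \<inter> Wb = {x}" using s(4) t(3) i by auto
    have "x \<notin> Wc" using t(4) i assms(4) by auto
    then have "Wc \<inter> Wb = {}" using s(4) t(3) by auto
    then have e: "Wc \<inter> (Wd \<union> Wb) = {y}" using t(4) by (simp add: Int_Un_distrib)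
    show ?thesis
      using *[OF upath_rev[OF assms(2)] _ assms(4)[symmetric] t(1) upath_append[OF t(2) s(2) d] _ e]
        assms(3) s(3,5) t(3,5) i by (auto simp: insert_commute Un_assoc)
  qed
qed

text \<open>The first and the last link of a path from \<open>a\<close> to \<open>b\<close> differ
  because \<open>a\<close> and \<open>b\<close> are not adjacent; a circle through both links
  contains both nodes.\<close>

lemma circle_through_two:
  assumes "conn V E" and tw: "\<forall>e\<in>E. \<forall>f\<in>E. e \<noteq> f \<longrightarrow> (\<exists>C. circ C \<and> C \<subseteq> E \<and> e \<in> C \<and> f \<in> C)"
    and "a \<in> V" "b \<in> V" "a \<noteq> b" "{a, b} \<notin> E"
  obtains C where "circ C" "C \<subseteq> E" "a \<in> \<Union>C" "b \<in> \<Union>C"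
proof -
  obtain W D where W: "upath a b W D" "D \<subseteq> E" using assms(1,3,4) unfolding conn_def by metis
  obtain g where g: "g \<in> D" "a \<in> g" using upath_edge_at[OF W(1) assms(5)] by metis
  obtain h where h: "h \<in> D" "b \<in> h" using upath_edge_at[OF upath_rev[OF W(1)]] assms(5) by metis
  have "g \<noteq> h"
  proof
    assume "g = h"
    then have "{a, b} \<subseteq> g" "card g = 2" using g h upath_edge[OF W(1) g(1)] by auto
    then have "g = {a, b}" using assms(5) card_seteq[of g "{a, b}"] card.infinite by fastforce
    then show False using g(1) W(2) assms(6) by auto
  qed
  then obtain C where "circ C" "C \<subseteq> E" "g \<in> C" "h \<in> C" using tw g h W(2) by (metis subsetD)
  then show thesis using that g h by auto
qed

text \<open>If \<open>a\<close> and \<open>b\<close> are adjacent, a circle through that link and a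
  link at \<open>c\<close> gives the path. Otherwise a circle through \<open>a\<close> and
  \<open>b\<close> is taken; if it misses \<open>c\<close>, it acquires an ear through
  \<open>c\<close>, along which one of its arcs, or a combination of both, is rerouted.\<close>

lemma three_conn_pathI:
  assumes co: "conn V E" and tw: "\<forall>e\<in>E. \<forall>f\<in>E. e \<noteq> f \<longrightarrow> (\<exists>C. circ C \<and> C \<subseteq> E \<and> e \<in> C \<and> f \<in> C)"
  shows "three_conn_path V E"
  unfolding three_conn_path_def
proof (intro ballI impI)
  fix a b c assume V: "a \<in> V" "b \<in> V" "c \<in> V" and ne: "a \<noteq> b" "a \<noteq> c" "b \<noteq> c"
  obtain W0 D0 where W0: "upath c a W0 D0" "D0 \<subseteq> E" using co V unfolding conn_def by metis
  obtain g where g: "g \<in> E" "c \<in> g" using upath_edge_at[OF W0(1)] ne W0(2) by (metis subsetD)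
  show "\<exists>W D. upath a b W D \<and> D \<subseteq> E \<and> c \<in> W"
  proof (cases "{a, b} \<in> E")
    case True
    have "g \<noteq> {a, b}" using g ne by auto
    then obtain C where C: "circ C" "C \<subseteq> E" "{a, b} \<in> C" "g \<in> C" using tw g(1) True by metis
    obtain b' W D where d: "{a, b} = {a, b'}" "upath a b' W D" "C = insert {a, b} D"
      using circ_edge_at[OF C(1,3), of a] by (metis insertI1)
    have "b' = b" using d(1) ne by (auto simp: doubleton_eq_iff)
    moreover have "c \<in> W" using upath_edge[OF d(2), of g] C(4) d(3) \<open>g \<noteq> {a, b}\<close> g(2) by auto
    ultimately show ?thesis using d C(2) by auto
  next
    case False
    obtain C where C: "circ C" "C \<subseteq> E" "a \<in> \<Union>C" "b \<in> \<Union>C" using circle_through_two[OF co tw V(1,2) ne(1) False] by metis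
    obtain W1 D1 W2 D2 where p: "upath a b W1 D1" "upath a b W2 D2" "W1 \<inter> W2 = {a, b}" "C = D1 \<union> D2"
      using circ_two_verts[OF C(1,3,4) ne(1)] by metis
    have DE: "D1 \<subseteq> E" "D2 \<subseteq> E" using p(4) C(2) by auto
    show ?thesis
    proof (cases "c \<in> W1 \<union> W2")
      case True
      then show ?thesis using p DE by auto
    next
      case c: False
      let ?X = "W1 \<union> W2"
      obtain h where h: "h \<in> D1" using upath_nonempty[OF p(1) ne(1)] by auto
      have hX: "h \<subseteq> ?X" using upath_edge[OF p(1) h] by auto
      then have "h \<noteq> g" using g c by auto
      \<comment> \<open>This circle contains a link of \<open>C\<close> and a link at
        \<open>c\<close>. Followed from \<open>c\<close> in both directions to the first nodes on
        \<open>C\<close>, it provides the ear.\<close>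
      then obtain C' where C': "circ C'" "C' \<subseteq> E" "h \<in> C'" "g \<in> C'" using tw g(1) h DE by (metis subsetD)
      obtain r t W D where d: "h = {r, t}" "upath r t W D" "C' = insert h D"
        using circ_edge[OF C'(1,3)] by metis
      have "c \<in> W" using upath_edge[OF d(2), of g] C'(4) d(3) \<open>h \<noteq> g\<close> g(2) by auto
      then obtain Wr Dr Wt Dt where s: "upath r c Wr Dr" "upath c t Wt Dt" "W = Wr \<union> Wt" "Wr \<inter> Wt = {c}" "D = Dr \<union> Dt"
        using upath_split[OF d(2)] by metis
      have rt: "r \<in> ?X" "t \<in> ?X" using hX d(1) by auto
      obtain x Wx Dx Wx' Dx' where x: "upath c x Wx Dx" "Wr = Wx \<union> Wx'" "Dr = Dx \<union> Dx'" "Wx \<inter> ?X = {x}"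
        using upath_hit[OF upath_rev[OF s(1)] rt(1)] by metis
      obtain y Wy Dy Wy' Dy' where y: "upath c y Wy Dy" "Wt = Wy \<union> Wy'" "Dt = Dy \<union> Dy'" "Wy \<inter> ?X = {y}"
        using upath_hit[OF s(2) rt(2)] by metis
      have i: "c \<in> Wx" "x \<in> Wx" "c \<in> Wy" "y \<in> Wy" using upath_ends[OF x(1)] upath_ends[OF y(1)] by auto
      have xy: "Wx \<inter> Wy = {c}" using s(4) x(2) y(2) i by auto
      have xny: "x \<noteq> y" using xy i x(4) y(4) c by auto
      have XX: "x \<in> ?X" "y \<in> ?X" using x(4) y(4) by auto
      define WE where "WE = Wx \<union> Wy"
      define DE where "DE = Dx \<union> Dy"
      have ear: "upath x y WE DE" unfolding WE_def DE_def using upath_append[OF upath_rev[OF x(1)] y(1) xy] .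
      have DEE: "DE \<subseteq> E" unfolding DE_def using x(3) y(3) s(5) d(3) C'(2) by auto
      have cE: "c \<in> WE" unfolding WE_def using i by auto
      have WEX: "WE \<inter> ?X = {x, y}" unfolding WE_def using x(4) y(4) by auto
      \<comment> \<open>The ear joins inner nodes of different arcs: the path uses \<open>W1\<close>
        up to \<open>x\<close>, then the ear, then \<open>W2\<close> from \<open>y\<close>
        on.\<close>
      have mixed: "\<exists>W D. upath a b W D \<and> D \<subseteq> E \<and> c \<in> W"
        if ear: "upath x y WE DE" "WE \<inter> (W1 \<union> W2) = {x, y}" and W: "upath a b W1 D1" "upath a b W2 D2" "W1 \<inter> W2 = {a, b}"
          "x \<in> W1" "x \<notin> W2" "y \<in> W2" "y \<notin> W1" "D1 \<subseteq> E" "D2 \<subseteq> E"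
        for x y W1 D1 W2 D2
      proof -
        obtain Wa Da Wb Db where 1: "upath a x Wa Da" "upath x b Wb Db" "W1 = Wa \<union> Wb" "Wa \<inter> Wb = {x}" "D1 = Da \<union> Db"
          using upath_split[OF W(1,4)] by metis
        obtain Wc Dc Wd Dd where 2: "upath a y Wc Dc" "upath y b Wd Dd" "W2 = Wc \<union> Wd" "Wc \<inter> Wd = {y}" "D2 = Dc \<union> Dd"
          using upath_split[OF W(2,6)] by metis
        have i: "a \<in> Wa" "x \<in> Wa" "b \<in> Wb" "a \<in> Wc" "y \<in> Wd" "b \<in> Wd" "x \<in> WE" "y \<in> WE"
          using upath_ends[OF 1(1)] upath_ends[OF 1(2)] upath_ends[OF 2(1)] upath_ends[OF 2(2)] upath_ends[OF ear(1)] by auto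
        have "b \<notin> Wa" using 1(4) i W(5) 2(3) by auto
        moreover have "a \<notin> Wd" using 2(4) i W(7) 1(3) by auto
        ultimately have ad: "Wa \<inter> Wd = {}" using W(3) 1(3) 2(3) by auto
        have "Wa \<inter> WE = {x}" using ear(2) 1(3) i W(7) by auto
        note q = upath_append[OF 1(1) ear(1) this]
        have "WE \<inter> Wd = {y}" using ear(2) 2(3) i W(5) by auto
        then have "(Wa \<union> WE) \<inter> Wd = {y}" using ad by (simp add: Int_Un_distrib2)
        note upath_append[OF q 2(2) this]
        then show ?thesis using 1(5) 2(5) W(8,9) DEE cE
          by (intro exI[of _ "Wa \<union> WE \<union> Wd"] exI[of _ "Da \<union> DE \<union> Dd"]) auto
      qed
      consider "x \<in> W1 \<and> y \<in> W1" | "x \<in> W2 \<and> y \<in> W2" | "x \<in> W1 \<and> x \<notin> W2 \<and> y \<in> W2 \<and> y \<notin> W1"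
        | "x \<in> W2 \<and> x \<notin> W1 \<and> y \<in> W1 \<and> y \<notin> W2" using XX by auto
      then show ?thesis
      proof cases
        case 1
        then have "WE \<inter> W1 = {x, y}" using WEX by auto
        then show ?thesis using upath_ear[OF p(1) ear _ xny] DEE DE cE by (metis le_sup_iff order_trans subsetD)
      next
        case 2
        then have "WE \<inter> W2 = {x, y}" using WEX by auto
        then show ?thesis using upath_ear[OF p(2) ear _ xny] DEE DE cE by (metis le_sup_iff order_trans subsetD)
      next
        case 3
        then show ?thesis using mixed[OF ear WEX p(1-3)] \<open>D1 \<subseteq> E\<close> \<open>D2 \<subseteq> E\<close> by auto
      next
        case 4
        have "WE \<inter> (W2 \<union> W1) = {x, y}" "W2 \<inter> W1 = {a, b}" using WEX p(3) by auto
        then show ?thesis using mixed[OF ear _ p(2,1)] 4 \<open>D1 \<subseteq> E\<close> \<open>D2 \<subseteq> E\<close> by auto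
      qed
    qed
  qed
qed

section \<open>Thetas formed by a circle and a chord\<close>

lemma upath_meet_disj:
  assumes "upath a b W1 D1" "upath a b W2 D2" "W1 \<inter> W2 = {a, b}" "g \<in> D1" "g \<notin> D2"
  shows "D1 \<inter> D2 = {}"
proof (rule ccontr)
  assume "D1 \<inter> D2 \<noteq> {}"
  then obtain d where "d \<in> D1 \<inter> D2" by auto
  then have "D1 = D2" using upath_meet[OF assms(1-3)] by metis
  then show False using assms(4,5) by simp
qed

text \<open>\<open>e\<close> and \<open>f\<close> are markers: \<open>e\<close> lies on the first
  path alone, and \<open>f\<close> on the second but not on the third. This rules out two paths that
  are one and the same link.\<close>

lemma uthetaI:
  assumes "upath a b W1 D1" "upath a b W2 D2" "upath a b W3 D3"
    "W1 \<inter> W2 = {a, b}" "W1 \<inter> W3 = {a, b}" "W2 \<inter> W3 = {a, b}" "a \<noteq> b"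
    "e \<in> D1" "e \<notin> D2" "e \<notin> D3" "f \<in> D2" "f \<notin> D3"
  shows "utheta a b W1 D1 W2 D2 W3 D3"
  unfolding utheta_def
  using assms(1-7) upath_meet_disj[OF assms(1,2,4,8,9)] upath_meet_disj[OF assms(1,3,5,8,10)]
    upath_meet_disj[OF assms(2,3,6,11,12)] by simp

text \<open>Without \<open>e\<close> and \<open>f\<close> the circle falls into two paths. A path of
  \<open>E\<close> between the ends of \<open>f\<close> leads from one to the other, and a
  connecting part of it is the chord that separates \<open>e\<close> from \<open>f\<close>.\<close>

lemma circ_chord:
  assumes co: "conn V E" and C: "circ C" "e \<in> C" "f \<in> C" "e \<noteq> f" and e: "e \<notin> E" and f: "f \<notin> E" "f \<subseteq> V"
  obtains a b WA A WB B WR R where "utheta a b WA A WB B WR R" "e \<in> A" "f \<in> B" "R \<subseteq> E" "A \<union> B = C"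
proof -
  obtain u v x y P DP Q DQ where c: "e = {u, v}" "f = {x, y}" "upath v x P DP" "upath y u Q DQ"
    "P \<inter> Q = {}" "C = insert e (insert f (DP \<union> DQ))" "e \<notin> DP \<union> DQ" "f \<notin> DP \<union> DQ"
    using circ_two_edges[OF C] by metis
  have i: "v \<in> P" "x \<in> P" "y \<in> Q" "u \<in> Q" using upath_ends[OF c(3)] upath_ends[OF c(4)] by auto
  have "x \<in> V" "y \<in> V" using f(2) c(2) by auto
  then obtain W0 D0 where W0: "upath y x W0 D0" "D0 \<subseteq> E" using co unfolding conn_def by metis
  obtain q p W R where R: "upath q p W R" "R \<subseteq> D0" "W \<inter> Q = {q}" "W \<inter> P = {p}"
    using connecting_path[OF W0(1) i(3,2)] by metis
  have qp: "q \<in> Q" "p \<in> P" "q \<in> W" "p \<in> W" using R(3,4) by auto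
  obtain Qy Dy Qu Du where q: "upath y q Qy Dy" "upath q u Qu Du" "Q = Qy \<union> Qu" "Qy \<inter> Qu = {q}" "DQ = Dy \<union> Du"
    using upath_split[OF c(4) qp(1)] by metis
  obtain Pv Dv Px Dx where p: "upath v p Pv Dv" "upath p x Px Dx" "P = Pv \<union> Px" "Pv \<inter> Px = {p}" "DP = Dv \<union> Dx"
    using upath_split[OF c(3) qp(2)] by metis
  have j: "q \<in> Qy" "q \<in> Qu" "p \<in> Pv" "p \<in> Px" "y \<in> Qy" "u \<in> Qu" "v \<in> Pv" "x \<in> Px"
    using upath_ends[OF q(1)] upath_ends[OF q(2)] upath_ends[OF p(1)] upath_ends[OF p(2)] by auto
  have "u \<notin> Pv" using c(5) i p(3) by auto
  then have 1: "upath u p (insert u Pv) (insert e Dv)" using upath_cons[OF p(1)] c(1) by simp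
  have "Qu \<inter> insert u Pv = {u}" using c(5) i j p(3) q(3) by auto
  note pe = upath_append[OF q(2) 1 this]
  have "y \<notin> Px" using c(5) i p(3) by auto
  then have 2: "upath y p (insert y Px) (insert f Dx)" using upath_cons[OF upath_rev[OF p(2)]] c(2) by (simp add: insert_commute)
  have "Qy \<inter> insert y Px = {y}" using c(5) i j p(3) q(3) by auto
  note pf = upath_append[OF upath_rev[OF q(1)] 2 this]
  have "utheta q p (Qu \<union> insert u Pv) (Du \<union> insert e Dv) (Qy \<union> insert y Px) (Dy \<union> insert f Dx) W R"
  proof (rule uthetaI[OF pe pf R(1)])
    show "(Qu \<union> insert u Pv) \<inter> (Qy \<union> insert y Px) = {q, p}"
      using c(5) p(3,4) q(3,4) j by auto
    show "(Qu \<union> insert u Pv) \<inter> W = {q, p}" "(Qy \<union> insert y Px) \<inter> W = {q, p}"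
      using R(3,4) p(3) q(3) j by auto
    show "q \<noteq> p" using c(5) qp by auto
    show "e \<in> Du \<union> insert e Dv" "f \<in> Dy \<union> insert f Dx" by auto
    show "e \<notin> R" "f \<notin> R" using e f(1) R(2) W0(2) by auto
    show "e \<notin> Dy \<union> insert f Dx" using C(4) c(7) p(5) q(5) by auto
  qed
  moreover have "(Du \<union> insert e Dv) \<union> (Dy \<union> insert f Dx) = C" unfolding c(6) p(5) q(5) by auto
  moreover have "e \<in> Du \<union> insert e Dv" "f \<in> Dy \<union> insert f Dx" by auto
  moreover have "R \<subseteq> E" using R(2) W0(2) by auto
  ultimately show thesis using that by metis
qed

lemma section_patch:
  assumes "\<And>d. K d \<noteq> {}" "\<And>d. d \<in> C \<Longrightarrow> s d \<in> K d"
  obtains s' where "\<And>d. s' d \<in> K d" "\<And>d. d \<in> C \<Longrightarrow> s' d = s d"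
proof (rule that)
  let ?s = "\<lambda>d. if d \<in> C then s d else (SOME k. k \<in> K d)"
  show "?s d \<in> K d" for d using assms some_in_eq by auto
qed auto

text \<open>Sections with values in \<open>K\<close> everywhere suffice, as balance depends only on
  the labels on the circle and no label set is empty.\<close>

lemma bexpI:
  assumes ne: "\<And>d. K d \<noteq> {}" and cong: "\<And>C s t. (\<And>e. e \<in> C \<Longrightarrow> s e = t e) \<Longrightarrow> b C s = b C t"
    and section_lift: "\<And>C e s. circ C \<Longrightarrow> C \<subseteq> E \<Longrightarrow> e \<in> C \<Longrightarrow> (\<And>d. s d \<in> K d) \<Longrightarrow> \<exists>!k. k \<in> K e \<and> b C (s(e := k))"
    and th: "\<And>x y W1 D1 W2 D2 W3 D3 s. utheta x y W1 D1 W2 D2 W3 D3 \<Longrightarrow> D1 \<union> D2 \<union> D3 \<subseteq> E \<Longrightarrow>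
        (\<And>d. s d \<in> K d) \<Longrightarrow> b (D1 \<union> D2) s \<Longrightarrow> b (D1 \<union> D3) s \<Longrightarrow> b (D2 \<union> D3) s"
  shows "bexp K E b"
  unfolding bexp_def theta_prop_def
proof (intro conjI allI impI)
  show "b C s = b C t" if "\<forall>e\<in>C. s e = t e" for C s t using cong that by metis
next
  fix x y W1 D1 W2 D2 W3 D3 s
  assume *: "utheta x y W1 D1 W2 D2 W3 D3" "D1 \<union> D2 \<union> D3 \<subseteq> E" "\<forall>d\<in>D1 \<union> D2 \<union> D3. s d \<in> K d"
    "b (D1 \<union> D2) s" "b (D1 \<union> D3) s"
  obtain s' where s': "\<And>d. s' d \<in> K d" "\<And>d. d \<in> D1 \<union> D2 \<union> D3 \<Longrightarrow> s' d = s d"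
    using section_patch[of K "D1 \<union> D2 \<union> D3" s] ne *(3) by blast
  have "b (D1 \<union> D2) s' = b (D1 \<union> D2) s" "b (D1 \<union> D3) s' = b (D1 \<union> D3) s" "b (D2 \<union> D3) s' = b (D2 \<union> D3) s"
    using s'(2) by (auto intro!: cong)
  then show "b (D2 \<union> D3) s" using th[OF *(1,2) s'(1)] *(4,5) by simp
next
  fix C e s assume *: "circ C" "C \<subseteq> E" "e \<in> C" "\<forall>d\<in>C - {e}. s d \<in> K d"
  obtain s' where s': "\<And>d. s' d \<in> K d" "\<And>d. d \<in> C - {e} \<Longrightarrow> s' d = s d"
    using section_patch[of K "C - {e}" s] ne *(4) by blast
  have "b C (s'(e := k)) = b C (s(e := k))" for k by (rule cong) (use s'(2) in auto)
  then show "\<exists>!k. k \<in> K e \<and> b C (s(e := k))" using section_lift[OF *(1-3) s'(1)] by simp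
qed

subsection \<open>Independence of the chord\<close>

text \<open>Two links off \<open>E\<close> are separated by a chord \<open>R\<close> in
  \<open>E\<close>, and both resulting circles have fewer such links. A label on \<open>R\<close> is
  chosen so that one of them is balanced for \<open>b1\<close>, hence for \<open>b2\<close>; the
  exchange then reduces the whole circle to the other one, for both classes.\<close>

lemma agree_all:
  assumes 1: "bexp K F b1" and 2: "bexp K F b2" and co: "conn V E" and E: "E \<subseteq> F" and V: "\<Union>F \<subseteq> V"
    and ne: "\<And>d. K d \<noteq> {}"
    and link_graph: "\<And>C s. circ C \<Longrightarrow> C \<subseteq> F \<Longrightarrow> card (C - E) \<le> 1 \<Longrightarrow> (\<And>d. s d \<in> K d) \<Longrightarrow> b1 C s = b2 C s"
  shows "agree K F b1 b2"
proof -
  note t1 = bexp_theta_prop[OF 1] and t2 = bexp_theta_prop[OF 2]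
  have "b1 C s = b2 C s" if "circ C" "C \<subseteq> F" "\<And>d. s d \<in> K d" for C s
    using that
  proof (induction "card (C - E)" arbitrary: C s rule: less_induct)
    case less
    note C = less.prems(1,2) and K = less.prems(3)
    show ?case
    proof (cases "card (C - E) \<le> 1")
      case True
      then show ?thesis using link_graph C K by metis
    next
      case False
      have fin: "finite (C - E)" using circ_finite[OF C(1)] by simp
      then obtain e f where ef: "e \<in> C" "e \<notin> E" "f \<in> C" "f \<notin> E" "e \<noteq> f"
        using False card_le_Suc0_iff_eq[OF fin] by auto
      have fV: "f \<subseteq> V" using ef(3) C(2) V by auto
      obtain a b WA A WB B WR R where th: "utheta a b WA A WB B WR R" "e \<in> A" "f \<in> B" "R \<subseteq> E" "A \<union> B = C"
        using circ_chord[OF co C(1) ef(1,3,5,2,4) fV] by metis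
      have dis: "A \<inter> B = {}" "A \<inter> R = {}" "B \<inter> R = {}" using th(1) unfolding utheta_def by auto
      have sub: "A \<subseteq> C" "B \<subseteq> C" "A \<subseteq> F" "B \<subseteq> F" "R \<subseteq> F" using th(4,5) C(2) E by auto
      have "(A \<union> R) - E \<subset> C - E" using th(3,4) ef(3,4) dis(1) sub(1) by auto
      then have c1: "card ((A \<union> R) - E) < card (C - E)" using fin psubset_card_mono by metis
      have "(B \<union> R) - E \<subset> C - E" using th(2,4) ef(1,2) dis(1) sub(2) by auto
      then have c2: "card ((B \<union> R) - E) < card (C - E)" using fin psubset_card_mono by metis
      note cc = utheta_circ[OF th(1)]
      obtain r where r: "r \<in> R" using upath_nonempty[of a b WR R] th(1) unfolding utheta_def by auto
      have AR: "A \<union> R \<subseteq> F" "r \<in> A \<union> R" "B \<union> R \<subseteq> F" using sub r by auto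
      obtain k where k: "k \<in> K r" "b1 (A \<union> R) (s(r := k))" using bexp_lift[OF 1 cc(2) AR(1,2), of s] K by auto
      define t where "t = s(r := k)"
      have K': "t d \<in> K d" for d using K k(1) unfolding t_def by simp
      have "r \<notin> C" using r dis th(5) by auto
      then have s: "b1 C t = b1 C s" "b2 C t = b2 C s" unfolding t_def using theta_prop_upd[OF t1] theta_prop_upd[OF t2] by metis+
      have kt: "b1 (A \<union> R) t" using k(2) unfolding t_def .
      have IH: "b2 (A \<union> R) t" "b1 (B \<union> R) t = b2 (B \<union> R) t"
        using less.hyps[OF c1 cc(2) AR(1) K'] less.hyps[OF c2 cc(3) AR(3) K'] kt by simp_all
      have BA: "B \<union> A \<union> R \<subseteq> F" using sub by auto
      have "b1 (B \<union> A) t = b1 (B \<union> R) t" using theta_prop_iff[where s = t, OF t1 utheta_perm(1)[OF th(1)] BA K' kt] .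
      moreover have "b2 (B \<union> A) t = b2 (B \<union> R) t" using theta_prop_iff[where s = t, OF t2 utheta_perm(1)[OF th(1)] BA K' IH(1)] .
      moreover have "B \<union> A = C" using th(5) by auto
      ultimately show ?thesis using s IH(2) by simp
    qed
  qed
  note all = this
  show ?thesis unfolding agree_def
  proof (intro allI impI)
    fix C s assume C: "circ C" "C \<subseteq> F" "\<forall>d\<in>C. s d \<in> K d"
    obtain s' where s': "\<And>d. s' d \<in> K d" "\<And>d. d \<in> C \<Longrightarrow> s' d = s d" using section_patch[of K C s] ne C(3) by blast
    have "b1 C s' = b1 C s" "b2 C s' = b2 C s"
      by (rule theta_prop_cong[OF t1]; use s'(2) in auto) (rule theta_prop_cong[OF t2]; use s'(2) in auto)
    then show "b1 C s = b2 C s" using all[OF C(1,2) s'(1)] by simp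
  qed
qed

text \<open>This recovers \<open>P\<close> from the links alone: after removal of \<open>e\<close>
  and \<open>f\<close> from the circle, \<open>P\<close> is the component of
  \<open>v\<close>.\<close>

lemma upath_stays:
  "upath a b W D \<Longrightarrow> a \<in> P \<Longrightarrow> D \<subseteq> D1 \<union> D2 \<Longrightarrow> \<Union>D1 \<subseteq> P \<Longrightarrow> \<Union>D2 \<inter> P = {} \<Longrightarrow> W \<subseteq> P \<and> D \<subseteq> D1"
proof (induction rule: upath.induct)
  case (upath_refl a) then show ?case by simp
next
  case (upath_step b c W D a)
  have "{a, b} \<notin> D2" using upath_step.prems(1,4) by auto
  then have ab: "{a, b} \<in> D1" using upath_step.prems(2) by auto
  then have "b \<in> P" using upath_step.prems(3) by auto
  then have "W \<subseteq> P \<and> D \<subseteq> D1" using upath_step.IH upath_step.prems(2-4) by simp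
  then show ?case using ab upath_step.prems(1) by simp
qed

text \<open>Removing \<open>e\<close> and \<open>f\<close> from the paths beside \<open>R\<close>
  and joining the pieces at the ends of the theta yields \<open>P\<close> and \<open>Q\<close>,
  which \<open>R\<close> connects.\<close>

lemma utheta_chord:
  assumes th: "utheta a b WA A WB B WR R" and e: "e \<in> A" "e = {u, v}" and f: "f \<in> B" and R: "R \<subseteq> E"
  obtains x y P DP Q DQ q p W Dy Du Dv Dx where "f = {x, y}" "upath v x P DP" "upath y u Q DQ" "P \<inter> Q = {}"
    "A \<union> B = insert e (insert f (DP \<union> DQ))" "e \<notin> DP \<union> DQ" "f \<notin> DP \<union> DQ"
    "A = insert e (Du \<union> Dv)" "B = insert f (Dy \<union> Dx)" "is_chord E u v x y P DP Q DQ q p W R Dy Du Dv Dx"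
proof -
  \<comment> \<open>The ends of the theta are interchanged if necessary, so that \<open>e\<close> is
    passed from \<open>u\<close> to \<open>v\<close>.\<close>
  obtain a' b' Wu Du Wv Dv where th': "utheta a' b' WA A WB B WR R" and s: "upath a' u Wu Du" "upath v b' Wv Dv"
    "WA = Wu \<union> Wv" "Wu \<inter> Wv = {}" "A = insert e (Du \<union> Dv)" "e \<notin> Du" "e \<notin> Dv"
  proof -
    have A: "upath a b WA A" using th by (simp add: utheta_def)
    obtain r t W1 D1 W2 D2 where s: "e = {r, t}" "upath a r W1 D1" "upath t b W2 D2" "WA = W1 \<union> W2" "W1 \<inter> W2 = {}"
      "A = insert e (D1 \<union> D2)" "e \<notin> D1" "e \<notin> D2" using upath_edge_split[OF A e(1)] by metis
    have "(r = u \<and> t = v) \<or> (r = v \<and> t = u)" using s(1) e(2) by (auto simp: doubleton_eq_iff)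
    then show thesis
    proof
      assume "r = u \<and> t = v" then show thesis using that[OF th] s by metis
    next
      assume "r = v \<and> t = u"
      then show thesis using that[OF utheta_perm(6)[OF th], of W2 D2 W1 D1] s upath_rev[OF s(2)] upath_rev[OF s(3)]
        by (simp add: Un_commute Int_commute)
    qed
  qed
  have B: "upath a' b' WB B" and ab: "a' \<noteq> b'" "WA \<inter> WB = {a', b'}" "WA \<inter> WR = {a', b'}" "WB \<inter> WR = {a', b'}"
    and RR: "upath a' b' WR R" and AB: "A \<inter> B = {}"
    using th' by (auto simp: utheta_def)
  obtain y x Wy Dy Wx Dx where t: "f = {y, x}" "upath a' y Wy Dy" "upath x b' Wx Dx" "WB = Wy \<union> Wx" "Wy \<inter> Wx = {}"
      "B = insert f (Dy \<union> Dx)" "f \<notin> Dy" "f \<notin> Dx" using upath_edge_split[OF B f] by metis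
  have i: "a' \<in> Wu" "b' \<in> Wv" "a' \<in> Wy" "b' \<in> Wx"
    using upath_ends[OF s(1)] upath_ends[OF s(2)] upath_ends[OF t(2)] upath_ends[OF t(3)] by auto
  have ni: "b' \<notin> Wu" "a' \<notin> Wv" "b' \<notin> Wy" "a' \<notin> Wx" using i s(4) t(5) by auto
  have sub: "Wu \<inter> Wy \<subseteq> {a', b'}" "Wv \<inter> Wx \<subseteq> {a', b'}" "Wu \<inter> Wx \<subseteq> {a', b'}" "Wv \<inter> Wy \<subseteq> {a', b'}"
    using ab(2) s(3) t(4) by auto
  have int: "Wy \<inter> Wu = {a'}" "Wv \<inter> Wx = {b'}" "Wu \<inter> Wx = {}" "Wv \<inter> Wy = {}" using i ni sub by auto
  note Qp = upath_append[OF upath_rev[OF t(2)] s(1) int(1)] and Pp = upath_append[OF s(2) upath_rev[OF t(3)] int(2)]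
  have PQ: "(Wv \<union> Wx) \<inter> (Wy \<union> Wu) = {}" using s(4) t(5) int(3,4) by auto
  have rr: "WR \<inter> (Wy \<union> Wu) = {a'}" "WR \<inter> (Wv \<union> Wx) = {b'}"
    using ab(3,4) s(3) t(4) i ni upath_ends[OF RR] by auto
  have ch: "is_chord E u v x y (Wv \<union> Wx) (Dv \<union> Dx) (Wy \<union> Wu) (Dy \<union> Du) a' b' WR R Dy Du Dv Dx"
    unfolding is_chord_def
    using RR R rr upath_rev[OF t(2)] s(1,2) upath_rev[OF t(3)] int(1,2) by blast
  show thesis
  proof (rule that[OF _ Pp Qp PQ _ _ _ s(5) t(6) ch])
    show "f = {x, y}" using t(1) by auto
    show "A \<union> B = insert e (insert f (Dv \<union> Dx \<union> (Dy \<union> Du)))" using s(5) t(6) by auto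
    show "e \<notin> Dv \<union> Dx \<union> (Dy \<union> Du)" "f \<notin> Dv \<union> Dx \<union> (Dy \<union> Du)" using s(5-7) t(6-8) AB by auto
  qed
qed

text \<open>Both thetas contain the same circle, so they give two chords of one frame, which
  \<open>chord_independent\<close> compares.\<close>

lemma theta_independent:
  assumes b0: "bexp K E b0" and be: "theta_prop K (insert e E) be" and bf: "theta_prop K (insert f E) bf"
    and ag: "agree K E be b0" "agree K E bf b0" and ef: "e \<noteq> f" "e \<notin> E" "f \<notin> E" "card e = 2"
    and 3: "three_conn_path V E" and V: "\<Union>E \<subseteq> V" "e \<subseteq> V" "f \<subseteq> V"
    and th: "utheta a b WA A WB B WR R" "e \<in> A" "f \<in> B" "R \<subseteq> E"
    and th': "utheta a' b' WA' A' WB' B' WR' R'" "e \<in> A'" "f \<in> B'" "R' \<subseteq> E"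
    and C: "A \<union> B = A' \<union> B'" "A \<union> B \<subseteq> insert e (insert f E)"
    and K: "\<And>d. s d \<in> K d" "\<And>d. s' d \<in> K d" and eq: "\<And>d. d \<in> A \<union> B \<Longrightarrow> s d = s' d"
    and b: "be (A \<union> R) s" "bf (B \<union> R) s" "be (A' \<union> R') s'"
  shows "bf (B' \<union> R') s'"
proof -
  obtain u v where e: "e = {u, v}" using ef(4) by (auto simp: card_2_iff)
  obtain x y P DP Q DQ q p W Dy Du Dv Dx where 1: "f = {x, y}" "upath v x P DP" "upath y u Q DQ" "P \<inter> Q = {}"
    "A \<union> B = insert e (insert f (DP \<union> DQ))" "e \<notin> DP \<union> DQ" "f \<notin> DP \<union> DQ"
    "A = insert e (Du \<union> Dv)" "B = insert f (Dy \<union> Dx)" "is_chord E u v x y P DP Q DQ q p W R Dy Du Dv Dx"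
    using utheta_chord[OF th(1,2) e th(3,4)] by metis
  obtain x' y' P' DP' Q' DQ' q' p' W' Dy' Du' Dv' Dx' where 2: "f = {x', y'}" "upath v x' P' DP'" "upath y' u Q' DQ'" "P' \<inter> Q' = {}"
    "A' \<union> B' = insert e (insert f (DP' \<union> DQ'))" "e \<notin> DP' \<union> DQ'" "f \<notin> DP' \<union> DQ'"
    "A' = insert e (Du' \<union> Dv')" "B' = insert f (Dy' \<union> Dx')" "is_chord E u v x' y' P' DP' Q' DQ' q' p' W' R' Dy' Du' Dv' Dx'"
    using utheta_chord[OF th'(1,2) e th'(3,4)] by metis
  have D: "DP \<union> DQ = DP' \<union> DQ'"
  proof -
    have "DP \<union> DQ = (A \<union> B) - {e, f}" unfolding 1(5) using 1(6,7) by auto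
    moreover have "DP' \<union> DQ' = (A' \<union> B') - {e, f}" unfolding 2(5) using 2(6,7) by auto
    ultimately show ?thesis using C(1) by simp
  qed
  have i: "v \<in> P" "x \<in> P" "y \<in> Q" "u \<in> Q" "v \<in> P'" "x' \<in> P'" "y' \<in> Q'" "u \<in> Q'"
    using upath_ends[OF 1(2)] upath_ends[OF 1(3)] upath_ends[OF 2(2)] upath_ends[OF 2(3)] by auto
  have U: "\<Union>DP \<subseteq> P" "\<Union>DQ \<subseteq> Q" "\<Union>DP' \<subseteq> P'" "\<Union>DQ' \<subseteq> Q'"
    using upath_Union[OF 1(2)] upath_Union[OF 1(3)] upath_Union[OF 2(2)] upath_Union[OF 2(3)] by auto
  \<comment> \<open>The two paths left after removing \<open>e\<close> and \<open>f\<close> depend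
    on the circle only, not on the theta.\<close>
  have "P' \<subseteq> P \<and> DP' \<subseteq> DP" by (rule upath_stays[OF 2(2) i(1), of DP DQ]) (use D U 1(4) in auto)
  moreover have "P \<subseteq> P' \<and> DP \<subseteq> DP'" by (rule upath_stays[OF 1(2) i(5), of DP' DQ']) (use D U 2(4) in auto)
  ultimately have PP: "P' = P" "DP' = DP" by auto
  have "Q' \<subseteq> Q \<and> DQ' \<subseteq> DQ" by (rule upath_stays[OF upath_rev[OF 2(3)] i(4), of DQ DP]) (use D U 1(4) in auto)
  moreover have "Q \<subseteq> Q' \<and> DQ \<subseteq> DQ'" by (rule upath_stays[OF upath_rev[OF 1(3)] i(8), of DQ' DP']) (use D U 2(4) in auto)
  ultimately have QQ: "Q' = Q" "DQ' = DQ" by auto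
  have "x' = x" "y' = y" using 1(1,4) 2(1) PP(1) QQ(1) i by (auto simp: doubleton_eq_iff)
  note c' = 2(10)[unfolded this PP QQ]
  have PQE: "DP \<union> DQ \<subseteq> E" using 1(5-7) C(2) by auto
  interpret chord_frame K E b0 be bf e f u v x y P DP Q DQ
    using b0 be bf ag e ef(2) 1(1) ef(3) 1(2,3,4) PQE by unfold_locales
  have "\<Union>DP \<subseteq> V" "\<Union>DQ \<subseteq> V" "u \<in> V" "v \<in> V" "x \<in> V" "y \<in> V"
    using PQE V e 1(1) by auto
  then have "P \<subseteq> V" "Q \<subseteq> V"
    using upath_verts[OF 1(2)] upath_verts[OF 1(3)] by (meson insert_subset order_trans)+
  then have PQV: "P \<union> Q \<subseteq> V" by simp
  \<comment> \<open>Two auxiliary chords are obtained from two different nodes on one of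
    \<open>P\<close> and \<open>Q\<close>. Since \<open>e \<noteq> f\<close>, these paths are not
    both trivial.\<close>
  have "\<exists>q1 p1 W1 R1 q2 p2 W2 R2.
    upath q1 p1 W1 R1 \<and> R1 \<subseteq> E \<and> W1 \<inter> Q = {q1} \<and> W1 \<inter> P = {p1} \<and>
    upath q2 p2 W2 R2 \<and> R2 \<subseteq> E \<and> W2 \<inter> Q = {q2} \<and> W2 \<inter> P = {p2} \<and> W1 \<inter> W2 \<subseteq> Q \<union> P \<and> R1 \<inter> R2 = {}"
  proof (cases "y = u")
    case False
    obtain q1 p1 W1 R1 q2 p2 W2 R2 where c: "upath q1 p1 W1 R1" "R1 \<subseteq> E" "W1 \<inter> Q = {q1}" "W1 \<inter> P = {p1}"
      "upath q2 p2 W2 R2" "R2 \<subseteq> E" "W2 \<inter> Q = {q2}" "W2 \<inter> P = {p2}" "W1 \<inter> W2 \<subseteq> P" "R1 \<inter> R2 = {}"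
      using two_connecting_paths[OF 3 i(3,4) False i(1) 1(4) PQV] by metis
    then have "W1 \<inter> W2 \<subseteq> Q \<union> P" by auto
    then show ?thesis using c by blast
  next
    case True
    then have vx: "v \<noteq> x" using ef(1) e 1(1) by auto
    have QP: "Q \<inter> P = {}" "Q \<union> P \<subseteq> V" using 1(4) PQV by auto
    obtain q1 p1 W1 R1 q2 p2 W2 R2 where c: "upath q1 p1 W1 R1" "R1 \<subseteq> E" "W1 \<inter> P = {q1}" "W1 \<inter> Q = {p1}"
      "upath q2 p2 W2 R2" "R2 \<subseteq> E" "W2 \<inter> P = {q2}" "W2 \<inter> Q = {p2}" "W1 \<inter> W2 \<subseteq> Q" "R1 \<inter> R2 = {}"
      using two_connecting_paths[OF 3 i(1,2) vx i(3) QP] by metis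
    then have "W1 \<inter> W2 \<subseteq> Q \<union> P" by auto
    then show ?thesis using c upath_rev[OF c(1)] upath_rev[OF c(5)] by blast
  qed
  then obtain q1 p1 W1 R1 q2 p2 W2 R2 where
    r1: "upath q1 p1 W1 R1" "R1 \<subseteq> E" "W1 \<inter> Q = {q1}" "W1 \<inter> P = {p1}" and
    r2: "upath q2 p2 W2 R2" "R2 \<subseteq> E" "W2 \<inter> Q = {q2}" "W2 \<inter> P = {p2}" and dis: "W1 \<inter> W2 \<subseteq> Q \<union> P" "R1 \<inter> R2 = {}"
    by metis
  have section_graph: "\<exists>Dy Du Dv Dx. chord q p W R Dy Du Dv Dx" if r: "upath q p W R" "R \<subseteq> E" "W \<inter> Q = {q}" "W \<inter> P = {p}" for q p W R
  proof -
    have "q \<in> Q" "p \<in> P" using r by auto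
    obtain Qy Dy Qu Du where q: "upath y q Qy Dy" "upath q u Qu Du" "Q = Qy \<union> Qu" "Qy \<inter> Qu = {q}" "DQ = Dy \<union> Du"
      using upath_split[OF 1(3) \<open>q \<in> Q\<close>] by metis
    obtain Pv Dv Px Dx where p: "upath v p Pv Dv" "upath p x Px Dx" "P = Pv \<union> Px" "Pv \<inter> Px = {p}" "DP = Dv \<union> Dx"
      using upath_split[OF 1(2) \<open>p \<in> P\<close>] by metis
    have "chord q p W R Dy Du Dv Dx" unfolding is_chord_def using r q p by metis
    then show ?thesis by metis
  qed
  obtain Dy1 Du1 Dv1 Dx1 where c1: "chord q1 p1 W1 R1 Dy1 Du1 Dv1 Dx1" using section_graph[OF r1] by metis
  obtain Dy2 Du2 Dv2 Dx2 where c2: "chord q2 p2 W2 R2 Dy2 Du2 Dv2 Dx2" using section_graph[OF r2] by metis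
  have "bf (insert f (Dy' \<union> Dx' \<union> R')) s'"
  proof (rule chord_independent[OF c1 c2 dis 1(10) c' K])
    show "\<And>d. d \<in> insert e (insert f (DP \<union> DQ)) \<Longrightarrow> s d = s' d" using eq unfolding 1(5) by simp
    show "be (insert e (Du \<union> Dv \<union> R)) s" using b(1) unfolding 1(8) by simp
    show "bf (insert f (Dy \<union> Dx \<union> R)) s" using b(2) unfolding 1(9) by simp
    show "be (insert e (Du' \<union> Dv' \<union> R')) s'" using b(3) unfolding 2(8) by simp
  qed
  then show ?thesis unfolding 2(9) by simp
qed

subsection \<open>Extension to two links\<close>

lemma upath_append3:
  assumes "upath a b W1 D1" "upath b c W2 D2" "upath c d W3 D3"
    "W1 \<inter> W2 = {b}" "W2 \<inter> W3 = {c}" "W1 \<inter> W3 \<subseteq> {c}"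
  shows "upath a d (W1 \<union> W2 \<union> W3) (D1 \<union> D2 \<union> D3)"
proof -
  have "(W1 \<union> W2) \<inter> W3 = {c}" using assms(5,6) by auto
  then show ?thesis using upath_append[OF upath_append[OF assms(1,2,4)] assms(3)] by simp
qed

lemma upath_bridge:
  assumes "upath a u W1 D1" "upath v b W2 D2" "W1 \<inter> W2 = {}" "e = {u, v}"
  shows "upath a b (W1 \<union> W2) (insert e (D1 \<union> D2))"
proof -
  have i: "u \<in> W1" "v \<in> W2" using upath_ends[OF assms(1)] upath_ends[OF assms(2)] by auto
  then have "u \<notin> W2" using assms(3) by auto
  then have "upath u b (insert u W2) (insert e D2)" using upath_cons[OF assms(2)] assms(4) by simp
  moreover have "W1 \<inter> insert u W2 = {u}" using assms(3) i by auto
  ultimately have "upath a b (W1 \<union> insert u W2) (D1 \<union> insert e D2)" using upath_append[OF assms(1)] by metis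
  moreover have "W1 \<union> insert u W2 = W1 \<union> W2" using i by auto
  ultimately show ?thesis by simp
qed

text \<open>The section \<open>s'\<close> differs from \<open>s\<close> only off the circle; it
  supplies the lift of the chord \<open>R\<close>.\<close>

definition joint where
  "joint K E be bf e f C s \<longleftrightarrow> (\<exists>a b WA A WB B WR R s'. utheta a b WA A WB B WR R \<and> e \<in> A \<and> f \<in> B \<and> R \<subseteq> E \<and>
     A \<union> B = C \<and> (\<forall>d. s' d \<in> K d) \<and> (\<forall>d\<in>C. s' d = s d) \<and> be (A \<union> R) s' \<and> bf (B \<union> R) s')"

lemma joint_sym: "joint K E be bf e f = joint K E bf be f e"
proof -
  have "joint K E bf be f e C s" if "joint K E be bf e f C s" for be bf e f C s
    using that utheta_perm(1) unfolding joint_def by (metis Un_commute)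
  then show ?thesis by blast
qed

locale amalgam =
  fixes K :: "'v set \<Rightarrow> 'k set" and V E b0 be bf e f
  assumes b0: "bexp K E b0" and be: "bexp K (insert e E) be" and bf: "bexp K (insert f E) bf"
    and agree_e: "agree K E be b0" and agree_f: "agree K E bf b0"
    and ef: "e \<noteq> f" "e \<notin> E" "f \<notin> E" "card e = 2" "card f = 2"
    and conn: "conn V E" and three: "three_conn_path V E"
    and V: "\<Union>E \<subseteq> V" "e \<subseteq> V" "f \<subseteq> V" and K_ne: "\<And>d. K d \<noteq> {}"
begin

abbreviation "EE \<equiv> insert e (insert f E)"
abbreviation "jo \<equiv> joint K E be bf e f"

text \<open>Independence of the chord turns the existential definition into a test: any chord, with
  any lift that balances the side of \<open>e\<close>, decides.\<close>

lemma joint_iff: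
  assumes th: "utheta a b WA A WB B WR R" "e \<in> A" "f \<in> B" "R \<subseteq> E" "A \<union> B \<subseteq> EE"
    and K: "\<And>d. s d \<in> K d" and b: "be (A \<union> R) s"
  shows "jo (A \<union> B) s = bf (B \<union> R) s"
proof
  assume "bf (B \<union> R) s"
  then show "jo (A \<union> B) s" unfolding joint_def using th(1-4) K b by metis
next
  assume "jo (A \<union> B) s"
  then obtain a' b' WA' A' WB' B' WR' R' s' where j: "utheta a' b' WA' A' WB' B' WR' R'" "e \<in> A'" "f \<in> B'" "R' \<subseteq> E"
     "A' \<union> B' = A \<union> B" "\<And>d. s' d \<in> K d" "\<And>d. d \<in> A \<union> B \<Longrightarrow> s' d = s d" "be (A' \<union> R') s'" "bf (B' \<union> R') s'"
    unfolding joint_def by metis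
  have "A' \<union> B' \<subseteq> EE" using j(5) th(5) by simp
  from theta_independent[OF b0 bexp_theta_prop[OF be] bexp_theta_prop[OF bf] agree_e agree_f ef(1-4) three V
      j(1-4) th(1-4) j(5) this, of s' s] j(5-9) K b
  show "bf (B \<union> R) s" by metis
qed

text \<open>A path \<open>insert e (insert f (DA \<union> DM \<union> DB))\<close> from \<open>a\<close> to \<open>b\<close> through \<open>e\<close> and then \<open>f\<close>,
  and a chord \<open>R\<close> that joins its middle part \<open>DM\<close> to one of its outer parts.\<close>

lemma same_path_outer:
  assumes th: "utheta a b W1 D1 W2 D2 W3 D3" and sub: "D1 \<union> D2 \<union> D3 \<subseteq> EE"
    and D1: "D1 = insert e (insert f (DA \<union> DM \<union> DB))" "W1 = WA \<union> WM \<union> WB"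
      "WA \<inter> WM = {}" "WA \<inter> WB = {}" "WM \<inter> WB = {}"
    and p: "upath a u WA DA" "e = {u, v}" "upath v x WM DM" "f = {x, y}" "upath y b WB DB"
    and nef: "e \<notin> DA \<union> DM \<union> DB" "f \<notin> DA \<union> DM \<union> DB" "e \<notin> D2 \<union> D3" "f \<notin> D2 \<union> D3"
    and R: "upath q p WR R" "R \<subseteq> E" "q \<in> WA" "WR \<inter> WM = {p}" "WR \<inter> (WA \<union> WB \<union> W2 \<union> W3) = {q}"
    and K: "\<And>d. s d \<in> K d"
  obtains s' F2 F3 c d V1 C1 V2 C2 V3 C3 where "\<And>d. s' d \<in> K d" "\<And>d. d \<in> D1 \<union> D2 \<union> D3 \<Longrightarrow> s' d = s d"
    "jo (D1 \<union> D2) s' = bf F2 s'" "jo (D1 \<union> D3) s' = bf F3 s'"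
    "utheta c d V1 C1 V2 C2 V3 C3" "C1 \<union> C2 \<union> C3 \<subseteq> insert f E" "F2 = C1 \<union> C2" "F3 = C1 \<union> C3" "D2 \<union> D3 = C2 \<union> C3"
proof -
  have T: "upath a b W1 D1" "upath a b W2 D2" "upath a b W3 D3" "a \<noteq> b"
    "W1 \<inter> W2 = {a, b}" "W1 \<inter> W3 = {a, b}" "W2 \<inter> W3 = {a, b}" "D1 \<inter> D2 = {}" "D1 \<inter> D3 = {}" "D2 \<inter> D3 = {}"
    using th by (auto simp: utheta_def)
  have i: "a \<in> WA" "u \<in> WA" "v \<in> WM" "x \<in> WM" "y \<in> WB" "b \<in> WB" "a \<in> W2" "b \<in> W2" "a \<in> W3" "b \<in> W3" "q \<in> WR" "p \<in> WR"
    using upath_ends[OF p(1)] upath_ends[OF p(3)] upath_ends[OF p(5)] upath_ends[OF T(2)] upath_ends[OF T(3)]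
      upath_ends[OF R(1)] by auto
  have pM: "p \<in> WM" using R(4) by auto
  obtain W4 D4 W5 D5 where A: "upath a q W4 D4" "upath q u W5 D5" "WA = W4 \<union> W5" "W4 \<inter> W5 = {q}" "DA = D4 \<union> D5"
    using upath_split[OF p(1) R(3)] by metis
  obtain W6 D6 W7 D7 where M: "upath v p W6 D6" "upath p x W7 D7" "WM = W6 \<union> W7" "W6 \<inter> W7 = {p}" "DM = D6 \<union> D7"
    using upath_split[OF p(3) pM] by metis
  have k: "q \<in> W4" "q \<in> W5" "a \<in> W4" "p \<in> W6" "p \<in> W7" "x \<in> W7" "u \<in> W5" "v \<in> W6"
    using upath_ends[OF A(1)] upath_ends[OF A(2)] upath_ends[OF M(1)] upath_ends[OF M(2)] by auto
  have cap1: "\<And>z. z \<in> WA \<Longrightarrow> z \<in> WM \<Longrightarrow> False" "\<And>z. z \<in> WA \<Longrightarrow> z \<in> WB \<Longrightarrow> False" "\<And>z. z \<in> WM \<Longrightarrow> z \<in> WB \<Longrightarrow> False"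
    using D1(3-5) by auto
  have cap2: "\<And>z. z \<in> W4 \<Longrightarrow> z \<in> WA" "\<And>z. z \<in> W5 \<Longrightarrow> z \<in> WA" "\<And>z. z \<in> W6 \<Longrightarrow> z \<in> WM" "\<And>z. z \<in> W7 \<Longrightarrow> z \<in> WM"
    using A(3) M(3) by auto
  have cap3: "\<And>z. z \<in> W4 \<Longrightarrow> z \<in> W5 \<Longrightarrow> z = q" "\<And>z. z \<in> W6 \<Longrightarrow> z \<in> W7 \<Longrightarrow> z = p"
    using A(4) M(4) by auto
  note cap = cap1 cap2 cap3
  have outer: "\<And>z. z \<in> WA \<Longrightarrow> z \<in> W \<Longrightarrow> z = a" "\<And>z. z \<in> WB \<Longrightarrow> z \<in> W \<Longrightarrow> z = b" "\<And>z. z \<in> WM \<Longrightarrow> z \<in> W \<Longrightarrow> False"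
    if "W1 \<inter> W = {a, b}" for W
  proof -
    show "z = a" if "z \<in> WA" "z \<in> W" for z using \<open>W1 \<inter> W = {a, b}\<close> that D1(2) cap(2) i by auto
    show "z = b" if "z \<in> WB" "z \<in> W" for z using \<open>W1 \<inter> W = {a, b}\<close> that D1(2) cap(2) i by auto
    show "False" if "z \<in> WM" "z \<in> W" for z using \<open>W1 \<inter> W = {a, b}\<close> that D1(2) cap(1,3) i by auto
  qed
  note o2 = outer[OF T(5)] and o3 = outer[OF T(6)]
  have r: "\<And>z. z \<in> WR \<Longrightarrow> z \<in> WM \<Longrightarrow> z = p" "\<And>z. z \<in> WR \<Longrightarrow> z \<in> WA \<Longrightarrow> z = q" "\<And>z. z \<in> WR \<Longrightarrow> z \<in> WB \<Longrightarrow> z = q"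
    "\<And>z. z \<in> WR \<Longrightarrow> z \<in> W2 \<Longrightarrow> z = q" "\<And>z. z \<in> WR \<Longrightarrow> z \<in> W3 \<Longrightarrow> z = q" using R(4,5) by auto
  have qp: "q \<noteq> p" using R(3) pM cap(1) by metis
  \<comment> \<open>The chord cuts off the piece of \<open>D1\<close> from \<open>q\<close> to
    \<open>p\<close>, which contains \<open>e\<close> and belongs to both circles through
    \<open>D1\<close>.\<close>
  have e56: "upath q p (W5 \<union> W6) (insert e (D5 \<union> D6))"
    by (rule upath_bridge[OF A(2) M(1) _ p(2)]) (use cap(1,5,6) in blast)
  have f7: "upath b p (WB \<union> W7) (insert f (DB \<union> D7))"
    by (rule upath_bridge[OF upath_rev[OF p(5)] upath_rev[OF M(2)]]) (use cap(3,7) p(4) in auto)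
  have fpath: "upath q p (W4 \<union> W \<union> (WB \<union> W7)) (D4 \<union> D \<union> insert f (DB \<union> D7))"
    if W: "upath a b W D" "W1 \<inter> W = {a, b}" for W D
  proof (rule upath_append3[OF upath_rev[OF A(1)] W(1) f7])
    note o = outer[OF W(2)]
    have "a \<in> W" "b \<in> W" using upath_ends[OF W(1)] by auto
    then show "W4 \<inter> W = {a}" using o(1) cap(4) k(3) by blast
    show "W \<inter> (WB \<union> W7) = {b}" using o(2,3) cap(7) i(6) \<open>b \<in> W\<close> by blast
    show "W4 \<inter> (WB \<union> W7) \<subseteq> {b}" using cap(1,2,4,7) by blast
  qed
  have eR: "e \<notin> R" "f \<notin> R" using R(2) ef(2,3) by auto
  have th1: "utheta q p (W5 \<union> W6) (insert e (D5 \<union> D6)) (W4 \<union> W \<union> (WB \<union> W7)) (D4 \<union> D \<union> insert f (DB \<union> D7)) WR R"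
    if W: "upath a b W D" "W1 \<inter> W = {a, b}" "e \<notin> D" "\<And>z. z \<in> WR \<Longrightarrow> z \<in> W \<Longrightarrow> z = q" for W D
  proof (rule uthetaI[where e = e and f = f, OF e56 fpath[OF W(1,2)] R(1) _ _ _ qp])
    note o = outer[OF W(2)]
    have a: "a \<in> W5 \<Longrightarrow> a = q" using cap(8) k by auto
    show "(W5 \<union> W6) \<inter> (W4 \<union> W \<union> (WB \<union> W7)) = {q, p}"
    proof (intro equalityI subsetI)
      fix z assume "z \<in> (W5 \<union> W6) \<inter> (W4 \<union> W \<union> (WB \<union> W7))"
      then have "z \<in> W5 \<or> z \<in> W6" "z \<in> W4 \<or> z \<in> W \<or> z \<in> WB \<or> z \<in> W7" by auto
      then have "z = q \<or> z = p" using cap o a by metis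
      then show "z \<in> {q, p}" by simp
    qed (use k in auto)
    show "(W5 \<union> W6) \<inter> WR = {q, p}"
    proof (intro equalityI subsetI)
      fix z assume "z \<in> (W5 \<union> W6) \<inter> WR"
      then have "z = q \<or> z = p" using cap(5,6) r by blast
      then show "z \<in> {q, p}" by simp
    qed (use k i in auto)
    show "(W4 \<union> W \<union> (WB \<union> W7)) \<inter> WR = {q, p}"
    proof (intro equalityI subsetI)
      fix z assume "z \<in> (W4 \<union> W \<union> (WB \<union> W7)) \<inter> WR"
      then have "z = q \<or> z = p" using cap(4,7) r W(4) by blast
      then show "z \<in> {q, p}" by simp
    qed (use k i in auto)
    show "e \<notin> D4 \<union> D \<union> insert f (DB \<union> D7)" using nef(1) W(3) ef(1) A(5) M(5) by auto
  qed (use eR in simp_all)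
  note th2 = th1[OF T(2,5) _ r(4)] and th3 = th1[OF T(3,6) _ r(5)]
  have AB: "insert e (D5 \<union> D6) \<union> (D4 \<union> D \<union> insert f (DB \<union> D7)) = D1 \<union> D" for D
    using D1(1) A(5) M(5) by auto
  have De: "insert e (D5 \<union> D6) \<union> R \<subseteq> insert e E" using sub D1(1) nef(2) A(5) M(5) R(2) by auto
  have cD: "circ (insert e (D5 \<union> D6) \<union> R)" using utheta_circ(2)[OF th2] nef(3) by simp
  obtain g where g: "g \<in> R" using upath_nonempty[OF R(1) qp] by auto
  \<comment> \<open>A label on \<open>R\<close> is chosen that balances the circle formed by this
    piece and \<open>R\<close>. By \<open>joint_iff\<close>, joint balance of either circle through
    \<open>D1\<close> is then balance in \<open>bf\<close> of the circle in which \<open>R\<close>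
    replaces the piece.\<close>
  obtain k0 where k0: "k0 \<in> K g" "be (insert e (D5 \<union> D6) \<union> R) (s(g := k0))"
    using bexp_lift[OF be cD De, of g s] g K by auto
  define s' where "s' = s(g := k0)"
  have K': "s' d \<in> K d" for d using K k0(1) unfolding s'_def by simp
  have Rdis: "R \<inter> (D1 \<union> D2 \<union> D3) = {}"
  proof -
    have i1: "WR \<inter> WA \<subseteq> {q}" "WR \<inter> WB \<subseteq> {q}" "WR \<inter> WM \<subseteq> {p}" "WR \<inter> W2 \<subseteq> {q}" "WR \<inter> W3 \<subseteq> {q}" using R(4,5) by auto
    show ?thesis using upath_disj[OF R(1) p(1) i1(1)] upath_disj[OF R(1) p(5) i1(2)] upath_disj[OF R(1) p(3) i1(3)]
       upath_disj[OF R(1) T(2) i1(4)] upath_disj[OF R(1) T(3) i1(5)] eR D1(1) by (simp add: Int_Un_distrib)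
  qed
  have off: "s' d = s d" if "d \<in> D1 \<union> D2 \<union> D3" for d using that g Rdis unfolding s'_def by auto
  have bE: "be (insert e (D5 \<union> D6) \<union> R) s'" using k0(2) unfolding s'_def .
  have j2: "jo (D1 \<union> D2) s' = bf (D4 \<union> D2 \<union> insert f (DB \<union> D7) \<union> R) s'"
  proof -
    have "utheta q p (W5 \<union> W6) (insert e (D5 \<union> D6)) (W4 \<union> W2 \<union> (WB \<union> W7)) (D4 \<union> D2 \<union> insert f (DB \<union> D7)) WR R" using th2 nef(3) by simp
    from joint_iff[OF this _ _ R(2) _ K' bE] show ?thesis unfolding AB using sub by simp
  qed
  have j3: "jo (D1 \<union> D3) s' = bf (D4 \<union> D3 \<union> insert f (DB \<union> D7) \<union> R) s'"
  proof -
    have "utheta q p (W5 \<union> W6) (insert e (D5 \<union> D6)) (W4 \<union> W3 \<union> (WB \<union> W7)) (D4 \<union> D3 \<union> insert f (DB \<union> D7)) WR R" using th3 nef(3) by simp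
    from joint_iff[OF this _ _ R(2) _ K' bE] show ?thesis unfolding AB using sub by simp
  qed
  \<comment> \<open>This is \<open>D1\<close> with the piece around \<open>e\<close> replaced by
    \<open>R\<close>. With \<open>D2\<close> and \<open>D3\<close> it forms a theta that avoids
    \<open>e\<close>.\<close>
  let ?C1 = "D4 \<union> R \<union> insert f (D7 \<union> DB)"
  have f7': "upath p b (W7 \<union> WB) (insert f (D7 \<union> DB))"
    by (rule upath_bridge[OF M(2) p(5) _ p(4)]) (use cap(3,7) in blast)
  have c1: "upath a b (W4 \<union> WR \<union> (W7 \<union> WB)) ?C1"
  proof (rule upath_append3[OF A(1) R(1) f7'])
    show "W4 \<inter> WR = {q}" using r(2) cap(4) k(1) i(11) by blast
    have "q \<notin> WB" using cap(2) R(3) by blast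
    then show "WR \<inter> (W7 \<union> WB) = {p}" using r(1,3) cap(7) k(5) i(12) by blast
    show "W4 \<inter> (W7 \<union> WB) \<subseteq> {p}" using cap(1,2,4,7) by blast
  qed
  have i1: "(W4 \<union> WR \<union> (W7 \<union> WB)) \<inter> W = {a, b}"
    if W: "W1 \<inter> W = {a, b}" "\<And>z. z \<in> WR \<Longrightarrow> z \<in> W \<Longrightarrow> z = q" for W
  proof (intro equalityI subsetI)
    note o = outer[OF W(1)]
    fix z assume "z \<in> (W4 \<union> WR \<union> (W7 \<union> WB)) \<inter> W"
    then have z: "z \<in> W" "z \<in> W4 \<or> z \<in> WR \<or> z \<in> W7 \<or> z \<in> WB" by auto
    then have "z = a \<or> z = b" using o cap(4,7) W(2) R(3) by metis
    then show "z \<in> {a, b}" by simp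
  next
    fix z assume "z \<in> {a, b}"
    then show "z \<in> (W4 \<union> WR \<union> (W7 \<union> WB)) \<inter> W" using W(1) k i by auto
  qed
  have t: "utheta a b (W4 \<union> WR \<union> (W7 \<union> WB)) ?C1 W2 D2 W3 D3"
  proof -
    have "?C1 \<inter> D2 = {}" by (rule upath_meet_disj[OF c1 T(2) i1[OF T(5) r(4)], of f]) (use nef(4) in auto)
    moreover have "?C1 \<inter> D3 = {}" by (rule upath_meet_disj[OF c1 T(3) i1[OF T(6) r(5)], of f]) (use nef(4) in auto)
    ultimately show ?thesis unfolding utheta_def using T c1 i1[OF T(5) r(4)] i1[OF T(6) r(5)] by simp
  qed
  have tE: "?C1 \<union> D2 \<union> D3 \<subseteq> insert f E" using sub D1(1) nef(1,3) A(5) M(5) R(2) by auto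
  show thesis
    by (rule that[OF K' off j2 j3 t tE]) auto
qed

text \<open>The chord starts at an inner node \<open>q\<close> of the second path. For
  \<open>D1 \<union> D2\<close> it is used as it stands, for \<open>D1 \<union> D3\<close> it is
  prolonged along the second path back to \<open>a\<close>; the circle cut off with \<open>e\<close>
  is the same in both cases. The circles that remain belong to a theta with ends \<open>q\<close>
  and \<open>b\<close>.\<close>

lemma same_path_across:
  assumes th: "utheta a b W1 D1 W2 D2 W3 D3" and sub: "D1 \<union> D2 \<union> D3 \<subseteq> EE"
    and D1: "D1 = insert e (insert f (DA \<union> DM \<union> DB))" "W1 = WA \<union> WM \<union> WB"
      "WA \<inter> WM = {}" "WA \<inter> WB = {}" "WM \<inter> WB = {}"
    and p: "upath a u WA DA" "e = {u, v}" "upath v x WM DM" "f = {x, y}" "upath y b WB DB"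
    and nef: "e \<notin> DA \<union> DM \<union> DB" "f \<notin> DA \<union> DM \<union> DB" "e \<notin> D2 \<union> D3" "f \<notin> D2 \<union> D3"
    and R: "upath q p WR R" "R \<subseteq> E" "q \<in> W2" "q \<noteq> a" "q \<noteq> b" "WR \<inter> WM = {p}" "WR \<inter> (WA \<union> WB \<union> W2 \<union> W3) = {q}"
    and K: "\<And>d. s d \<in> K d"
  obtains s' F2 F3 c d V1 C1 V2 C2 V3 C3 where "\<And>d. s' d \<in> K d" "\<And>d. d \<in> D1 \<union> D2 \<union> D3 \<Longrightarrow> s' d = s d"
    "jo (D1 \<union> D2) s' = bf F2 s'" "jo (D1 \<union> D3) s' = bf F3 s'"
    "utheta c d V1 C1 V2 C2 V3 C3" "C1 \<union> C2 \<union> C3 \<subseteq> insert f E" "F2 = C1 \<union> C2" "F3 = C1 \<union> C3" "D2 \<union> D3 = C2 \<union> C3"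
proof -
  have T: "upath a b W1 D1" "upath a b W2 D2" "upath a b W3 D3" "a \<noteq> b"
    "W1 \<inter> W2 = {a, b}" "W1 \<inter> W3 = {a, b}" "W2 \<inter> W3 = {a, b}" "D1 \<inter> D2 = {}" "D1 \<inter> D3 = {}" "D2 \<inter> D3 = {}"
    using th by (auto simp: utheta_def)
  have i: "a \<in> WA" "u \<in> WA" "v \<in> WM" "x \<in> WM" "y \<in> WB" "b \<in> WB" "a \<in> W2" "b \<in> W2" "a \<in> W3" "b \<in> W3" "q \<in> WR" "p \<in> WR"
    using upath_ends[OF p(1)] upath_ends[OF p(3)] upath_ends[OF p(5)] upath_ends[OF T(2)] upath_ends[OF T(3)]
      upath_ends[OF R(1)] by auto
  have pM: "p \<in> WM" using R(6) by auto
  obtain W4 D4 W5 D5 where A: "upath a q W4 D4" "upath q b W5 D5" "W2 = W4 \<union> W5" "W4 \<inter> W5 = {q}" "D2 = D4 \<union> D5"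
    using upath_split[OF T(2) R(3)] by metis
  obtain W6 D6 W7 D7 where M: "upath v p W6 D6" "upath p x W7 D7" "WM = W6 \<union> W7" "W6 \<inter> W7 = {p}" "DM = D6 \<union> D7"
    using upath_split[OF p(3) pM] by metis
  have k: "q \<in> W4" "q \<in> W5" "a \<in> W4" "b \<in> W5" "p \<in> W6" "p \<in> W7" "x \<in> W7" "v \<in> W6"
    using upath_ends[OF A(1)] upath_ends[OF A(2)] upath_ends[OF M(1)] upath_ends[OF M(2)] by auto
  have cap1: "\<And>z. z \<in> WA \<Longrightarrow> z \<in> WM \<Longrightarrow> False" "\<And>z. z \<in> WA \<Longrightarrow> z \<in> WB \<Longrightarrow> False" "\<And>z. z \<in> WM \<Longrightarrow> z \<in> WB \<Longrightarrow> False"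
    using D1(3-5) by auto
  have cap2: "\<And>z. z \<in> W4 \<Longrightarrow> z \<in> W2" "\<And>z. z \<in> W5 \<Longrightarrow> z \<in> W2" "\<And>z. z \<in> W6 \<Longrightarrow> z \<in> WM" "\<And>z. z \<in> W7 \<Longrightarrow> z \<in> WM"
    using A(3) M(3) by auto
  have cap3: "\<And>z. z \<in> W4 \<Longrightarrow> z \<in> W5 \<Longrightarrow> z = q" "\<And>z. z \<in> W6 \<Longrightarrow> z \<in> W7 \<Longrightarrow> z = p"
    using A(4) M(4) by auto
  have ab: "b \<notin> W4" "a \<notin> W5" using cap3(1) k(3,4) R(4,5) by auto
  have outer: "\<And>z. z \<in> WA \<Longrightarrow> z \<in> W \<Longrightarrow> z = a" "\<And>z. z \<in> WB \<Longrightarrow> z \<in> W \<Longrightarrow> z = b" "\<And>z. z \<in> WM \<Longrightarrow> z \<in> W \<Longrightarrow> False"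
    if "W1 \<inter> W = {a, b}" for W
  proof -
    show "z = a" if "z \<in> WA" "z \<in> W" for z using \<open>W1 \<inter> W = {a, b}\<close> that D1(2) cap1(2) i by auto
    show "z = b" if "z \<in> WB" "z \<in> W" for z using \<open>W1 \<inter> W = {a, b}\<close> that D1(2) cap1(2) i by auto
    show "False" if "z \<in> WM" "z \<in> W" for z using \<open>W1 \<inter> W = {a, b}\<close> that D1(2) cap1(1,3) i by auto
  qed
  note o2 = outer[OF T(5)] and o3 = outer[OF T(6)]
  have o23: "\<And>z. z \<in> W2 \<Longrightarrow> z \<in> W3 \<Longrightarrow> z = a \<or> z = b" using T(7) by auto
  have qn: "q \<notin> WA" "q \<notin> WB" "q \<notin> W3" "q \<notin> WM" using R(3,4,5) o2 o23 by blast+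
  have r: "\<And>z. z \<in> WR \<Longrightarrow> z \<in> WM \<Longrightarrow> z = p" "\<And>z. z \<in> WR \<Longrightarrow> z \<in> W2 \<Longrightarrow> z = q" using R(6,7) by auto
  have r2: "\<And>z. z \<in> WR \<Longrightarrow> z \<in> WA \<Longrightarrow> False" "\<And>z. z \<in> WR \<Longrightarrow> z \<in> WB \<Longrightarrow> False" "\<And>z. z \<in> WR \<Longrightarrow> z \<in> W3 \<Longrightarrow> False"
    using R(7) qn(1-3) by auto
  have qp: "q \<noteq> p" using qn(4) pM by auto
  have ap: "a \<noteq> p" using cap1(1) i(1) pM by auto
  have eR: "e \<notin> R" "f \<notin> R" using R(2) ef(2,3) by auto
  have e6: "upath a p (WA \<union> W6) (insert e (DA \<union> D6))"
    by (rule upath_bridge[OF p(1) M(1) _ p(2)]) (use cap1(1) cap2(3) in blast)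
  have f7: "upath b p (WB \<union> W7) (insert f (DB \<union> D7))"
    by (rule upath_bridge[OF upath_rev[OF p(5)] upath_rev[OF M(2)]]) (use cap1(3) cap2(4) p(4) in auto)
  have f7': "upath p b (W7 \<union> WB) (insert f (D7 \<union> DB))"
    by (rule upath_bridge[OF M(2) p(5) _ p(4)]) (use cap1(3) cap2(4) in blast)
  have "W4 \<inter> (WA \<union> W6) = {a}" using o2(1,3) cap2(1,3) k(3) i(1) by blast
  note ep = upath_append[OF upath_rev[OF A(1)] e6 this]
  have "W5 \<inter> (WB \<union> W7) = {b}" using o2(2,3) cap2(2,4) k(4) i(6) by blast
  note fp = upath_append[OF A(2) f7 this]
  have "W3 \<inter> (WB \<union> W7) = {b}" using o3(2,3) cap2(4) i(10) i(6) by blast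
  note fp3 = upath_append[OF T(3) f7 this]
  have "W4 \<inter> WR = {q}" using cap2(1) r(2) k(1) i(11) by blast
  note R3 = upath_append[OF A(1) R(1) this]
  have D: "e \<notin> D4" "e \<notin> D5" "f \<notin> D4" "f \<notin> D5" "e \<notin> D3" "f \<notin> D3" "e \<notin> DB" "e \<notin> D7" "e \<notin> DA" "e \<notin> D6" "f \<notin> DA" "f \<notin> D6"
    using nef A(5) M(5) by auto
  have th2: "utheta q p (W4 \<union> (WA \<union> W6)) (D4 \<union> insert e (DA \<union> D6)) (W5 \<union> (WB \<union> W7)) (D5 \<union> insert f (DB \<union> D7)) WR R"
  proof (rule uthetaI[where e = e and f = f, OF ep fp R(1) _ _ _ qp])
    show "(W4 \<union> (WA \<union> W6)) \<inter> (W5 \<union> (WB \<union> W7)) = {q, p}"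
    proof (intro equalityI subsetI)
      fix z assume "z \<in> (W4 \<union> (WA \<union> W6)) \<inter> (W5 \<union> (WB \<union> W7))"
      then have "z \<in> W4 \<or> z \<in> WA \<or> z \<in> W6" "z \<in> W5 \<or> z \<in> WB \<or> z \<in> W7" by auto
      then have "z = q \<or> z = p" using cap1 cap2 cap3 o2 ab by metis
      then show "z \<in> {q, p}" by simp
    qed (use k in auto)
    show "(W4 \<union> (WA \<union> W6)) \<inter> WR = {q, p}"
    proof (intro equalityI subsetI)
      fix z assume "z \<in> (W4 \<union> (WA \<union> W6)) \<inter> WR"
      then have "z = q \<or> z = p" using cap2(1,3) r r2 by blast
      then show "z \<in> {q, p}" by simp
    qed (use k i in auto)
    show "(W5 \<union> (WB \<union> W7)) \<inter> WR = {q, p}"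
    proof (intro equalityI subsetI)
      fix z assume "z \<in> (W5 \<union> (WB \<union> W7)) \<inter> WR"
      then have "z = q \<or> z = p" using cap2(2,4) r r2 by blast
      then show "z \<in> {q, p}" by simp
    qed (use k i in auto)
    show "e \<notin> D5 \<union> insert f (DB \<union> D7)" using D ef(1) by simp
  qed (use eR in simp_all)
  have th3: "utheta a p (WA \<union> W6) (insert e (DA \<union> D6)) (W3 \<union> (WB \<union> W7)) (D3 \<union> insert f (DB \<union> D7)) (W4 \<union> WR) (D4 \<union> R)"
  proof (rule uthetaI[where e = e and f = f, OF e6 fp3 R3 _ _ _ ap])
    show "(WA \<union> W6) \<inter> (W3 \<union> (WB \<union> W7)) = {a, p}"
    proof (intro equalityI subsetI)
      fix z assume "z \<in> (WA \<union> W6) \<inter> (W3 \<union> (WB \<union> W7))"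
      then have "z \<in> WA \<or> z \<in> W6" "z \<in> W3 \<or> z \<in> WB \<or> z \<in> W7" by auto
      then have "z = a \<or> z = p" using cap1 cap2 cap3 o3 by metis
      then show "z \<in> {a, p}" by simp
    qed (use k i in auto)
    show "(WA \<union> W6) \<inter> (W4 \<union> WR) = {a, p}"
    proof (intro equalityI subsetI)
      fix z assume "z \<in> (WA \<union> W6) \<inter> (W4 \<union> WR)"
      then have "z = a \<or> z = p" using cap2(1,3) o2 r r2 by blast
      then show "z \<in> {a, p}" by simp
    qed (use k i in auto)
    show "(W3 \<union> (WB \<union> W7)) \<inter> (W4 \<union> WR) = {a, p}"
    proof (intro equalityI subsetI)
      fix z assume "z \<in> (W3 \<union> (WB \<union> W7)) \<inter> (W4 \<union> WR)"
      then have "z \<in> W3 \<or> z \<in> WB \<or> z \<in> W7" "z \<in> W4 \<or> z \<in> WR" by auto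
      then have "z = a \<or> z = p" using cap2 o2 o23 ab r r2 by metis
      then show "z \<in> {a, p}" by simp
    qed (use k i in auto)
    show "e \<notin> D3 \<union> insert f (DB \<union> D7)" using D ef(1) by simp
    show "e \<notin> D4 \<union> R" "f \<notin> D4 \<union> R" using D eR by simp_all
  qed simp_all
  have AB: "(D4 \<union> insert e (DA \<union> D6)) \<union> (D5 \<union> insert f (DB \<union> D7)) = D1 \<union> D2"
    "insert e (DA \<union> D6) \<union> (D3 \<union> insert f (DB \<union> D7)) = D1 \<union> D3"
    using D1(1) A(5) M(5) by auto
  have D4E: "D4 \<union> R \<subseteq> E" using sub A(5) D(1,3) R(2) by auto
  have De: "D4 \<union> insert e (DA \<union> D6) \<union> R \<subseteq> insert e E" using sub D1(1) D M(5) D4E by auto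
  note cD = utheta_circ(2)[OF th2]
  obtain g where g: "g \<in> R" using upath_nonempty[OF R(1) qp] by auto
  obtain k0 where k0: "k0 \<in> K g" "be (D4 \<union> insert e (DA \<union> D6) \<union> R) (s(g := k0))"
    using bexp_lift[OF be cD De, of g s] g K by auto
  define s' where "s' = s(g := k0)"
  have K': "s' d \<in> K d" for d using K k0(1) unfolding s'_def by simp
  have Rdis: "R \<inter> (D1 \<union> D2 \<union> D3) = {}"
  proof -
    have i1: "WR \<inter> WA \<subseteq> {q}" "WR \<inter> WB \<subseteq> {q}" "WR \<inter> WM \<subseteq> {p}" "WR \<inter> W2 \<subseteq> {q}" "WR \<inter> W3 \<subseteq> {q}" using R(6,7) by auto
    show ?thesis using upath_disj[OF R(1) p(1) i1(1)] upath_disj[OF R(1) p(5) i1(2)] upath_disj[OF R(1) p(3) i1(3)]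
       upath_disj[OF R(1) T(2) i1(4)] upath_disj[OF R(1) T(3) i1(5)] eR D1(1) by (simp add: Int_Un_distrib)
  qed
  have off: "s' d = s d" if "d \<in> D1 \<union> D2 \<union> D3" for d using that g Rdis unfolding s'_def by auto
  have bE: "be (D4 \<union> insert e (DA \<union> D6) \<union> R) s'" using k0(2) unfolding s'_def .
  then have bE3: "be (insert e (DA \<union> D6) \<union> (D4 \<union> R)) s'" by (simp add: Un_commute Un_left_commute)
  have j2: "jo (D1 \<union> D2) s' = bf (D5 \<union> insert f (DB \<union> D7) \<union> R) s'"
    using joint_iff[OF th2 _ _ R(2) _ K' bE] sub unfolding AB by simp
  have j3: "jo (D1 \<union> D3) s' = bf (D3 \<union> insert f (DB \<union> D7) \<union> (D4 \<union> R)) s'"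
    using joint_iff[OF th3 _ _ D4E _ K' bE3] sub unfolding AB by simp
  have "WR \<inter> (W7 \<union> WB) = {p}" using r(1) r2(2) cap2(4) k(6) i(12) by blast
  note c1 = upath_append[OF R(1) f7' this]
  have "W4 \<inter> W3 = {a}" using o23 cap2(1) ab(1) k(3) i(9) by blast
  note c3 = upath_append[OF upath_rev[OF A(1)] T(3) this]
  have t: "utheta q b (WR \<union> (W7 \<union> WB)) (R \<union> insert f (D7 \<union> DB)) W5 D5 (W4 \<union> W3) (D4 \<union> D3)"
  proof -
    have w: "(WR \<union> (W7 \<union> WB)) \<inter> W5 = {q, b}"
    proof (intro equalityI subsetI)
      fix z assume "z \<in> (WR \<union> (W7 \<union> WB)) \<inter> W5"
      then have "z = q \<or> z = b" using cap2(2,4) o2 r by blast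
      then show "z \<in> {q, b}" by simp
    qed (use k i in auto)
    have w': "(WR \<union> (W7 \<union> WB)) \<inter> (W4 \<union> W3) = {q, b}"
    proof (intro equalityI subsetI)
      fix z assume "z \<in> (WR \<union> (W7 \<union> WB)) \<inter> (W4 \<union> W3)"
      then have "z \<in> WR \<or> z \<in> W7 \<or> z \<in> WB" "z \<in> W4 \<or> z \<in> W3" by auto
      then have "z = q \<or> z = b" using cap2 o2 o3 r r2 by metis
      then show "z \<in> {q, b}" by simp
    qed (use k i in auto)
    have w'': "W5 \<inter> (W4 \<union> W3) = {q, b}"
    proof (intro equalityI subsetI)
      fix z assume "z \<in> W5 \<inter> (W4 \<union> W3)"
      then have "z = q \<or> z = b" using cap2(2) cap3(1) o23 ab(2) by blast
      then show "z \<in> {q, b}" by simp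
    qed (use k i in auto)
    have "(R \<union> insert f (D7 \<union> DB)) \<inter> D5 = {}" by (rule upath_meet_disj[OF c1 A(2) w, of f]) (use D in auto)
    moreover have "(R \<union> insert f (D7 \<union> DB)) \<inter> (D4 \<union> D3) = {}" by (rule upath_meet_disj[OF c1 c3 w', of f]) (use D in auto)
    moreover have "D5 \<inter> (D4 \<union> D3) = {}"
      using T(10) A(5) upath_disj[OF A(1,2), of q] A(4) by auto
    ultimately show ?thesis unfolding utheta_def using R(5) c1 A(2) c3 w w' w'' by simp
  qed
  have tE: "(R \<union> insert f (D7 \<union> DB)) \<union> D5 \<union> (D4 \<union> D3) \<subseteq> insert f E" using sub D1(1) D A(5) M(5) R(2) by auto
  show thesis
    by (rule that[OF K' off j2 j3 t tE]) (auto simp: A(5))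
qed

end

text \<open>This excludes that exactly two of the three hold; being symmetric, it carries over to
  permuted paths.\<close>

definition two_of_three where
  "two_of_three x y z \<longleftrightarrow> (x \<and> y \<longrightarrow> z) \<and> (x \<and> z \<longrightarrow> y) \<and> (y \<and> z \<longrightarrow> x)"

lemma theta_two_of_three:
  assumes b: "theta_prop K F b" and th: "utheta a c W1 D1 W2 D2 W3 D3" "D1 \<union> D2 \<union> D3 \<subseteq> F"
    and K: "\<And>d. s d \<in> K d"
  shows "two_of_three (b (D1 \<union> D2) s) (b (D1 \<union> D3) s) (b (D2 \<union> D3) s)"
  unfolding two_of_three_def
  using theta_prop_theta[where s = s, OF b th K] theta_prop_iff[where s = s, OF b th K] by blast

lemma joint_cong: "(\<And>d. d \<in> C \<Longrightarrow> s d = t d) \<Longrightarrow> joint K E be bf e f C s = joint K E be bf e f C t"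
  unfolding joint_def by (simp cong: ball_cong)

section \<open>The amalgam of two one-link extensions\<close>

context amalgam
begin

lemma swap: "amalgam K V E b0 bf be f e"
  using b0 be bf agree_e agree_f ef conn three V K_ne by unfold_locales auto

lemma agree_on_E: "circ C \<Longrightarrow> C \<subseteq> E \<Longrightarrow> (\<And>d. s d \<in> K d) \<Longrightarrow> be C s = bf C s"
  using agree_e agree_f unfolding agree_def by metis

text \<open>By the preceding constructions the three circles are balanced as those of a theta in
  \<open>insert f E\<close> are. The cases are the places where the chord can start: on
  \<open>WA\<close>, or inside the second or the third path.\<close>

lemma same_path_left:
  assumes th: "utheta a b W1 D1 W2 D2 W3 D3" and sub: "D1 \<union> D2 \<union> D3 \<subseteq> EE"
    and D1: "D1 = insert e (insert f (DA \<union> DM \<union> DB))" "W1 = WA \<union> WM \<union> WB"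
      "WA \<inter> WM = {}" "WA \<inter> WB = {}" "WM \<inter> WB = {}"
    and p: "upath a u WA DA" "e = {u, v}" "upath v x WM DM" "f = {x, y}" "upath y b WB DB"
    and nef: "e \<notin> DA \<union> DM \<union> DB" "f \<notin> DA \<union> DM \<union> DB" "e \<notin> D2 \<union> D3" "f \<notin> D2 \<union> D3"
    and R: "upath q p WR R" "R \<subseteq> E" "WR \<inter> WM = {p}" "WR \<inter> (WA \<union> WB \<union> W2 \<union> W3) = {q}" "q \<notin> WB"
    and K: "\<And>d. s d \<in> K d"
  shows "two_of_three (jo (D1 \<union> D2) s) (jo (D1 \<union> D3) s) (bf (D2 \<union> D3) s)"
proof -
  have fin: "two_of_three (jo (D1 \<union> D2) s) (jo (D1 \<union> D3) s) (bf (D2 \<union> D3) s)"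
    if s': "\<And>d. s' d \<in> K d" "\<And>d. d \<in> D1 \<union> D2 \<union> D3 \<Longrightarrow> s' d = s d"
      and j: "jo (D1 \<union> D2) s' = bf F2 s'" "jo (D1 \<union> D3) s' = bf F3 s'"
      and t: "utheta c d V1 C1 V2 C2 V3 C3" "C1 \<union> C2 \<union> C3 \<subseteq> insert f E" "F2 = C1 \<union> C2" "F3 = C1 \<union> C3" "D2 \<union> D3 = C2 \<union> C3"
    for s' F2 F3 c d V1 C1 V2 C2 V3 C3 and D2 D3 :: "'v set set"
  proof -
    have 1: "jo (D1 \<union> D2) s' = jo (D1 \<union> D2) s" "jo (D1 \<union> D3) s' = jo (D1 \<union> D3) s"
      by (rule joint_cong; use s'(2) in auto)+
    have 2: "bf (D2 \<union> D3) s' = bf (D2 \<union> D3) s"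
      by (rule theta_prop_cong[OF bexp_theta_prop[OF bf]]) (use s'(2) in auto)
    from theta_two_of_three[where s = s', OF bexp_theta_prop[OF bf] t(1,2) s'(1)]
    show ?thesis unfolding t(3-5)[symmetric] j[symmetric] 1 2 .
  qed
  have "q \<in> WA \<union> WB \<union> W2 \<union> W3" using R(4) by auto
  moreover have "a \<in> WA" "b \<in> WB" using upath_ends[OF p(1)] upath_ends[OF p(5)] by auto
  ultimately consider "q \<in> WA" | "q \<in> W2" "q \<noteq> a" "q \<noteq> b" | "q \<in> W3" "q \<noteq> a" "q \<noteq> b"
    using R(5) by blast
  then show ?thesis
  proof cases
    case 1
    show ?thesis
      by (rule same_path_outer[OF th sub D1 p nef R(1,2) 1 R(3,4) K]) (rule fin)
  next
    case 2
    show ?thesis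
      by (rule same_path_across[OF th sub D1 p nef R(1,2) 2 R(3,4) K]) (rule fin)
  next
    case 3
    have sub': "D1 \<union> D3 \<union> D2 \<subseteq> EE" using sub by auto
    have nef': "e \<notin> D3 \<union> D2" "f \<notin> D3 \<union> D2" using nef by auto
    have R4: "WR \<inter> (WA \<union> WB \<union> W3 \<union> W2) = {q}" using R(4) by (simp add: Un_ac)
    have "two_of_three (jo (D1 \<union> D3) s) (jo (D1 \<union> D2) s) (bf (D3 \<union> D2) s)"
      by (rule same_path_across[OF utheta_perm(2)[OF th] sub' D1 p nef(1,2) nef' R(1,2) 3 R(3) R4 K]) (rule fin)
    then show ?thesis unfolding two_of_three_def Un_commute[of D3 D2] by satx
  qed
qed

text \<open>A path of \<open>E\<close> between the ends of \<open>e\<close> runs into the middle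
  part and supplies a chord. If that chord starts on the part beyond \<open>f\<close>, the path is
  read backwards with \<open>e\<close> and \<open>f\<close> interchanged.\<close>

lemma same_path_ordered:
  assumes th: "utheta a b W1 D1 W2 D2 W3 D3" and sub: "D1 \<union> D2 \<union> D3 \<subseteq> EE"
    and D1: "D1 = insert e (insert f (DA \<union> DM \<union> DB))" "W1 = WA \<union> WM \<union> WB"
      "WA \<inter> WM = {}" "WA \<inter> WB = {}" "WM \<inter> WB = {}"
    and p: "upath a u WA DA" "e = {u, v}" "upath v x WM DM" "f = {x, y}" "upath y b WB DB"
    and nef: "e \<notin> DA \<union> DM \<union> DB" "f \<notin> DA \<union> DM \<union> DB" "e \<notin> D2 \<union> D3" "f \<notin> D2 \<union> D3"
    and K: "\<And>d. s d \<in> K d"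
  shows "two_of_three (jo (D1 \<union> D2) s) (jo (D1 \<union> D3) s) (bf (D2 \<union> D3) s)"
proof -
  have "u \<in> V" "v \<in> V" using p(2) V(2) by auto
  then obtain W0 D0 where W0: "upath u v W0 D0" "D0 \<subseteq> E" using conn unfolding conn_def by metis
  have uv: "u \<in> WA \<union> WB \<union> W2 \<union> W3" "v \<in> WM" using upath_ends[OF p(1)] upath_ends[OF p(3)] by auto
  obtain q p' WR R where R: "upath q p' WR R" "R \<subseteq> D0" "WR \<inter> (WA \<union> WB \<union> W2 \<union> W3) = {q}" "WR \<inter> WM = {p'}"
    using connecting_path[OF W0(1) uv] by metis
  have RE: "R \<subseteq> E" using R(2) W0(2) by simp
  show ?thesis
  proof (cases "q \<in> WB")
    case False
    show ?thesis by (rule same_path_left[OF th sub D1 p nef R(1) RE R(4,3) False K])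
  next
    case True
    then have qA: "q \<notin> WA" using D1(4) by auto
    have "two_of_three (joint K E bf be f e (D1 \<union> D2) s) (joint K E bf be f e (D1 \<union> D3) s) (be (D2 \<union> D3) s)"
    proof (rule amalgam.same_path_left[OF swap utheta_perm(6)[OF th] _ _ _ _ _ _ upath_rev[OF p(5)] _ upath_rev[OF p(3)] _ upath_rev[OF p(1)]
          _ _ _ _ R(1) RE R(4) _ qA K])
      show "D1 \<union> D2 \<union> D3 \<subseteq> insert f (insert e E)" using sub by auto
      show "D1 = insert f (insert e (DB \<union> DM \<union> DA))" using D1(1) by auto
      show "W1 = WB \<union> WM \<union> WA" "WB \<inter> WM = {}" "WB \<inter> WA = {}" "WM \<inter> WA = {}" using D1(2-5) by auto
      show "f = {y, x}" "e = {v, u}" using p(2,4) by auto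
      show "f \<notin> DB \<union> DM \<union> DA" "e \<notin> DB \<union> DM \<union> DA" "f \<notin> D2 \<union> D3" "e \<notin> D2 \<union> D3" using nef by auto
      show "WR \<inter> (WB \<union> WA \<union> W2 \<union> W3) = {q}" using R(3) by (simp add: Un_commute)
    qed
    moreover have "D2 \<union> D3 \<subseteq> E" using sub nef(3,4) by auto
    ultimately show ?thesis
      using agree_on_E[OF utheta_circ(3)[OF th]] K joint_sym[of K E be bf e f] by simp
  qed
qed

lemma same_path:
  assumes th: "utheta a b W1 D1 W2 D2 W3 D3" and sub: "D1 \<union> D2 \<union> D3 \<subseteq> EE"
    and e: "e \<in> D1" "f \<in> D1" and K: "\<And>d. s d \<in> K d"
  shows "two_of_three (jo (D1 \<union> D2) s) (jo (D1 \<union> D3) s) (bf (D2 \<union> D3) s)"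
proof -
  have D: "upath a b W1 D1" "D1 \<inter> D2 = {}" "D1 \<inter> D3 = {}" using th by (auto simp: utheta_def)
  have n: "e \<notin> D2 \<union> D3" "f \<notin> D2 \<union> D3" using D e by auto
  obtain u v Wu Du Wv Dv where s: "e = {u, v}" "upath a u Wu Du" "upath v b Wv Dv" "W1 = Wu \<union> Wv" "Wu \<inter> Wv = {}"
    "D1 = insert e (Du \<union> Dv)" "e \<notin> Du" "e \<notin> Dv" using upath_edge_split[OF D(1) e(1)] by metis
  have "f \<in> Du \<or> f \<in> Dv" using s(6) e(2) ef(1) by auto
  then show ?thesis
  proof
    assume f: "f \<in> Dv"
    obtain x y Wx Dx Wy Dy where t: "f = {x, y}" "upath v x Wx Dx" "upath y b Wy Dy" "Wv = Wx \<union> Wy" "Wx \<inter> Wy = {}"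
      "Dv = insert f (Dx \<union> Dy)" "f \<notin> Dx" "f \<notin> Dy" using upath_edge_split[OF s(3) f] by metis
    have "f \<notin> Du"
    proof
      assume "f \<in> Du"
      then have "f \<subseteq> Wu \<inter> Wv" using upath_edge[OF s(2), of f] upath_edge[OF s(3), of f] f by auto
      then show False using s(5) t(1) by auto
    qed
    then show ?thesis
      by (intro same_path_ordered[OF th sub _ _ _ _ _ s(2,1) t(2,1,3) _ _ n K]) (use s t in auto)
  next
    assume f: "f \<in> Du"
    obtain y x Wy Dy Wx Dx where t: "f = {y, x}" "upath a y Wy Dy" "upath x u Wx Dx" "Wu = Wy \<union> Wx" "Wy \<inter> Wx = {}"
      "Du = insert f (Dy \<union> Dx)" "f \<notin> Dy" "f \<notin> Dx" using upath_edge_split[OF s(2) f] by metis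
    have "f \<notin> Dv"
    proof
      assume "f \<in> Dv"
      then have "f \<subseteq> Wu \<inter> Wv" using upath_edge[OF s(2), of f] upath_edge[OF s(3), of f] f by auto
      then show False using s(5) t(1) by auto
    qed
    moreover have "e = {v, u}" "f = {x, y}" using s(1) t(1) by auto
    ultimately show ?thesis
      by (intro same_path_ordered[OF utheta_perm(6)[OF th] sub _ _ _ _ _ upath_rev[OF s(3)] _ upath_rev[OF t(3)] _ upath_rev[OF t(2)] _ _ n K])
        (use s(4-8) t(4-8) in auto)
  qed
qed

text \<open>The third path lies in \<open>E\<close> and is itself a chord that separates
  \<open>e\<close> from \<open>f\<close>, so \<open>joint_iff\<close> applies to it directly, once
  for each order of \<open>e\<close> and \<open>f\<close>.\<close>

lemma cross_paths:
  assumes th: "utheta a b W1 D1 W2 D2 W3 D3" and sub: "D1 \<union> D2 \<union> D3 \<subseteq> EE"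
    and e: "e \<in> D1" "f \<in> D2" and K: "\<And>d. s d \<in> K d"
  shows "two_of_three (jo (D1 \<union> D2) s) (be (D1 \<union> D3) s) (bf (D2 \<union> D3) s)"
proof -
  have "D1 \<inter> D3 = {}" "D2 \<inter> D3 = {}" using th by (auto simp: utheta_def)
  then have D3: "D3 \<subseteq> E" using sub e by auto
  have 12: "D1 \<union> D2 \<subseteq> EE" "D2 \<union> D1 \<subseteq> insert f (insert e E)" using sub by auto
  have "be (D1 \<union> D3) s \<Longrightarrow> jo (D1 \<union> D2) s = bf (D2 \<union> D3) s"
    using joint_iff[OF th e D3 12(1)] K by metis
  moreover have "bf (D2 \<union> D3) s \<Longrightarrow> joint K E bf be f e (D2 \<union> D1) s = be (D1 \<union> D3) s"
    using amalgam.joint_iff[OF swap utheta_perm(1)[OF th] e(2,1) D3 12(2)] K by metis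
  ultimately show ?thesis unfolding two_of_three_def joint_sym[of K E bf be f e] Un_commute[of D2 D1] by satx
qed

text \<open>A chord is labelled so that the side of \<open>f\<close> is balanced, which the label at
  \<open>g\<close> does not affect. Joint balance is then balance of the side of \<open>e\<close>,
  where lifting at \<open>g\<close> is available.\<close>

lemma joint_lift:
  assumes C: "circ C" "C \<subseteq> EE" and th: "utheta a b WA A WB B WR R" "e \<in> A" "f \<in> B" "R \<subseteq> E" "A \<union> B = C"
    and g: "g \<in> A" and K: "\<And>d. s d \<in> K d"
  shows "\<exists>!k. k \<in> K g \<and> jo C (s(g := k))"
proof -
  have dis: "A \<inter> B = {}" "A \<inter> R = {}" "B \<inter> R = {}" "a \<noteq> b" "upath a b WR R" using th(1) by (auto simp: utheta_def)
  obtain r where r: "r \<in> R" using upath_nonempty[OF dis(5,4)] by auto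
  have BR: "B \<union> R \<subseteq> insert f E" "r \<in> B \<union> R" using th(2,4,5) C(2) dis(1) r by auto
  have AR: "A \<union> R \<subseteq> insert e E" "g \<in> A \<union> R" using th(3,4,5) C(2) dis(1) g by auto
  obtain k1 where k1: "k1 \<in> K r" "bf (B \<union> R) (s(r := k1))"
    using bexp_lift[OF bf utheta_circ(3)[OF th(1)] BR, of s] K by auto
  define t where "t = s(r := k1)"
  have Kt: "t d \<in> K d" for d using K k1(1) unfolding t_def by simp
  have gB: "g \<notin> B \<union> R" using g dis by auto
  have "jo C (s(g := k)) = be (A \<union> R) (t(g := k))" if k: "k \<in> K g" for k
  proof -
    have K': "(t(g := k)) d \<in> K d" for d using Kt k by simp
    have "bf (B \<union> R) (t(g := k))" using k1(2) theta_prop_upd[OF bexp_theta_prop[OF bf] gB] unfolding t_def by metis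
    moreover have "B \<union> A \<subseteq> insert f (insert e E)" using th(5) C(2) by auto
    ultimately have "joint K E bf be f e (B \<union> A) (t(g := k)) = be (A \<union> R) (t(g := k))"
      using amalgam.joint_iff[where s = "t(g := k)", OF swap utheta_perm(1)[OF th(1)] th(3,2,4) _ K'] by simp
    moreover have "B \<union> A = C" using th(5) by auto
    moreover have "jo C (t(g := k)) = jo C (s(g := k))"
      by (rule joint_cong) (use r dis th(5) in \<open>auto simp: t_def\<close>)
    ultimately show ?thesis using joint_sym[of K E be bf e f] by simp
  qed
  moreover have "\<exists>!k. k \<in> K g \<and> be (A \<union> R) (t(g := k))"
    using bexp_lift[OF be utheta_circ(2)[OF th(1)] AR, of t] Kt by simp
  ultimately show ?thesis by metis
qed

text \<open>On circles in \<open>E\<close> both extensions agree, so the last alternative covers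
  them consistently.\<close>

definition "amalgam_balance C s = (if e \<in> C then if f \<in> C then jo C s else be C s else bf C s)"

text \<open>If a theta contains both new links, \<open>same_path\<close> applies when they lie on
  one path and \<open>cross_paths\<close> when they do not, after a permutation of the paths. A
  theta that misses one of them is governed by the extension to the other.\<close>

lemma amalgam_bexp: "bexp K EE amalgam_balance"
proof (rule bexpI[OF K_ne])
  show "amalgam_balance C s = amalgam_balance C t" if "\<And>d. d \<in> C \<Longrightarrow> s d = t d" for C s t
    unfolding amalgam_balance_def
    using joint_cong[of C s t, OF that] theta_prop_cong[OF bexp_theta_prop[OF be], of C s t, OF that]
      theta_prop_cong[OF bexp_theta_prop[OF bf], of C s t, OF that] by presburger
next
  fix C g s assume C: "circ C" "C \<subseteq> EE" and g: "g \<in> C" and K: "\<And>d. s d \<in> K d"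
  consider "e \<in> C" "f \<in> C" | "e \<in> C" "f \<notin> C" | "e \<notin> C" by auto
  then show "\<exists>!k. k \<in> K g \<and> amalgam_balance C (s(g := k))"
  proof cases
    case 1
    obtain a b WA A WB B WR R where th: "utheta a b WA A WB B WR R" "e \<in> A" "f \<in> B" "R \<subseteq> E" "A \<union> B = C"
      using circ_chord[OF conn C(1) 1 ef(1-3) V(3)] by metis
    have C': "C \<subseteq> insert f (insert e E)" "B \<union> A = C" using C(2) th(5) by auto
    have "g \<in> A \<or> g \<in> B" using g th(5) by auto
    then have "\<exists>!k. k \<in> K g \<and> jo C (s(g := k))"
    proof
      assume "g \<in> A" then show ?thesis using joint_lift[OF C th _ K] by simp
    next
      assume "g \<in> B"
      then show ?thesis
        using amalgam.joint_lift[OF swap C(1) C'(1) utheta_perm(1)[OF th(1)] th(3,2,4) C'(2) _ K] joint_sym[of K E be bf e f] by simp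
    qed
    then show ?thesis using 1 unfolding amalgam_balance_def by simp
  next
    case 2
    then have "C \<subseteq> insert e E" using C(2) by auto
    from bexp_lift[OF be C(1) this g, of s] K show ?thesis using 2 unfolding amalgam_balance_def by simp
  next
    case 3
    then have "C \<subseteq> insert f E" using C(2) by auto
    from bexp_lift[OF bf C(1) this g, of s] K show ?thesis using 3 unfolding amalgam_balance_def by simp
  qed
next
  fix a b W1 D1 W2 D2 W3 D3 s
  assume th: "utheta a b W1 D1 W2 D2 W3 D3" and sub: "D1 \<union> D2 \<union> D3 \<subseteq> EE" and K: "\<And>d. s d \<in> K d"
    and b: "amalgam_balance (D1 \<union> D2) s" "amalgam_balance (D1 \<union> D3) s"
  note C = utheta_circ[OF th]
  have dis: "D1 \<inter> D2 = {}" "D1 \<inter> D3 = {}" "D2 \<inter> D3 = {}" using th by (auto simp: utheta_def)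
  have subs: "D2 \<union> D1 \<union> D3 \<subseteq> EE" "D1 \<union> D3 \<union> D2 \<subseteq> EE" "D3 \<union> D2 \<union> D1 \<subseteq> EE" "D2 \<union> D3 \<union> D1 \<subseteq> EE" "D3 \<union> D1 \<union> D2 \<subseteq> EE"
    using sub by auto
  have "two_of_three (amalgam_balance (D1 \<union> D2) s) (amalgam_balance (D1 \<union> D3) s) (amalgam_balance (D2 \<union> D3) s)"
  proof (cases "f \<in> D1 \<union> D2 \<union> D3")
    case False
    then have E: "D1 \<union> D2 \<union> D3 \<subseteq> insert e E" using sub by auto
    have "amalgam_balance X s = be X s" if X: "circ X" "X \<subseteq> D1 \<union> D2 \<union> D3" for X
    proof (cases "e \<in> X")
      case True then show ?thesis using X False unfolding amalgam_balance_def by auto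
    next
      case 2: False
      then have "X \<subseteq> E" using X(2) E by auto
      then show ?thesis using agree_on_E[OF X(1), of s] K 2 unfolding amalgam_balance_def by simp
    qed
    then have "amalgam_balance (D1 \<union> D2) s = be (D1 \<union> D2) s" "amalgam_balance (D1 \<union> D3) s = be (D1 \<union> D3) s" "amalgam_balance (D2 \<union> D3) s = be (D2 \<union> D3) s"
      using C by auto
    then show ?thesis using theta_two_of_three[where s = s, OF bexp_theta_prop[OF be] th E K] by simp
  next
    case f: True
    show ?thesis
    proof (cases "e \<in> D1 \<union> D2 \<union> D3")
      case False
      then have E: "D1 \<union> D2 \<union> D3 \<subseteq> insert f E" using sub by auto
      have "amalgam_balance (D1 \<union> D2) s = bf (D1 \<union> D2) s" "amalgam_balance (D1 \<union> D3) s = bf (D1 \<union> D3) s" "amalgam_balance (D2 \<union> D3) s = bf (D2 \<union> D3) s"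
        using False unfolding amalgam_balance_def by auto
      then show ?thesis using theta_two_of_three[where s = s, OF bexp_theta_prop[OF bf] th E K] by simp
    next
      case e: True
      have cm: "D2 \<union> D1 = D1 \<union> D2" "D3 \<union> D1 = D1 \<union> D3" "D3 \<union> D2 = D2 \<union> D3" by auto
      consider "e \<in> D1" "f \<in> D1" | "e \<in> D1" "f \<in> D2" | "e \<in> D1" "f \<in> D3" | "e \<in> D2" "f \<in> D1" | "e \<in> D2" "f \<in> D2"
        | "e \<in> D2" "f \<in> D3" | "e \<in> D3" "f \<in> D1" | "e \<in> D3" "f \<in> D2" | "e \<in> D3" "f \<in> D3" using e f by auto
      then show ?thesis
      proof cases
        case 1
        then have n: "e \<notin> D2" "e \<notin> D3" "f \<notin> D2" "f \<notin> D3" using dis by auto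
        have a: "amalgam_balance (D1 \<union> D2) s = jo (D1 \<union> D2) s" "amalgam_balance (D1 \<union> D3) s = jo (D1 \<union> D3) s" "amalgam_balance (D2 \<union> D3) s = bf (D2 \<union> D3) s"
          unfolding amalgam_balance_def using 1 n by simp_all
        show ?thesis using same_path[where s = s, OF th sub 1 K] unfolding a cm two_of_three_def by satx
      next
        case 2
        then have n: "e \<notin> D2" "e \<notin> D3" "f \<notin> D1" "f \<notin> D3" using dis by auto
        have a: "amalgam_balance (D1 \<union> D2) s = jo (D1 \<union> D2) s" "amalgam_balance (D1 \<union> D3) s = be (D1 \<union> D3) s" "amalgam_balance (D2 \<union> D3) s = bf (D2 \<union> D3) s"
          unfolding amalgam_balance_def using 2 n by simp_all
        show ?thesis using cross_paths[where s = s, OF th sub 2 K] unfolding a cm two_of_three_def by satx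
      next
        case 3
        then have n: "e \<notin> D2" "e \<notin> D3" "f \<notin> D1" "f \<notin> D2" using dis by auto
        have a: "amalgam_balance (D1 \<union> D2) s = be (D1 \<union> D2) s" "amalgam_balance (D1 \<union> D3) s = jo (D1 \<union> D3) s" "amalgam_balance (D2 \<union> D3) s = bf (D2 \<union> D3) s"
          unfolding amalgam_balance_def using 3 n by simp_all
        show ?thesis using cross_paths[where s = s, OF utheta_perm(2)[OF th] subs(2) 3 K] unfolding a cm two_of_three_def by satx
      next
        case 4
        then have n: "e \<notin> D1" "e \<notin> D3" "f \<notin> D2" "f \<notin> D3" using dis by auto
        have a: "amalgam_balance (D1 \<union> D2) s = jo (D1 \<union> D2) s" "amalgam_balance (D1 \<union> D3) s = bf (D1 \<union> D3) s" "amalgam_balance (D2 \<union> D3) s = be (D2 \<union> D3) s"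
          unfolding amalgam_balance_def using 4 n by simp_all
        show ?thesis using cross_paths[where s = s, OF utheta_perm(1)[OF th] subs(1) 4 K] unfolding a cm two_of_three_def by satx
      next
        case 5
        then have n: "e \<notin> D1" "e \<notin> D3" "f \<notin> D1" "f \<notin> D3" using dis by auto
        have a: "amalgam_balance (D1 \<union> D2) s = jo (D1 \<union> D2) s" "amalgam_balance (D1 \<union> D3) s = bf (D1 \<union> D3) s" "amalgam_balance (D2 \<union> D3) s = jo (D2 \<union> D3) s"
          unfolding amalgam_balance_def using 5 n by simp_all
        show ?thesis using same_path[where s = s, OF utheta_perm(1)[OF th] subs(1) 5 K] unfolding a cm two_of_three_def by satx
      next
        case 6
        then have n: "e \<notin> D1" "e \<notin> D3" "f \<notin> D1" "f \<notin> D2" using dis by auto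
        have a: "amalgam_balance (D1 \<union> D2) s = be (D1 \<union> D2) s" "amalgam_balance (D1 \<union> D3) s = bf (D1 \<union> D3) s" "amalgam_balance (D2 \<union> D3) s = jo (D2 \<union> D3) s"
          unfolding amalgam_balance_def using 6 n by simp_all
        show ?thesis using cross_paths[where s = s, OF utheta_perm(4)[OF th] subs(4) 6 K] unfolding a cm two_of_three_def by satx
      next
        case 7
        then have n: "e \<notin> D1" "e \<notin> D2" "f \<notin> D2" "f \<notin> D3" using dis by auto
        have a: "amalgam_balance (D1 \<union> D2) s = bf (D1 \<union> D2) s" "amalgam_balance (D1 \<union> D3) s = jo (D1 \<union> D3) s" "amalgam_balance (D2 \<union> D3) s = be (D2 \<union> D3) s"
          unfolding amalgam_balance_def using 7 n by simp_all
        show ?thesis using cross_paths[where s = s, OF utheta_perm(5)[OF th] subs(5) 7 K] unfolding a cm two_of_three_def by satx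
      next
        case 8
        then have n: "e \<notin> D1" "e \<notin> D2" "f \<notin> D1" "f \<notin> D3" using dis by auto
        have a: "amalgam_balance (D1 \<union> D2) s = bf (D1 \<union> D2) s" "amalgam_balance (D1 \<union> D3) s = be (D1 \<union> D3) s" "amalgam_balance (D2 \<union> D3) s = jo (D2 \<union> D3) s"
          unfolding amalgam_balance_def using 8 n by simp_all
        show ?thesis using cross_paths[where s = s, OF utheta_perm(3)[OF th] subs(3) 8 K] unfolding a cm two_of_three_def by satx
      next
        case 9
        then have n: "e \<notin> D1" "e \<notin> D2" "f \<notin> D1" "f \<notin> D2" using dis by auto
        have a: "amalgam_balance (D1 \<union> D2) s = bf (D1 \<union> D2) s" "amalgam_balance (D1 \<union> D3) s = jo (D1 \<union> D3) s" "amalgam_balance (D2 \<union> D3) s = jo (D2 \<union> D3) s"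
          unfolding amalgam_balance_def using 9 n by simp_all
        show ?thesis using same_path[where s = s, OF utheta_perm(3)[OF th] subs(3) 9 K] unfolding a cm two_of_three_def by satx
      qed
    qed
  qed
  then show "amalgam_balance (D2 \<union> D3) s" using b unfolding two_of_three_def by blast
qed

lemma amalgam_agree: "agree K (insert e E) amalgam_balance be" "agree K (insert f E) amalgam_balance bf"
proof -
  show "agree K (insert e E) amalgam_balance be" unfolding agree_def
  proof (intro allI impI)
    fix C s assume C: "circ C" "C \<subseteq> insert e E" "\<forall>d\<in>C. s d \<in> K d"
    then have "f \<notin> C" using ef by auto
    moreover have "be C s = bf C s" if "e \<notin> C"
    proof -
      have "C \<subseteq> E" using C(2) that by auto
      then show ?thesis using agree_e agree_f C(1,3) unfolding agree_def by metis
    qed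
    ultimately show "amalgam_balance C s = be C s" unfolding amalgam_balance_def by simp
  qed
  show "agree K (insert f E) amalgam_balance bf" unfolding agree_def
  proof (intro allI impI)
    fix C s assume "circ C" "C \<subseteq> insert f E"
    then have "e \<notin> C" using ef by auto
    then show "amalgam_balance C s = bf C s" unfolding amalgam_balance_def by simp
  qed
qed

end

subsection \<open>Uniqueness, and extension to many links\<close>

lemma bexp_mono:
  assumes "bexp K F b" "E \<subseteq> F" "\<And>d. d \<in> E \<Longrightarrow> K' d = K d"
  shows "bexp K' E b"
  unfolding bexp_def theta_prop_def
proof (intro conjI allI impI)
  show "b C s = b C t" if "\<forall>e\<in>C. s e = t e" for C s t
    using theta_prop_cong[OF bexp_theta_prop[OF assms(1)]] that by metis
next
  fix x y W1 D1 W2 D2 W3 D3 s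
  assume *: "utheta x y W1 D1 W2 D2 W3 D3" "D1 \<union> D2 \<union> D3 \<subseteq> E" "\<forall>d\<in>D1 \<union> D2 \<union> D3. s d \<in> K' d"
    "b (D1 \<union> D2) s" "b (D1 \<union> D3) s"
  have "D1 \<union> D2 \<union> D3 \<subseteq> F" using order_trans[OF *(2) assms(2)] .
  moreover have "s d \<in> K d" if "d \<in> D1 \<union> D2 \<union> D3" for d using that *(2,3) assms(3) by (metis subsetD)
  ultimately show "b (D2 \<union> D3) s" using theta_prop_theta[where s = s, OF bexp_theta_prop[OF assms(1)] *(1)] *(4,5) by metis
next
  fix C e s assume *: "circ C" "C \<subseteq> E" "e \<in> C" "\<forall>d\<in>C - {e}. s d \<in> K' d"
  have "C \<subseteq> F" using order_trans[OF *(2) assms(2)] .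
  moreover have "s d \<in> K d" if "d \<in> C - {e}" for d using that *(2,4) assms(3) by (metis Diff_subset subsetD)
  ultimately have "\<exists>!k. k \<in> K e \<and> b C (s(e := k))" using bexp_lift[where s = s, OF assms(1) *(1) _ *(3)] by metis
  moreover have "K' e = K e" using *(2,3) assms(3) by auto
  ultimately show "\<exists>!k. k \<in> K' e \<and> b C (s(e := k))" by simp
qed

text \<open>Fixing the label over \<open>e\<close> lets two extensions with different fibres over \<open>e\<close> be compared in one
  \<open>chord_frame\<close>.\<close>

lemma theta_prop_pin:
  assumes b: "theta_prop K (insert e E) b" and k: "k \<in> K e" and K': "\<And>d. d \<in> E \<Longrightarrow> K' d = K d"
  shows "theta_prop K' (insert e E) (\<lambda>C s. b C (s(e := k)))"
  unfolding theta_prop_def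
proof (intro conjI allI impI)
  show "b C (s(e := k)) = b C (t(e := k))" if "\<forall>e\<in>C. s e = t e" for C s t
    by (rule theta_prop_cong[OF b]) (use that in simp)
next
  fix x y W1 D1 W2 D2 W3 D3 s
  assume *: "utheta x y W1 D1 W2 D2 W3 D3" "D1 \<union> D2 \<union> D3 \<subseteq> insert e E" "\<forall>d\<in>D1 \<union> D2 \<union> D3. s d \<in> K' d"
    "b (D1 \<union> D2) (s(e := k))" "b (D1 \<union> D3) (s(e := k))"
  have "(s(e := k)) d \<in> K d" if "d \<in> D1 \<union> D2 \<union> D3" for d
  proof (cases "d = e")
    case False
    then have "d \<in> E" using that *(2) by auto
    then show ?thesis using False *(3) that K' by auto
  qed (use k in simp)
  then show "b (D2 \<union> D3) (s(e := k))" using theta_prop_theta[where s = "s(e := k)", OF b *(1,2)] *(4,5) by metis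
qed

text \<open>This is a degenerate chord frame: \<open>e = f\<close>, the two paths are the single
  nodes \<open>v\<close> and \<open>u\<close>, and the chords are the paths from \<open>u\<close> to
  \<open>v\<close>. With \<open>k1\<close> and \<open>k2\<close> pinned, independence of the chord
  says that labels which match along one path match along every other.\<close>

lemma edge_consistent:
  assumes b1: "bexp K1 (insert e E) b1" and b2: "bexp K2 (insert e E) b2" and KK: "\<And>d. d \<in> E \<Longrightarrow> K1 d = K2 d"
    and ag: "agree K1 E b1 b2" and ee: "e = {u, v}" "u \<noteq> v" "e \<notin> E" "u \<in> V" "v \<in> V"
    and co: "conn V E" and tw: "\<forall>e\<in>E. \<forall>f\<in>E. e \<noteq> f \<longrightarrow> (\<exists>C. circ C \<and> C \<subseteq> E \<and> e \<in> C \<and> f \<in> C)"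
    and k: "k1 \<in> K1 e" "k2 \<in> K2 e"
    and R: "upath u v W R" "R \<subseteq> E" "upath u v W' R'" "R' \<subseteq> E"
    and s: "\<And>d. d \<in> E \<Longrightarrow> s d \<in> K1 d" "\<And>d. d \<in> E \<Longrightarrow> s' d \<in> K1 d"
    and b: "b1 (insert e R) (s(e := k1))" "b2 (insert e R) (s(e := k2))" "b1 (insert e R') (s'(e := k1))"
  shows "b2 (insert e R') (s'(e := k2))"
proof -
  define K' where "K' = (\<lambda>d. if d \<in> E then K1 d else UNIV)"
  define be where "be = (\<lambda>C s. b1 C (s(e := k1)))"
  define bf where "bf = (\<lambda>C s. b2 C (s(e := k2)))"
  note t1 = bexp_theta_prop[OF b1] and t2 = bexp_theta_prop[OF b2]
  have ag1: "agree K' E be b1" unfolding agree_def be_def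
    using theta_prop_upd[OF t1] ee(3) by (metis subsetD)
  have ag2: "agree K' E bf b1" unfolding agree_def bf_def
  proof (intro allI impI)
    fix C s assume C: "circ C" "C \<subseteq> E" "\<forall>d\<in>C. s d \<in> K' d"
    have "\<forall>d\<in>C. s d \<in> K1 d" using C(2,3) unfolding K'_def by (metis subsetD)
    then have "b1 C s = b2 C s" using ag C(1,2) unfolding agree_def by metis
    moreover have "b2 C (s(e := k2)) = b2 C s" using theta_prop_upd[OF t2] C(2) ee(3) by (metis subsetD)
    ultimately show "b2 C (s(e := k2)) = b1 C s" by simp
  qed
  have B0: "bexp K' E b1" by (rule bexp_mono[OF b1]) (auto simp: K'_def)
  have be: "theta_prop K' (insert e E) be" unfolding be_def by (rule theta_prop_pin[OF t1 k(1)]) (simp add: K'_def)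
  have bf: "theta_prop K' (insert e E) bf" unfolding bf_def by (rule theta_prop_pin[OF t2 k(2)]) (simp add: K'_def KK)
  interpret chord_frame K' E b1 be bf e e u v v u "{v}" "{}" "{u}" "{}"
    by unfold_locales (use B0 be bf ag1 ag2 ee upath_refl in \<open>auto simp: insert_commute\<close>)
  have ch: "chord u v W R {} {} {} {}" if "upath u v W R" "R \<subseteq> E" for W R
    unfolding is_chord_def using that upath_ends[OF that(1)] upath_refl[of u] upath_refl[of v] by auto
  \<comment> \<open>The two arcs of a circle through \<open>u\<close> and \<open>v\<close> serve as
    the disjoint chords.\<close>
  obtain C where C: "circ C" "C \<subseteq> E" "u \<in> \<Union>C" "v \<in> \<Union>C"
    using circle_through_two[OF co tw ee(4,5,2)] ee(1,3) by metis
  obtain W1 R1 W2 R2 where p: "upath u v W1 R1" "upath u v W2 R2" "W1 \<inter> W2 = {u, v}" "R1 \<inter> R2 = {}" "C = R1 \<union> R2"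
    using circ_two_verts[OF C(1,3,4) ee(2)] by metis
  have RE: "R1 \<subseteq> E" "R2 \<subseteq> E" using p(5) C(2) by auto
  define t where "t = s(e := k1)"
  define t' where "t' = s'(e := k1)"
  have sec: "t d \<in> K' d" "t' d \<in> K' d" for d unfolding K'_def t_def t'_def using s ee(3) by auto
  have "bf (insert e ({} \<union> {} \<union> R')) t'"
  proof (rule chord_independent[where s = t and s' = t', OF ch[OF p(1) RE(1)] ch[OF p(2) RE(2)] _ p(4) ch[OF R(1,2)] ch[OF R(3,4)] sec])
    show "W1 \<inter> W2 \<subseteq> {u} \<union> {v}" using p(3) by auto
    show "t d = t' d" if "d \<in> insert e (insert e ({} \<union> {}))" for d using that unfolding t_def t'_def by simp
  qed (use b in \<open>simp_all add: be_def bf_def t_def t'_def\<close>)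
  then show ?thesis unfolding bf_def t'_def by simp
qed

text \<open>Labels \<open>k1\<close> and \<open>k2\<close> are matched if some lift of the fixed
  path \<open>R0\<close> is closed to a balanced circle by \<open>k1\<close> for \<open>b1\<close>
  and by \<open>k2\<close> for \<open>b2\<close>. By \<open>edge_consistent\<close> a match persists
  for every path and lift, and unique lifting makes the matching a bijection.\<close>

lemma edge_unique:
  assumes b1: "bexp K1 (insert e E) b1" and b2: "bexp K2 (insert e E) b2" and KK: "\<And>d. d \<in> E \<Longrightarrow> K1 d = K2 d"
    and ag: "agree K1 E b1 b2" and e: "e \<notin> E" "e \<subseteq> V" "card e = 2"
    and co: "conn V E" and tw: "\<forall>e\<in>E. \<forall>f\<in>E. e \<noteq> f \<longrightarrow> (\<exists>C. circ C \<and> C \<subseteq> E \<and> e \<in> C \<and> f \<in> C)"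
    and ne: "\<And>d. K1 d \<noteq> {}"
  shows "\<exists>\<phi>. bij_betw \<phi> (K1 e) (K2 e) \<and>
    (\<forall>C s. circ C \<longrightarrow> e \<in> C \<longrightarrow> C \<subseteq> insert e E \<longrightarrow> (\<forall>d. s d \<in> K1 d) \<longrightarrow> b1 C s = b2 C (s(e := \<phi> (s e))))"
proof -
  obtain u v where uv: "e = {u, v}" "u \<noteq> v" using e(3) by (auto simp: card_2_iff)
  then have V: "u \<in> V" "v \<in> V" using e(2) by auto
  obtain W0 R0 where R0: "upath u v W0 R0" "R0 \<subseteq> E" using co V unfolding conn_def by metis
  have ag': "agree K2 E b2 b1"
    unfolding agree_def
  proof (intro allI impI)
    fix C s assume C: "circ C" "C \<subseteq> E" "\<forall>d\<in>C. s d \<in> K2 d"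
    then have "\<forall>d\<in>C. s d \<in> K1 d" using KK by (metis subsetD)
    then show "b2 C s = b1 C s" using ag C(1,2) unfolding agree_def by metis
  qed
  have KK': "\<And>d. d \<in> E \<Longrightarrow> K2 d = K1 d" using KK by simp
  define \<psi> where "\<psi> k1 k2 \<longleftrightarrow> k1 \<in> K1 e \<and> k2 \<in> K2 e \<and> (\<exists>s. (\<forall>d\<in>E. s d \<in> K1 d) \<and>
     b1 (insert e R0) (s(e := k1)) \<and> b2 (insert e R0) (s(e := k2)))" for k1 k2
  have main: "b1 (insert e R) (s(e := k1)) = b2 (insert e R) (s(e := k2))"
    if \<psi>: "\<psi> k1 k2" and R: "upath u v W R" "R \<subseteq> E" and s: "\<forall>d\<in>E. s d \<in> K1 d" for k1 k2 W R s
  proof -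
    obtain t where t: "\<And>d. d \<in> E \<Longrightarrow> t d \<in> K1 d" "b1 (insert e R0) (t(e := k1))" "b2 (insert e R0) (t(e := k2))"
      and k: "k1 \<in> K1 e" "k2 \<in> K2 e" using \<psi> unfolding \<psi>_def by metis
    have s1: "\<And>d. d \<in> E \<Longrightarrow> s d \<in> K1 d" using s by simp
    have t2: "\<And>d. d \<in> E \<Longrightarrow> t d \<in> K2 d" "\<And>d. d \<in> E \<Longrightarrow> s d \<in> K2 d" using t(1) s1 KK by auto
    show ?thesis
      using edge_consistent[where s = t and s' = s, OF b1 b2 KK ag uv e(1) V co tw k R0 R t(1) s1 t(2,3)]
        edge_consistent[where s = t and s' = s, OF b2 b1 KK' ag' uv e(1) V co tw k(2,1) R0 R t2 t(3,2)] by blast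
  qed
  have "{u, v} \<notin> R0" using R0(2) e(1) uv(1) by auto
  then have "circ (insert e R0)" unfolding circ_def using R0(1) uv by metis
  moreover have "insert e R0 \<subseteq> insert e E" "e \<in> insert e R0" using R0(2) by auto
  ultimately have circ0: "circ (insert e R0)" "insert e R0 \<subseteq> insert e E" "e \<in> insert e R0" by auto
  obtain g where g: "g \<in> R0" "g \<noteq> e" using upath_nonempty[OF R0(1) uv(2)] R0(2) e(1) by auto
  define s0 where "s0 = (\<lambda>d. SOME k. k \<in> K1 d)"
  have s0: "s0 d \<in> K1 d" for d unfolding s0_def using ne some_in_eq by auto
  \<comment> \<open>With the label over \<open>e\<close> prescribed, a link of \<open>R0\<close> is
    relabelled to attain balance; so every label takes part in the matching.\<close>
  have l1: "\<exists>s. (\<forall>d\<in>E. s d \<in> K1 d) \<and> b1 (insert e R0) (s(e := k))" if k: "k \<in> K1 e" for k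
  proof -
    have "(s0(e := k)) d \<in> K1 d" for d using s0 k by simp
    then obtain h where "h \<in> K1 g" "b1 (insert e R0) ((s0(e := k))(g := h))"
      using bexp_lift[where s = "s0(e := k)", OF b1 circ0(1,2), of g] g by auto
    moreover have "(s0(e := k))(g := h) = (s0(g := h))(e := k)" using g(2) by (rule fun_upd_twist[symmetric])
    ultimately show ?thesis using s0 by (intro exI[of _ "s0(g := h)"]) auto
  qed
  have l2: "\<exists>s. (\<forall>d\<in>E. s d \<in> K1 d) \<and> b2 (insert e R0) (s(e := k))" if k: "k \<in> K2 e" for k
  proof -
    have "(s0(e := k)) d \<in> K2 d" if "d \<in> insert e R0 - {g}" for d using s0 k that R0(2) KK by auto
    then obtain h where "h \<in> K2 g" "b2 (insert e R0) ((s0(e := k))(g := h))"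
      using bexp_lift[where s = "s0(e := k)", OF b2 circ0(1,2), of g] g by blast
    moreover have "(s0(e := k))(g := h) = (s0(g := h))(e := k)" using g(2) by (rule fun_upd_twist[symmetric])
    moreover have "K2 g = K1 g" using g(1) R0(2) KK by auto
    ultimately show ?thesis using s0 by (intro exI[of _ "s0(g := h)"]) auto
  qed
  have u1: "\<exists>!k. k \<in> K1 e \<and> b1 (insert e R0) (s(e := k))" if "\<forall>d\<in>E. s d \<in> K1 d" for s
    using bexp_lift[where s = s, OF b1 circ0] that R0(2) by blast
  have u2: "\<exists>!k. k \<in> K2 e \<and> b2 (insert e R0) (s(e := k))" if "\<forall>d\<in>E. s d \<in> K1 d" for s
  proof -
    have "s d \<in> K2 d" if "d \<in> insert e R0 - {e}" for d using that \<open>\<forall>d\<in>E. s d \<in> K1 d\<close> R0(2) KK by auto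
    then show ?thesis using bexp_lift[where s = s, OF b2 circ0] by blast
  qed
  have ex1: "\<exists>k2. \<psi> k1 k2" if "k1 \<in> K1 e" for k1 using l1[OF that] u2 that unfolding \<psi>_def by metis
  have ex2: "\<exists>k1. \<psi> k1 k2" if "k2 \<in> K2 e" for k2 using l2[OF that] u1 that unfolding \<psi>_def by metis
  have in12: "k1 \<in> K1 e" "k2 \<in> K2 e" if "\<psi> k1 k2" for k1 k2 using that unfolding \<psi>_def by auto
  have eq2: "k2 = k2'" if "\<psi> k1 k2" "\<psi> k1 k2'" for k1 k2 k2'
    using l1[OF in12(1)[OF that(1)]] main[OF that(1) R0] main[OF that(2) R0] u2 in12[OF that(1)] in12[OF that(2)] by metis
  have eq1: "k1 = k1'" if "\<psi> k1 k2" "\<psi> k1' k2" for k1 k1' k2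
    using l2[OF in12(2)[OF that(1)]] main[OF that(1) R0] main[OF that(2) R0] u1 in12[OF that(1)] in12[OF that(2)] by metis
  define \<phi> where "\<phi> k1 = (SOME k2. \<psi> k1 k2)" for k1
  have \<phi>: "\<psi> k (\<phi> k)" if "k \<in> K1 e" for k using ex1[OF that] unfolding \<phi>_def by (rule someI_ex)
  have "bij_betw \<phi> (K1 e) (K2 e)"
  proof (rule bij_betwI')
    show "(\<phi> x = \<phi> y) = (x = y)" if "x \<in> K1 e" "y \<in> K1 e" for x y using eq1 \<phi>[OF that(1)] \<phi>[OF that(2)] by metis
    show "\<phi> x \<in> K2 e" if "x \<in> K1 e" for x using in12 \<phi>[OF that] by metis
    show "\<exists>x\<in>K1 e. y = \<phi> x" if "y \<in> K2 e" for y using ex2[OF that] in12 eq2 \<phi> by metis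
  qed
  moreover have "b1 C s = b2 C (s(e := \<phi> (s e)))"
    if C: "circ C" "e \<in> C" "C \<subseteq> insert e E" and s: "\<forall>d. s d \<in> K1 d" for C s
  proof -
    obtain w D W where D: "e = {u, w}" "upath u w W D" "e \<notin> D" "C = insert e D"
      using circ_edge_at[OF C(1,2), of u] uv(1) by (metis insertI1)
    have w: "w = v" using D(1) uv by (auto simp: doubleton_eq_iff)
    have "D \<subseteq> E" using D(3,4) C(3) by auto
    then show ?thesis using main[OF \<phi>, of "s e" W D s] D(2,4) s w by simp
  qed
  ultimately show ?thesis by metis
qed

lemma bexp_relabel:
  assumes b: "bexp K2 F b" and \<phi>: "\<And>e. e \<in> F \<Longrightarrow> bij_betw (\<phi> e) (K1 e) (K2 e)"
  shows "bexp K1 F (\<lambda>C s. b C (\<lambda>d. \<phi> d (s d)))"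
  unfolding bexp_def theta_prop_def
proof (intro conjI allI impI)
  show "b C (\<lambda>d. \<phi> d (s d)) = b C (\<lambda>d. \<phi> d (t d))" if "\<forall>e\<in>C. s e = t e" for C s t
    by (rule theta_prop_cong[OF bexp_theta_prop[OF b]]) (use that in simp)
next
  fix x y W1 D1 W2 D2 W3 D3 s
  assume *: "utheta x y W1 D1 W2 D2 W3 D3" "D1 \<union> D2 \<union> D3 \<subseteq> F" "\<forall>d\<in>D1 \<union> D2 \<union> D3. s d \<in> K1 d"
    "b (D1 \<union> D2) (\<lambda>d. \<phi> d (s d))" "b (D1 \<union> D3) (\<lambda>d. \<phi> d (s d))"
  have "\<phi> d (s d) \<in> K2 d" if "d \<in> D1 \<union> D2 \<union> D3" for d
    using that *(2,3) \<phi> bij_betwE by (metis subsetD)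
  then show "b (D2 \<union> D3) (\<lambda>d. \<phi> d (s d))"
    using theta_prop_theta[where s = "\<lambda>d. \<phi> d (s d)", OF bexp_theta_prop[OF b] *(1,2)] *(4,5) by metis
next
  fix C e s assume *: "circ C" "C \<subseteq> F" "e \<in> C" "\<forall>d\<in>C - {e}. s d \<in> K1 d"
  have "\<phi> d (s d) \<in> K2 d" if "d \<in> C - {e}" for d using that *(2,4) \<phi> bij_betwE by (metis Diff_subset subsetD)
  then have 1: "\<exists>!k. k \<in> K2 e \<and> b C ((\<lambda>d. \<phi> d (s d))(e := k))"
    using bexp_lift[where s = "\<lambda>d. \<phi> d (s d)", OF b *(1-3)] by metis
  have bij: "bij_betw (\<phi> e) (K1 e) (K2 e)" using \<phi> *(2,3) by auto
  have 2: "(\<lambda>d. \<phi> d ((s(e := k)) d)) = (\<lambda>d. \<phi> d (s d))(e := \<phi> e k)" for k by auto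
  obtain k2 where k2: "k2 \<in> K2 e" "b C ((\<lambda>d. \<phi> d (s d))(e := k2))"
    "\<And>k. k \<in> K2 e \<Longrightarrow> b C ((\<lambda>d. \<phi> d (s d))(e := k)) \<Longrightarrow> k = k2" using 1 by metis
  obtain k1 where k1: "k1 \<in> K1 e" "\<phi> e k1 = k2" using bij k2(1) by (metis bij_betw_imp_surj_on imageE)
  have "k = k1" if "k \<in> K1 e" "b C ((\<lambda>d. \<phi> d (s d))(e := \<phi> e k))" for k
    using k2(3)[OF _ that(2)] k1 that(1) bij unfolding bij_betw_def inj_on_def by auto
  then show "\<exists>!k. k \<in> K1 e \<and> b C (\<lambda>d. \<phi> d ((s(e := k)) d))" unfolding 2 using k1 k2(2) by metis
qed

lemma card_diff_le_1:
  assumes "finite C" "card (C - E) \<le> 1"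
  obtains "C \<subseteq> E" | e where "e \<in> C" "e \<notin> E" "C \<subseteq> insert e E"
proof (cases "C \<subseteq> E")
  case False
  then obtain e where e: "e \<in> C" "e \<notin> E" by auto
  have "C - E = {e}" using assms e card_le_Suc0_iff_eq[of "C - E"] by auto
  then show thesis using that(2)[OF e] by auto
qed (use that in simp)

text \<open>The matchings over single links are put together, with the identity on \<open>E\<close>.
  By construction the classes then agree on circles with at most one link off \<open>E\<close>, and
  \<open>agree_all\<close> extends this to all circles.\<close>

lemma extension_unique:
  assumes b1: "bexp K1 F b1" and b2: "bexp K2 F b2" and KK: "\<And>d. d \<in> E \<Longrightarrow> K1 d = K2 d"
    and ag: "agree K1 E b1 b2" and F: "E \<subseteq> F" "\<Union>F \<subseteq> V" "\<And>e. e \<in> F \<Longrightarrow> card e = 2"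
    and co: "conn V E" and tw: "\<forall>e\<in>E. \<forall>f\<in>E. e \<noteq> f \<longrightarrow> (\<exists>C. circ C \<and> C \<subseteq> E \<and> e \<in> C \<and> f \<in> C)"
    and ne: "\<And>d. K1 d \<noteq> {}"
  obtains \<phi> where "\<And>e. e \<in> F \<Longrightarrow> bij_betw (\<phi> e) (K1 e) (K2 e)" "\<And>e. e \<in> E \<Longrightarrow> \<phi> e = id"
    "agree K1 F b1 (\<lambda>C s. b2 C (\<lambda>d. \<phi> d (s d)))"
proof -
  have "\<exists>\<phi>. bij_betw \<phi> (K1 e) (K2 e) \<and>
    (\<forall>C s. circ C \<longrightarrow> e \<in> C \<longrightarrow> C \<subseteq> insert e E \<longrightarrow> (\<forall>d. s d \<in> K1 d) \<longrightarrow> b1 C s = b2 C (s(e := \<phi> (s e))))"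
    if "e \<in> F - E" for e
  proof -
    have 1: "bexp K1 (insert e E) b1" "bexp K2 (insert e E) b2"
      using bexp_mono[OF b1, of "insert e E" K1] bexp_mono[OF b2, of "insert e E" K2] that F(1) by auto
    show ?thesis by (rule edge_unique[OF 1 KK ag _ _ _ co tw ne]) (use that F in auto)
  qed
  then obtain \<phi>0 where \<phi>0: "\<And>e. e \<in> F - E \<Longrightarrow> bij_betw (\<phi>0 e) (K1 e) (K2 e)"
    "\<And>e C s. e \<in> F - E \<Longrightarrow> circ C \<Longrightarrow> e \<in> C \<Longrightarrow> C \<subseteq> insert e E \<Longrightarrow> (\<And>d. s d \<in> K1 d) \<Longrightarrow> b1 C s = b2 C (s(e := \<phi>0 e (s e)))"
    by metis
  define \<phi> where "\<phi> = (\<lambda>e. if e \<in> E then id else \<phi>0 e)"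
  have \<phi>: "bij_betw (\<phi> e) (K1 e) (K2 e)" if "e \<in> F" for e unfolding \<phi>_def using \<phi>0(1) that KK by auto
  note t2 = bexp_theta_prop[OF b2]
  have link_graph: "b1 C s = b2 C (\<lambda>d. \<phi> d (s d))"
    if C: "circ C" "C \<subseteq> F" "card (C - E) \<le> 1" and s: "\<And>d. s d \<in> K1 d" for C s
  proof (rule card_diff_le_1[OF circ_finite[OF C(1)] C(3)])
    assume E: "C \<subseteq> E"
    have "b2 C (\<lambda>d. \<phi> d (s d)) = b2 C s" by (rule theta_prop_cong[OF t2]) (use E in \<open>auto simp: \<phi>_def\<close>)
    then show ?thesis using ag C(1) E s unfolding agree_def by metis
  next
    fix e assume e: "e \<in> C" "e \<notin> E" "C \<subseteq> insert e E"
    have "b2 C (\<lambda>d. \<phi> d (s d)) = b2 C (s(e := \<phi>0 e (s e)))"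
      by (rule theta_prop_cong[OF t2]) (use e in \<open>auto simp: \<phi>_def\<close>)
    moreover have "e \<in> F - E" using e C(2) by auto
    ultimately show ?thesis using \<phi>0(2)[OF _ C(1) e(1,3)] s by metis
  qed
  have "agree K1 F b1 (\<lambda>C s. b2 C (\<lambda>d. \<phi> d (s d)))"
    by (rule agree_all[OF b1 bexp_relabel[OF b2 \<phi>] co F(1,2) ne link_graph])
  moreover have "\<phi> e = id" if "e \<in> E" for e using that by (simp add: \<phi>_def)
  ultimately show thesis by (intro that[of \<phi>] \<phi>)
qed

text \<open>One link \<open>e\<close> is moved into the base. Over the enlarged base every other
  link \<open>g\<close> gets the amalgam of its extension with that of \<open>e\<close>, which
  restores the hypotheses for the remaining links.\<close>

lemma finite_amalgam:
  assumes "finite Y" and ne: "\<And>d. K d \<noteq> {}"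
    and "bexp K E b0" "conn V E" "three_conn_path V E" "\<Union>E \<subseteq> V"
    and "\<And>e. e \<in> Y \<Longrightarrow> e \<subseteq> V \<and> card e = 2 \<and> e \<notin> E \<and> bexp K (insert e E) (b e) \<and> agree K E (b e) b0"
  shows "\<exists>B. bexp K (E \<union> Y) B \<and> agree K E B b0 \<and> (\<forall>e\<in>Y. agree K (insert e E) B (b e))"
  using assms(1,3-)
proof (induction arbitrary: E b0 b rule: finite_induct)
  case empty
  then show ?case by (intro exI[of _ b0]) (auto simp: agree_def)
next
  case (insert e Y)
  note be = insert.prems(5)[of e, simplified]
  have "\<exists>c. bexp K (insert g (insert e E)) c \<and> agree K (insert e E) c (b e) \<and> agree K (insert g E) c (b g)" if g: "g \<in> Y" for g
  proof -
    note bg = insert.prems(5)[of g]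
    have "amalgam K V E b0 (b e) (b g) e g"
      by unfold_locales (use be bg g insert.prems(1-4) insert.hyps(2) ne in auto)
    from amalgam.amalgam_bexp[OF this] amalgam.amalgam_agree[OF this] show ?thesis
      by (metis insert_commute)
  qed
  then obtain c where c: "\<And>g. g \<in> Y \<Longrightarrow> bexp K (insert g (insert e E)) (c g)"
    "\<And>g. g \<in> Y \<Longrightarrow> agree K (insert e E) (c g) (b e)" "\<And>g. g \<in> Y \<Longrightarrow> agree K (insert g E) (c g) (b g)" by metis
  have "\<exists>B. bexp K (insert e E \<union> Y) B \<and> agree K (insert e E) B (b e) \<and> (\<forall>g\<in>Y. agree K (insert g (insert e E)) B (c g))"
  proof (rule insert.IH)
    show "bexp K (insert e E) (b e)" using be by simp
    show "conn V (insert e E)" "three_conn_path V (insert e E)"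
      by (rule conn_mono[OF insert.prems(2)] three_conn_path_mono[OF insert.prems(3)]; auto)+
    show "\<Union>(insert e E) \<subseteq> V" using insert.prems(4) be by auto
    show "g \<subseteq> V \<and> card g = 2 \<and> g \<notin> insert e E \<and> bexp K (insert g (insert e E)) (c g) \<and> agree K (insert e E) (c g) (b e)"
      if g: "g \<in> Y" for g
      using insert.prems(5)[of g] c g insert.hyps(2) by auto
  qed
  then obtain B where B: "bexp K (insert e E \<union> Y) B" "agree K (insert e E) B (b e)"
    "\<And>g. g \<in> Y \<Longrightarrow> agree K (insert g (insert e E)) B (c g)" by metis
  have "agree K E B b0"
    unfolding agree_def
  proof (intro allI impI)
    fix C s assume C: "circ C" "C \<subseteq> E" "\<forall>d\<in>C. s d \<in> K d"
    then have "B C s = b e C s" using B(2) unfolding agree_def by (metis subset_insertI2)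
    then show "B C s = b0 C s" using be C unfolding agree_def by metis
  qed
  moreover have "agree K (insert g E) B (b g)" if g: "g \<in> Y" for g
    unfolding agree_def
  proof (intro allI impI)
    fix C s assume C: "circ C" "C \<subseteq> insert g E" "\<forall>d\<in>C. s d \<in> K d"
    then have "C \<subseteq> insert g (insert e E)" by auto
    then have "B C s = c g C s" using B(3)[OF g] C unfolding agree_def by metis
    then show "B C s = b g C s" using c(3)[OF g] C unfolding agree_def by metis
  qed
  moreover have "insert e E \<union> Y = E \<union> insert e Y" by auto
  ultimately show ?case using B(1,2) by (intro exI[of _ B]) auto
qed

text \<open>A circle is judged by the amalgam chosen for its own finitely many new links. The
  choices do not conflict: amalgams of finite sets agree on circles with at most one new link, hence
  by \<open>agree_all\<close> on all common circles.\<close>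

lemma amalgam_all:
  assumes ne: "\<And>d. K d \<noteq> {}"
    and b0: "bexp K E b0" and co: "conn V E" and three: "three_conn_path V E" and V: "\<Union>E \<subseteq> V"
    and b: "\<And>e. e \<in> X \<Longrightarrow> e \<subseteq> V \<and> card e = 2 \<and> e \<notin> E \<and> bexp K (insert e E) (b e) \<and> agree K E (b e) b0"
  obtains B where "bexp K (E \<union> X) B" "agree K E B b0"
proof -
  have "\<exists>B. bexp K (E \<union> Y) B \<and> agree K E B b0 \<and> (\<forall>e\<in>Y. agree K (insert e E) B (b e))" if "finite Y" "Y \<subseteq> X" for Y
    by (rule finite_amalgam[OF that(1) ne b0 co three V]) (use b that(2) in auto)
  then obtain Bf where Bf: "\<And>Y. finite Y \<Longrightarrow> Y \<subseteq> X \<Longrightarrow> bexp K (E \<union> Y) (Bf Y)"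
    "\<And>Y. finite Y \<Longrightarrow> Y \<subseteq> X \<Longrightarrow> agree K E (Bf Y) b0"
    "\<And>Y e. finite Y \<Longrightarrow> Y \<subseteq> X \<Longrightarrow> e \<in> Y \<Longrightarrow> agree K (insert e E) (Bf Y) (b e)" by metis
  define B where "B C s \<longleftrightarrow> circ C \<and> C \<subseteq> E \<union> X \<and> Bf (C - E) C s" for C s
  have BY: "B C s = Bf Y C s" if Y: "finite Y" "Y \<subseteq> X" and C: "circ C" "C \<subseteq> E \<union> Y" and s: "\<And>d. s d \<in> K d" for Y C s
  proof -
    let ?Z = "C - E"
    have Z: "finite ?Z" "?Z \<subseteq> X" "?Z \<subseteq> Y" using circ_finite[OF C(1)] C(2) Y(2) by auto
    have "agree K (E \<union> ?Z) (Bf ?Z) (Bf Y)"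
    proof (rule agree_all[OF Bf(1)[OF Z(1,2)] bexp_mono[OF Bf(1)[OF Y]] co _ _ ne])
      show "E \<union> ?Z \<subseteq> E \<union> Y" "E \<subseteq> E \<union> ?Z" using Z(3) by auto
      show "\<Union>(E \<union> ?Z) \<subseteq> V" using V b Z(2) by blast
    next
      fix D s assume D: "circ D" "D \<subseteq> E \<union> ?Z" "card (D - E) \<le> 1" and s: "\<And>d. s d \<in> K d"
      show "Bf ?Z D s = Bf Y D s"
      proof (rule card_diff_le_1[OF circ_finite[OF D(1)] D(3)])
        assume "D \<subseteq> E"
        then show ?thesis using Bf(2)[OF Z(1,2)] Bf(2)[OF Y] D(1) s unfolding agree_def by metis
      next
        fix e assume e: "e \<in> D" "e \<notin> E" "D \<subseteq> insert e E"
        then have "e \<in> ?Z" "e \<in> Y" using D(2) Z(3) by auto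
        then show ?thesis using Bf(3)[OF Z(1,2)] Bf(3)[OF Y] D(1) s e(3) unfolding agree_def by metis
      qed
    qed simp
    moreover have "C \<subseteq> E \<union> ?Z" "C \<subseteq> E \<union> X" using C(2) Y(2) by auto
    ultimately show ?thesis unfolding B_def using C(1) s unfolding agree_def by metis
  qed
  have "bexp K (E \<union> X) B"
  proof (rule bexpI[OF ne])
    show "B C s = B C t" if eq: "\<And>e. e \<in> C \<Longrightarrow> s e = t e" for C s t
    proof (cases "circ C \<and> C \<subseteq> E \<union> X")
      case True
      then have "finite (C - E)" "C - E \<subseteq> X" using circ_finite[of C] by auto
      then show ?thesis unfolding B_def using theta_prop_cong[OF bexp_theta_prop[OF Bf(1)]] eq by metis
    qed (auto simp: B_def)
  next
    fix C e s assume C: "circ C" "C \<subseteq> E \<union> X" "e \<in> C" and s: "\<And>d. s d \<in> K d"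
    have Z: "finite (C - E)" "C - E \<subseteq> X" "C \<subseteq> E \<union> (C - E)" using circ_finite[OF C(1)] C(2) by auto
    have "\<exists>!k. k \<in> K e \<and> Bf (C - E) C (s(e := k))"
      using bexp_lift[where s = s, OF Bf(1)[OF Z(1,2)] C(1) Z(3) C(3)] s by simp
    then show "\<exists>!k. k \<in> K e \<and> B C (s(e := k))" unfolding B_def using C(1,2) by simp
  next
    fix x y W1 D1 W2 D2 W3 D3 s
    assume th: "utheta x y W1 D1 W2 D2 W3 D3" "D1 \<union> D2 \<union> D3 \<subseteq> E \<union> X" and s: "\<And>d. s d \<in> K d"
      and h: "B (D1 \<union> D2) s" "B (D1 \<union> D3) s"
    \<comment> \<open>A theta has finitely many links, so one amalgam judges its three
      circles.\<close>
    let ?Y = "(D1 \<union> D2 \<union> D3) - E"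
    have "finite (D1 \<union> D2 \<union> D3)" using th(1) upath_finite unfolding utheta_def by (metis finite_UnI)
    then have Y: "finite ?Y" "?Y \<subseteq> X" using th(2) by auto
    note eq = BY[where s = s, OF Y _ _ s]
    have D: "D1 \<union> D2 \<subseteq> E \<union> ?Y" "D1 \<union> D3 \<subseteq> E \<union> ?Y" "D2 \<union> D3 \<subseteq> E \<union> ?Y" "D1 \<union> D2 \<union> D3 \<subseteq> E \<union> ?Y" by auto
    note C = utheta_circ[OF th(1)]
    have "Bf ?Y (D2 \<union> D3) s"
      using theta_prop_theta[where s = s, OF bexp_theta_prop[OF Bf(1)[OF Y]] th(1) D(4) s] h eq[OF C(1) D(1)] eq[OF C(2) D(2)] by simp
    then show "B (D2 \<union> D3) s" using eq[OF C(3) D(3)] by simp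
  qed
  moreover have "agree K E B b0"
    unfolding agree_def
  proof (intro allI impI)
    fix C s assume C: "circ C" "C \<subseteq> E" "\<forall>d\<in>C. s d \<in> K d"
    have "C - E = {}" "C \<subseteq> E \<union> X" using C(2) by auto
    then have "B C s = Bf {} C s" using C(1) by (simp only: B_def simp_thms)
    then show "B C s = b0 C s" using Bf(2)[of "{}"] C unfolding agree_def by simp
  qed
  ultimately show thesis using that by metis
qed

subsection \<open>From sections to biased expansions\<close>

text \<open>The nodes of a path are distinct, so no two of its edges are parallel; this makes the
  projection injective on the path.\<close>

lemma path_seq_upath:
  assumes "path_seq G vs es" and \<pi>: "\<And>f. f \<in> edges G \<Longrightarrow> ends G f = \<pi> f"
  shows "upath (hd vs) (last vs) (set vs) (\<pi> ` set es) \<and> inj_on \<pi> (set es)"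
  using assms(1)
proof (induction es arbitrary: vs)
  case Nil
  then obtain v where "vs = [v]" unfolding path_seq_def by (auto simp: length_Suc_conv)
  then show ?case by (simp add: upath_refl)
next
  case (Cons f es)
  then obtain v w vs' where vs: "vs = v # w # vs'" unfolding path_seq_def by (auto simp: length_Suc_conv)
  have nth: "ends G ((f # es) ! i) = {vs ! i, vs ! Suc i}" if "i < Suc (length es)" for i
    using Cons.prems that unfolding path_seq_def by simp
  have "path_seq G (w # vs') es" unfolding path_seq_def
  proof (intro conjI allI impI)
    show "ends G (es ! i) = {(w # vs') ! i, (w # vs') ! Suc i}" if "i < length es" for i
      using nth[of "Suc i"] that vs by simp
  qed (use Cons.prems vs in \<open>auto simp: path_seq_def\<close>)
  from Cons.IH[OF this]
  have IH: "upath w (last (w # vs')) (set (w # vs')) (\<pi> ` set es)" "inj_on \<pi> (set es)"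
    by simp_all
  have "ends G f = {v, w}" using nth[of 0] vs by simp
  moreover have "f \<in> edges G" using Cons.prems unfolding path_seq_def by simp
  ultimately have f: "\<pi> f = {v, w}" using \<pi> by simp
  have v: "v \<notin> set (w # vs')" using Cons.prems vs unfolding path_seq_def by simp
  have up: "upath v (last vs) (set vs) (\<pi> ` set (f # es))"
    using upath_cons[OF IH(1) v f[symmetric]] vs by simp
  have "\<pi> f \<noteq> \<pi> g" if "g \<in> set es" for g
    using upath_avoid[OF IH(1) v] that f by auto
  then have "inj_on \<pi> (set (f # es))" using IH(2) by (auto simp: inj_on_def)
  then show ?case using up vs by simp
qed

lemma upath_list:
  "upath a b W D \<Longrightarrow> \<exists>vs ds. hd vs = a \<and> last vs = b \<and> set vs = W \<and> set ds = D \<and> distinct vs \<and> distinct ds \<and>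
     length vs = Suc (length ds) \<and> (\<forall>i<length ds. ds ! i = {vs ! i, vs ! Suc i})"
proof (induction rule: upath.induct)
  case (upath_refl a)
  show ?case by (intro exI[of _ "[a]"] exI[of _ "[]"]) simp
next
  case (upath_step b c W D a)
  then obtain vs ds where *: "hd vs = b" "last vs = c" "set vs = W" "set ds = D" "distinct vs" "distinct ds"
     "length vs = Suc (length ds)" "\<forall>i<length ds. ds ! i = {vs ! i, vs ! Suc i}" by metis
  have "{a, b} \<notin> D" using upath_avoid[OF upath_step.hyps] by auto
  moreover have "vs \<noteq> []" using *(7) by auto
  moreover have "({a, b} # ds) ! i = {(a # vs) ! i, (a # vs) ! Suc i}" if "i < Suc (length ds)" for i
    using that *(1,8) \<open>vs \<noteq> []\<close> by (cases i) (auto simp: hd_conv_nth)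
  ultimately show ?case using * upath_step.hyps(2)
    by (intro exI[of _ "a # vs"] exI[of _ "{a, b} # ds"]) simp
qed

lemma upath_path_seq:
  assumes "upath a b W D" and l: "\<And>d. d \<in> D \<Longrightarrow> l d \<in> edges G \<and> ends G (l d) = d" and "W \<subseteq> verts G"
  obtains vs es where "path_seq G vs es" "hd vs = a" "last vs = b" "set vs = W" "set es = l ` D"
proof -
  obtain vs ds where *: "hd vs = a" "last vs = b" "set vs = W" "set ds = D" "distinct vs" "distinct ds"
     "length vs = Suc (length ds)" "\<forall>i<length ds. ds ! i = {vs ! i, vs ! Suc i}" using upath_list[OF assms(1)] by metis
  have "ends G (map l ds ! i) = {vs ! i, vs ! Suc i}" if "i < length (map l ds)" for i
  proof -
    have "ds ! i \<in> D" using that *(4) by auto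
    then show ?thesis using that *(8) l by simp
  qed
  moreover have "set (map l ds) \<subseteq> edges G" using *(4) l by auto
  ultimately have "path_seq G vs (map l ds)"
    unfolding path_seq_def using *(3,5,7) assms(3) by simp
  then show thesis using that * by (metis list.set_map)
qed

text \<open>Injectivity of \<open>\<pi>\<close> excludes digons, which are circles of
  \<open>G\<close> but project to a single link.\<close>

lemma circle_seq_circ:
  assumes c: "circle_seq G es" and \<pi>: "\<And>f. f \<in> edges G \<Longrightarrow> ends G f = \<pi> f \<and> card (\<pi> f) = 2" and inj: "inj_on \<pi> (set es)"
  shows "circ (\<pi> ` set es)"
proof -
  obtain vs where vs: "length vs = length es" "distinct vs" "set vs \<subseteq> verts G"
    "\<And>i. i < length es \<Longrightarrow> ends G (es ! i) = {vs ! i, vs ! (Suc i mod length es)}" and es: "es \<noteq> []" "distinct es" "set es \<subseteq> edges G"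
    using c unfolding circle_seq_def by auto
  define n where "n = length es - 1"
  have n: "length es = Suc n" "length vs = Suc n" unfolding n_def using es(1) vs(1) by auto
  have e: "es = butlast es @ [last es]" "last es = es ! n"
    using append_butlast_last_id[OF es(1)] last_conv_nth[OF es(1)] unfolding n_def by simp_all
  have ne: "vs \<noteq> []" using n by auto
  have hl: "hd vs = vs ! 0" "last vs = vs ! n" using ne n by (auto simp: hd_conv_nth last_conv_nth)
  have le: "last es \<in> set es" using es(1) by simp
  have "ends G (last es) = {vs ! n, vs ! 0}" using vs(4)[of n] e(2) n by simp
  then have pe: "\<pi> (last es) = {hd vs, last vs}" "card {hd vs, last vs} = 2"
    using \<pi> le es(3) hl by (metis insert_commute subsetD)+
  then have neq: "hd vs \<noteq> last vs" by auto
  have sub: "set (butlast es) \<subseteq> set es" by (auto dest: in_set_butlastD)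
  have "path_seq G vs (butlast es)" unfolding path_seq_def
    using vs(2,3) n es(3) sub vs(4) by (auto simp: nth_butlast)
  then have up: "upath (hd vs) (last vs) (set vs) (\<pi> ` set (butlast es))" using path_seq_upath \<pi> by metis
  have "last es \<notin> set (butlast es)" using es(2) e(1) by (metis distinct_append not_distinct_conv_prefix)
  then have "\<pi> (last es) \<notin> \<pi> ` set (butlast es)" using inj sub le by (auto simp: inj_on_def)
  moreover have "\<pi> ` set es = insert (\<pi> (last es)) (\<pi> ` set (butlast es))"
    by (subst e(1)) simp
  ultimately show ?thesis unfolding circ_def using up neq pe(1) by metis
qed

text \<open>The prescribed link \<open>e\<close> is put in the last place, the one singled out by
  the circle lifting property.\<close>

lemma circ_circle_seq:
  assumes C: "circ C" "e \<in> C" and l: "\<And>d. d \<in> C \<Longrightarrow> l d \<in> edges G \<and> ends G (l d) = d" and V: "\<Union>C \<subseteq> verts G"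
  obtains ds where "set (ds @ [e]) = C" "distinct (ds @ [e])" "circle_seq G (map l (ds @ [e]))"
proof -
  obtain a b W D where c: "e = {a, b}" "a \<noteq> b" "upath a b W D" "e \<notin> D" "C = insert e D"
    using circ_edge[OF C] by metis
  obtain vs ds where *: "hd vs = a" "last vs = b" "set vs = W" "set ds = D" "distinct vs" "distinct ds"
     "length vs = Suc (length ds)" "\<forall>i<length ds. ds ! i = {vs ! i, vs ! Suc i}" using upath_list[OF c(3)] by metis
  have s: "set (ds @ [e]) = C" "distinct (ds @ [e])" using * c by auto
  have "a \<in> verts G" using V c(1,5) by auto
  then have W: "W \<subseteq> verts G" using upath_verts[OF c(3)] V c(5) by auto
  have vn: "vs \<noteq> []" using *(7) by auto
  have "inj_on l C" by (rule inj_onI) (metis l)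
  then have "distinct (map l (ds @ [e]))" using s by (simp add: distinct_map del: map_append set_append)
  moreover have "ends G (map l (ds @ [e]) ! i) = {vs ! i, vs ! (Suc i mod length (map l (ds @ [e])))}"
    if i: "i < length (map l (ds @ [e]))" for i
  proof (cases "i < length ds")
    case True
    then have "ds ! i \<in> C" using s(1) by auto
    then show ?thesis using True *(8) l by (simp add: nth_append)
  next
    case False
    then have "i = length ds" using i by simp
    moreover have "vs ! 0 = a" "vs ! length ds = b" using *(1,2,7) vn by (auto simp: hd_conv_nth last_conv_nth)
    ultimately show ?thesis using l[OF C(2)] c(1) by (simp add: nth_append insert_commute)
  qed
  moreover have "set (map l (ds @ [e])) \<subseteq> edges G" using l unfolding set_map s(1) by auto
  ultimately have "circle_seq G (map l (ds @ [e]))" unfolding circle_seq_def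
    using *(3,5,7) W by (intro conjI exI[of _ vs]) auto
  then show thesis using that s by metis
qed

text \<open>Two edges of the cyclic sequence with equal ends are successors of each other, which is
  possible only in length 2.\<close>

lemma circle_seq_parallel:
  assumes c: "circle_seq G es" and fg: "f \<in> set es" "g \<in> set es" "f \<noteq> g" "ends G f = ends G g"
  shows "set es = {f, g}"
proof -
  have "set es = {f, g}"
    if ij: "i < j" "j < length es" "f = es ! i" "g = es ! j" "ends G f = ends G g" for i j f g
  proof -
    obtain vs where vs: "length vs = length es" "distinct vs"
      "\<And>i. i < length es \<Longrightarrow> ends G (es ! i) = {vs ! i, vs ! (Suc i mod length es)}" using c unfolding circle_seq_def by auto
    let ?n = "length es"
    have "0 < ?n" using ij by linarith
    then have lt: "Suc i mod ?n < ?n" "Suc j mod ?n < ?n" by simp_all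
    have "vs ! i \<noteq> vs ! j" using vs(1,2) ij by (simp add: nth_eq_iff_index_eq)
    moreover have "{vs ! i, vs ! (Suc i mod ?n)} = {vs ! j, vs ! (Suc j mod ?n)}" using vs(3) ij by auto
    ultimately have "vs ! i = vs ! (Suc j mod ?n)" "vs ! (Suc i mod ?n) = vs ! j" by (auto simp: doubleton_eq_iff)
    then have "i = Suc j mod ?n" "j = Suc i mod ?n" using vs(1,2) ij lt by (simp_all add: nth_eq_iff_index_eq)
    moreover have "Suc i mod ?n = Suc i" using ij by simp
    ultimately have j: "j = Suc i" "i = Suc j mod ?n" by auto
    have "Suc j = ?n"
    proof (rule ccontr)
      assume "Suc j \<noteq> ?n"
      then have "Suc j mod ?n = Suc j" using ij by simp
      then show False using j by linarith
    qed
    moreover from this have "i = 0" using j(2) by simp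
    ultimately have "i = 0" "j = 1" "?n = 2" using j(1) by simp_all
    then have "es = [es ! 0, es ! 1]" by (metis (no_types, lifting) One_nat_def Suc_1 length_0_conv length_Suc_conv nth_Cons_0 nth_Cons_Suc)
    then show ?thesis using ij(3,4) \<open>i = 0\<close> \<open>j = 1\<close> by (metis empty_set list.simps(15))
  qed
  note key = this
  obtain i j where ij: "i < length es" "j < length es" "f = es ! i" "g = es ! j" using fg by (metis in_set_conv_nth)
  then have "i \<noteq> j" using fg(3) by auto
  then consider "i < j" | "j < i" by linarith
  then show ?thesis
  proof cases
    case 1 then show ?thesis using key ij fg(4) by metis
  next
    case 2 then show ?thesis using key[of j i g f] ij fg(4) by auto
  qed
qed

section \<open>The biased graph formed by labelled links\<close>

definition link_graph :: "'v set \<Rightarrow> 'v set set \<Rightarrow> ('v, 'v set) mgraph" where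
  "link_graph V E = \<lparr>verts = V, edges = E, ends = (\<lambda>e. e)\<rparr>"

definition link_set :: "'v set \<Rightarrow> 'v set set \<Rightarrow> bool" where
  "link_set V E \<longleftrightarrow> (\<forall>e\<in>E. e \<subseteq> V \<and> card e = 2)"

lemma link_graph_simps [simp]: "verts (link_graph V E) = V" "edges (link_graph V E) = E" "ends (link_graph V E) = (\<lambda>e. e)"
  by (simp_all add: link_graph_def)

lemma simple_graph_link_graph:
  "simple_graph \<Delta> \<Longrightarrow> \<Delta> = link_graph (verts \<Delta>) (edges \<Delta>) \<and> link_set (verts \<Delta>) (edges \<Delta>)"
  unfolding simple_graph_def link_graph_def link_set_def wf_graph_def by (cases \<Delta>) auto

lemma simple_link_graph: "link_set V E \<Longrightarrow> simple_graph (link_graph V E)"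
  unfolding simple_graph_def link_set_def wf_graph_def by auto

lemma link_set_Union: "link_set V E \<Longrightarrow> \<Union>E \<subseteq> V"
  unfolding link_set_def by auto

definition section_lift where "section_lift s C = (\<lambda>e. (e, s e)) ` C"

text \<open>With the edges of \<Omega> as labels this has just the edge type prescribed in
  \<open>extends_to\<close>.\<close>

definition section_graph :: "'v set \<Rightarrow> 'v set set \<Rightarrow> ('v set \<Rightarrow> 'k set) \<Rightarrow> ('v set set \<Rightarrow> ('v set \<Rightarrow> 'k) \<Rightarrow> bool) \<Rightarrow>
  ('v, 'v set \<times> 'k) biased_graph" where
  "section_graph V E K b = \<lparr>verts = V, edges = {(e, k). e \<in> E \<and> k \<in> K e}, ends = fst,
     balanced = {section_lift s C |s C. circ C \<and> C \<subseteq> E \<and> (\<forall>d\<in>C. s d \<in> K d) \<and> b C s}\<rparr>"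

lemma section_graph_simps [simp]: "verts (section_graph V E K b) = V" "edges (section_graph V E K b) = {(e, k). e \<in> E \<and> k \<in> K e}"
  "ends (section_graph V E K b) = fst"
  "balanced (section_graph V E K b) = {section_lift s C |s C. circ C \<and> C \<subseteq> E \<and> (\<forall>d\<in>C. s d \<in> K d) \<and> b C s}"
  by (simp_all add: section_graph_def)

lemma fst_section_lift: "fst ` section_lift s C = C"
  by (force simp: section_lift_def)

lemma section_lift_eq_iff: "section_lift s C = section_lift t D \<longleftrightarrow> C = D \<and> (\<forall>d\<in>C. s d = t d)"
proof
  assume eq: "section_lift s C = section_lift t D"
  then have "C = D" using fst_section_lift by metis
  moreover have "s d = t d" if "d \<in> C" for d
  proof -
    have "(d, s d) \<in> section_lift t D" unfolding eq[symmetric] using that by (auto simp: section_lift_def)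
    then show ?thesis by (auto simp: section_lift_def)
  qed
  ultimately show "C = D \<and> (\<forall>d\<in>C. s d = t d)" by simp
qed (auto simp: section_lift_def)

text \<open>If two of the three paths are parallel links, \<open>T\<close> does not project to a
  theta, and unique lifting allows at most one balanced circle in it. Otherwise \<open>T\<close> is
  the lift of a theta by a single section, and two balanced circles entail a third.\<close>

lemma section_graph_theta_card:
  fixes T :: "('v set \<times> 'k) set"
  assumes b: "bexp K E b" and T: "theta (section_graph V E K b) T"
  shows "card {C \<in> balanced (section_graph V E K b). C \<subseteq> T} \<noteq> 2"
proof
  let ?B = "{C \<in> balanced (section_graph V E K b). C \<subseteq> T}"
  assume c2: "card ?B = 2"
  obtain C1 C2 where C12: "?B = {C1, C2}" "C1 \<noteq> C2" using c2 by (auto simp: card_2_iff)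
  obtain u v vs1 es1 vs2 es2 vs3 es3 where uv: "u \<noteq> v"
    and p: "path_seq (section_graph V E K b) vs1 es1" "path_seq (section_graph V E K b) vs2 es2" "path_seq (section_graph V E K b) vs3 es3"
    and h: "hd vs1 = u" "last vs1 = v" "hd vs2 = u" "last vs2 = v" "hd vs3 = u" "last vs3 = v"
    and w: "set vs1 \<inter> set vs2 = {u, v}" "set vs1 \<inter> set vs3 = {u, v}" "set vs2 \<inter> set vs3 = {u, v}"
    and d: "set es1 \<inter> set es2 = {}" "set es1 \<inter> set es3 = {}" "set es2 \<inter> set es3 = {}"
    and T: "T = set es1 \<union> set es2 \<union> set es3"
    using T unfolding theta_def by auto
  define D1 D2 D3 where "D1 = fst ` set es1" and "D2 = fst ` set es2" and "D3 = fst ` set es3"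
  have u1: "upath u v (set vs1) D1" "inj_on fst (set es1)" and u2: "upath u v (set vs2) D2" "inj_on fst (set es2)"
    and u3: "upath u v (set vs3) D3" "inj_on fst (set es3)"
    using path_seq_upath[OF p(1), of fst] path_seq_upath[OF p(2), of fst] path_seq_upath[OF p(3), of fst] h
    unfolding D1_def D2_def D3_def by auto
  have fT: "fst ` T = D1 \<union> D2 \<union> D3" unfolding T D1_def D2_def D3_def by auto
  have TE: "T \<subseteq> {(e, k). e \<in> E \<and> k \<in> K e}" using p unfolding T path_seq_def by auto
  have DE: "D1 \<union> D2 \<union> D3 \<subseteq> E" unfolding fT[symmetric] using TE by auto
  have "C1 \<in> ?B" "C2 \<in> ?B" using C12(1) by auto
  then obtain s1 c1 s2 c2 where c: "C1 = section_lift s1 c1" "circ c1" "c1 \<subseteq> E" "\<forall>d\<in>c1. s1 d \<in> K d" "b c1 s1" "C1 \<subseteq> T"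
    "C2 = section_lift s2 c2" "circ c2" "c2 \<subseteq> E" "\<forall>d\<in>c2. s2 d \<in> K d" "b c2 s2" "C2 \<subseteq> T" by auto
  have cT: "c1 \<subseteq> D1 \<union> D2 \<union> D3" "c2 \<subseteq> D1 \<union> D2 \<union> D3"
    unfolding fT[symmetric] using image_mono[OF c(6), of fst] image_mono[OF c(12), of fst]
    unfolding c(1,7) fst_section_lift by simp_all
  \<comment> \<open>Paths with a common projected link are both single edges over
    \<open>{u, v}\<close>. Every balanced circle in \<open>T\<close> then covers the circle formed
    by this link and the third path and has the labels of that path, so its label over
    \<open>{u, v}\<close> is forced.\<close>
  have parallel: False
    if T: "T = A \<union> A' \<union> B" and AA: "fst ` A \<inter> fst ` A' \<noteq> {}" and inj: "inj_on fst B"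
      and A: "upath u v W (fst ` A)" "upath u v W' (fst ` A')" "upath u v W'' (fst ` B)"
      and W: "W \<inter> W' = {u, v}" "W \<inter> W'' = {u, v}" for A A' B W W' W''
  proof -
    obtain d0 where "d0 \<in> fst ` A \<inter> fst ` A'" using AA by blast
    from upath_meet[OF A(1,2) W(1) this] have eq: "fst ` A = {{u, v}}" "fst ` A' = {{u, v}}" by auto
    let ?e = "{u, v}"
    have fT': "D1 \<union> D2 \<union> D3 = insert ?e (fst ` B)" unfolding fT[symmetric] T using eq by (simp add: image_Un)
    have two: "\<exists>d\<in>C. d \<noteq> ?e" if C: "circ C" for C
    proof -
      have "C \<noteq> {}" using C unfolding circ_def by blast
      then obtain e' where e': "e' \<in> C" by blast
      then obtain x where "x \<in> e'" using circ_card2[OF C e'] by (metis card.empty equals0I zero_neq_numeral)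
      with e' show ?thesis using circ_degree[OF C] by metis
    qed
    \<comment> \<open>Three parallel edges would project to one link, which contains no
      circle.\<close>
    have eB: "?e \<notin> fst ` B"
    proof
      assume "?e \<in> fst ` B"
      then have "fst ` B = {?e}" using upath_direct[OF A(3)] by simp
      then have "c1 \<subseteq> {?e}" using cT(1) fT' by simp
      then show False using two[OF c(2)] by auto
    qed
    have cc: "circ (insert ?e (fst ` B))" using A(3) uv eB unfolding circ_def by auto
    have c12: "c1 = insert ?e (fst ` B)" "c2 = insert ?e (fst ` B)"
      using circ_subset_circ[OF c(2) cc] circ_subset_circ[OF c(8) cc] cT fT' by auto
    have on: "s1 d = s2 d" if "d \<in> fst ` B" for d
    proof -
      have "d \<noteq> ?e" using that eB by auto
      have "(d, s1 d) \<in> T" "(d, s2 d) \<in> T" using c(1,6,7,12) c12 that by (auto simp: section_lift_def)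
      moreover have "(d, k) \<in> B" if "(d, k) \<in> T" for k
      proof -
        have "d \<notin> fst ` A" "d \<notin> fst ` A'" using \<open>d \<noteq> ?e\<close> eq by auto
        then show ?thesis using that T by force
      qed
      ultimately have "(d, s1 d) \<in> B" "(d, s2 d) \<in> B" by auto
      then show ?thesis using inj_onD[OF inj, of "(d, s1 d)" "(d, s2 d)"] by simp
    qed
    have E: "insert ?e (fst ` B) \<subseteq> E" using c(3) c12 by simp
    have s1K: "s1 d \<in> K d" if "d \<in> insert ?e (fst ` B) - {?e}" for d using that c(4) c12 by auto
    have "b (insert ?e (fst ` B)) (s1(?e := s2 ?e)) = b c2 s2"
      unfolding c12(2) by (rule theta_prop_cong[OF bexp_theta_prop[OF b]]) (use on in auto)
    moreover have "b (insert ?e (fst ` B)) (s1(?e := s1 ?e))" using c(5) c12 by simp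
    moreover have "s1 ?e \<in> K ?e" "s2 ?e \<in> K ?e" using c(4,10) c12 by auto
    ultimately have "s1 ?e = s2 ?e" using bexp_lift[OF b cc E _ s1K, of ?e] c(11) by blast
    then have "section_lift s1 c1 = section_lift s2 c2" unfolding section_lift_eq_iff using c12 on by auto
    then show False using C12(2) c(1,7) by simp
  qed
  have i12: "D1 \<inter> D2 = {}"
    using parallel[of "set es1" "set es2" "set es3" "set vs1" "set vs2" "set vs3"] T u1 u2 u3 w
    unfolding D1_def D2_def D3_def by blast
  have i13: "D1 \<inter> D3 = {}"
    using parallel[of "set es1" "set es3" "set es2" "set vs1" "set vs3" "set vs2"] T u1 u2 u3 w
    unfolding D1_def D2_def D3_def by blast
  have i23: "D2 \<inter> D3 = {}"
    using parallel[of "set es2" "set es3" "set es1" "set vs2" "set vs3" "set vs1"] T u1 u2 u3 w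
    unfolding D1_def D2_def D3_def by blast
  have th: "utheta u v (set vs1) D1 (set vs2) D2 (set vs3) D3"
    unfolding utheta_def using uv u1 u2 u3 w i12 i13 i23 by simp
  have inj_Un: "inj_on fst (A \<union> B)" if "inj_on fst A" "inj_on fst B" "fst ` A \<inter> fst ` B = {}"
    for A B :: "('v set \<times> 'k) set"
    unfolding inj_on_Un using that by blast
  have "inj_on fst (set es1 \<union> set es2)"
    using inj_Un[OF u1(2) u2(2)] i12 unfolding D1_def D2_def .
  moreover have "fst ` (set es1 \<union> set es2) \<inter> fst ` set es3 = {}"
    using i13 i23 unfolding image_Un D1_def D2_def D3_def Int_Un_distrib2 by simp
  ultimately have injT: "inj_on fst T" unfolding T using inj_Un u3(2) by metis
  \<comment> \<open>As \<open>T\<close> is projected injectively, its edges form a section over the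
    theta.\<close>
  define s where "s d = snd (inv_into T fst d)" for d
  have s: "(d, s d) \<in> T" if "d \<in> D1 \<union> D2 \<union> D3" for d
  proof -
    have "inv_into T fst d \<in> T" "fst (inv_into T fst d) = d"
      using that fT by (auto intro: inv_into_into simp: f_inv_into_f)
    then show ?thesis unfolding s_def by (metis prod.collapse)
  qed
  have st: "k = s d" if "(d, k) \<in> T" for d k
  proof -
    have "d \<in> fst ` T" using that by force
    then have "(d, s d) \<in> T" using s fT by metis
    then show ?thesis using inj_onD[OF injT, of "(d, k)" "(d, s d)"] that by simp
  qed
  have sK: "s d \<in> K d" if "d \<in> D1 \<union> D2 \<union> D3" for d using s[OF that] TE by auto
  have ss: "C = section_lift s c" if "C = section_lift t c" "C \<subseteq> T" for C t c
    unfolding that(1) section_lift_eq_iff using st that by (auto simp: section_lift_def)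
  have bs: "b c s = b c t" if "section_lift t c \<subseteq> T" for t c
    by (rule theta_prop_cong[OF bexp_theta_prop[OF b]]) (use st that in \<open>auto simp: section_lift_def\<close>)
  have inB: "section_lift s C \<in> ?B" if "circ C" "C \<subseteq> D1 \<union> D2 \<union> D3" "b C s" for C
  proof -
    have "section_lift s C \<subseteq> T" using s that(2) by (auto simp: section_lift_def)
    moreover have "\<forall>d\<in>C. s d \<in> K d" "C \<subseteq> E" using sK that(2) DE by auto
    ultimately show ?thesis using that(1,3) by auto
  qed
  have b12: "b c1 s" "b c2 s" using bs c by auto
  have ne: "c1 \<noteq> c2" using C12(2) ss c(1,6,7,12) by metis
  have two: "two_of_three (b (D1 \<union> D2) s) (b (D1 \<union> D3) s) (b (D2 \<union> D3) s)"
    unfolding two_of_three_def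
    using theta_prop_theta[where s = s, OF bexp_theta_prop[OF b] th DE sK] theta_prop_iff[where s = s, OF bexp_theta_prop[OF b] th DE sK] by blast
  \<comment> \<open>Two different balanced circles in \<open>T\<close> are lifts of two of the three
    circles, so all three lifts are balanced; three distinct sets do not fit into
    \<open>{C1, C2}\<close>.\<close>
  have all: "b (D1 \<union> D2) s" "b (D1 \<union> D3) s" "b (D2 \<union> D3) s"
    using utheta_circles[OF th c(2) cT(1)] utheta_circles[OF th c(8) cT(2)] ne b12 two unfolding two_of_three_def by metis+
  have "section_lift s (D1 \<union> D2) \<in> {C1, C2}" "section_lift s (D1 \<union> D3) \<in> {C1, C2}" "section_lift s (D2 \<union> D3) \<in> {C1, C2}"
    unfolding C12(1)[symmetric]
    using inB[OF utheta_circ(1)[OF th] _ all(1)] inB[OF utheta_circ(2)[OF th] _ all(2)]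
      inB[OF utheta_circ(3)[OF th] _ all(3)] by blast+
  then have "section_lift s (D1 \<union> D2) = section_lift s (D1 \<union> D3) \<or> section_lift s (D1 \<union> D2) = section_lift s (D2 \<union> D3) \<or> section_lift s (D1 \<union> D3) = section_lift s (D2 \<union> D3)"
    by auto
  moreover have "D1 \<noteq> {}" "D2 \<noteq> {}" "D3 \<noteq> {}" using upath_nonempty[OF _ uv] u1 u2 u3 by auto
  ultimately show False unfolding section_lift_eq_iff using i12 i13 i23 by auto
qed

text \<open>A section has one edge over each link, so no digon is balanced. For circle lifting the
  given edges are read as a section, and the candidates for the last edge as its values at
  \<open>e\<close>.\<close>

lemma section_graph_biased_expansion:
  assumes b: "bexp K E b" and E: "link_set V E" and ne: "\<And>e. e \<in> E \<Longrightarrow> K e \<noteq> {}"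
  shows "biased_expansion (section_graph V E K b) fst (link_graph V E)"
proof -
  let ?O = "section_graph V E K b"
  have wf: "wf_graph ?O" "wf_graph (link_graph V E)" using E unfolding wf_graph_def link_set_def by auto
  have "C \<in> circles ?O" if "C \<in> balanced ?O" for C
  proof -
    obtain s D where D: "C = section_lift s D" "circ D" "D \<subseteq> E" "\<forall>d\<in>D. s d \<in> K d" using \<open>C \<in> balanced ?O\<close> by auto
    obtain e where e: "e \<in> D" using D(2) unfolding circ_def by auto
    obtain ds where ds: "set (ds @ [e]) = D" "circle_seq ?O (map (\<lambda>e. (e, s e)) (ds @ [e]))"
    proof (rule circ_circle_seq[OF D(2) e, of "\<lambda>e. (e, s e)" ?O])
      show "\<And>d. d \<in> D \<Longrightarrow> (d, s d) \<in> edges ?O \<and> ends ?O (d, s d) = d" using D(3,4) by auto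
      show "\<Union>D \<subseteq> verts ?O" using D(3) link_set_Union[OF E] by auto
    qed
    have "C = set (map (\<lambda>e. (e, s e)) (ds @ [e]))" unfolding D(1) section_lift_def ds(1)[symmetric] set_map by simp
    then show ?thesis unfolding circles_def using ds(2) by blast
  qed
  then have bg: "is_biased_graph ?O" unfolding is_biased_graph_def using wf section_graph_theta_card[OF b, of V] by blast
  have digon: "{f, g} \<notin> balanced ?O" if "f \<noteq> g" "fst f = fst g" for f g
  proof
    assume "{f, g} \<in> balanced ?O"
    then obtain s D where "{f, g} = section_lift s D" by auto
    then have "f \<in> section_lift s D" "g \<in> section_lift s D" by auto
    then show False using that by (auto simp: section_lift_def)
  qed
  have lifting: "\<exists>!f. f \<in> edges ?O \<and> fst f = e \<and> set (fs @ [f]) \<in> balanced ?O"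
    if c: "circle_seq (link_graph V E) (es @ [e])" "set fs \<subseteq> edges ?O" "map fst fs = es" for es e fs
  proof -
    let ?C = "set (es @ [e])"
    have C: "circ ?C" using circle_seq_circ[OF c(1), of "\<lambda>e. e"] E by (auto simp: link_set_def)
    have CE: "?C \<subseteq> E" "distinct (es @ [e])" using c(1) unfolding circle_seq_def by auto
    have inj: "inj_on fst (set fs)" using CE(2) c(3) by (metis distinct_append distinct_map)
    define s where "s d = snd (inv_into (set fs) fst d)" for d
    have s: "s (fst f) = snd f" if "f \<in> set fs" for f unfolding s_def using inv_into_f_f[OF inj that] by simp
    have fs: "set fs = section_lift s (set es)" unfolding c(3)[symmetric] section_lift_def using s by force
    have en: "e \<notin> set es" using CE(2) by simp
    have sK: "s d \<in> K d" if "d \<in> ?C - {e}" for d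
    proof -
      have "d \<in> set es" using that by auto
      then have "(d, s d) \<in> set fs" unfolding fs by (auto simp: section_lift_def)
      then show ?thesis using c(2) by auto
    qed
    have bal: "set (fs @ [(e, k)]) \<in> balanced ?O \<longleftrightarrow> b ?C (s(e := k))" if k: "k \<in> K e" for k
    proof -
      have "section_lift (s(e := k)) (set es) = set fs" unfolding fs section_lift_eq_iff using en by auto
      then have L: "set (fs @ [(e, k)]) = section_lift (s(e := k)) ?C" by (simp add: section_lift_def)
      show ?thesis
      proof
        assume "set (fs @ [(e, k)]) \<in> balanced ?O"
        then obtain t D where t: "section_lift (s(e := k)) ?C = section_lift t D" "b D t" unfolding L by auto
        then have D: "D = ?C" and e1: "\<forall>d\<in>?C. (s(e := k)) d = t d" unfolding section_lift_eq_iff by metis+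
        have "b ?C (s(e := k)) = b ?C t" by (rule theta_prop_cong[OF bexp_theta_prop[OF b]]) (use e1 in blast)
        then show "b ?C (s(e := k))" using t(2) unfolding D by simp
      next
        assume "b ?C (s(e := k))"
        moreover have "\<forall>d\<in>?C. (s(e := k)) d \<in> K d" using sK k by auto
        ultimately show "set (fs @ [(e, k)]) \<in> balanced ?O" unfolding L section_graph_simps using C CE(1) by blast
      qed
    qed
    have "e \<in> ?C" by simp
    from bexp_lift[OF b C CE(1) this sK] have "\<exists>!k. k \<in> K e \<and> b ?C (s(e := k))" by simp
    then obtain k where k: "k \<in> K e" "b ?C (s(e := k))" "\<And>k'. k' \<in> K e \<Longrightarrow> b ?C (s(e := k')) \<Longrightarrow> k' = k" by metis
    show ?thesis
    proof (rule ex1I[of _ "(e, k)"])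
      have "(e, k) \<in> edges ?O" using k(1) CE(1) by simp
      then show "(e, k) \<in> edges ?O \<and> fst (e, k) = e \<and> set (fs @ [(e, k)]) \<in> balanced ?O"
        using k(2) bal[OF k(1)] by (metis fst_conv)
      fix f assume f: "f \<in> edges ?O \<and> fst f = e \<and> set (fs @ [f]) \<in> balanced ?O"
      then have "f \<in> edges ?O" "fst f = e" by blast+
      then obtain k' where k': "f = (e, k')" "k' \<in> K e" by (cases f) auto
      have "b ?C (s(e := k'))" using f bal[OF k'(2)] unfolding k'(1) by blast
      then show "f = (e, k)" using k(3)[OF k'(2)] k'(1) by simp
    qed
  qed
  have fstE: "fst ` edges ?O = edges (link_graph V E)" using ne by force
  have "verts ?O = verts (link_graph V E)" "\<forall>f\<in>edges ?O. ends (link_graph V E) (fst f) = ends ?O f" by auto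
  moreover have "\<forall>f\<in>edges ?O. \<forall>g\<in>edges ?O. f \<noteq> g \<and> fst f = fst g \<longrightarrow> {f, g} \<notin> balanced ?O"
    by (intro ballI impI, elim conjE) (rule digon)
  moreover have "\<forall>es e fs. circle_seq (link_graph V E) (es @ [e]) \<and> set fs \<subseteq> edges ?O \<and> map fst fs = es \<longrightarrow>
        (\<exists>!f. f \<in> edges ?O \<and> fst f = e \<and> set (fs @ [f]) \<in> balanced ?O)"
    by (intro allI impI, elim conjE) (rule lifting)
  ultimately show ?thesis unfolding biased_expansion_def using bg wf(2) fstE by (intro conjI)
qed

subsection \<open>From biased expansions to sections\<close>

definition fibre :: "('v, 'f) biased_graph \<Rightarrow> ('f \<Rightarrow> 'v set) \<Rightarrow> ('f \<Rightarrow> 'k) \<Rightarrow> 'v set set \<Rightarrow> 'v set \<Rightarrow> 'k set" where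
  "fibre \<Omega> p l E e = (if e \<in> E then l ` {f \<in> edges \<Omega>. p f = e} else UNIV)"

definition select :: "('v, 'f) biased_graph \<Rightarrow> ('f \<Rightarrow> 'v set) \<Rightarrow> ('f \<Rightarrow> 'k) \<Rightarrow> ('v set \<Rightarrow> 'k) \<Rightarrow> 'v set set \<Rightarrow> 'f set" where
  "select \<Omega> p l s C = {f \<in> edges \<Omega>. p f \<in> C \<and> l f = s (p f)}"

definition balance :: "('v, 'f) biased_graph \<Rightarrow> ('f \<Rightarrow> 'v set) \<Rightarrow> ('f \<Rightarrow> 'k) \<Rightarrow> 'v set set \<Rightarrow> ('v set \<Rightarrow> 'k) \<Rightarrow> bool" where
  "balance \<Omega> p l C s \<longleftrightarrow> select \<Omega> p l s C \<in> balanced \<Omega>"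

lemma expansion_facts:
  assumes "biased_expansion \<Omega> p (link_graph V E)"
  shows "verts \<Omega> = V" "p ` edges \<Omega> = E" "\<And>f. f \<in> edges \<Omega> \<Longrightarrow> ends \<Omega> f = p f" "is_biased_graph \<Omega>"
    "\<And>C. C \<in> balanced \<Omega> \<Longrightarrow> C \<in> circles \<Omega>" "\<And>C. C \<in> balanced \<Omega> \<Longrightarrow> C \<subseteq> edges \<Omega>"
    "\<And>f g. f \<in> edges \<Omega> \<Longrightarrow> g \<in> edges \<Omega> \<Longrightarrow> f \<noteq> g \<Longrightarrow> p f = p g \<Longrightarrow> {f, g} \<notin> balanced \<Omega>"
    "\<And>es e fs. circle_seq (link_graph V E) (es @ [e]) \<Longrightarrow> set fs \<subseteq> edges \<Omega> \<Longrightarrow> map p fs = es \<Longrightarrow>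
        \<exists>!f. f \<in> edges \<Omega> \<and> p f = e \<and> set (fs @ [f]) \<in> balanced \<Omega>"
proof -
  have b: "is_biased_graph \<Omega>" "verts \<Omega> = verts (link_graph V E)" "p ` edges \<Omega> = edges (link_graph V E)"
    "\<forall>f\<in>edges \<Omega>. ends (link_graph V E) (p f) = ends \<Omega> f"
    "\<forall>f\<in>edges \<Omega>. \<forall>g\<in>edges \<Omega>. f \<noteq> g \<and> p f = p g \<longrightarrow> {f, g} \<notin> balanced \<Omega>"
    "\<forall>es e fs. circle_seq (link_graph V E) (es @ [e]) \<and> set fs \<subseteq> edges \<Omega> \<and> map p fs = es \<longrightarrow>
        (\<exists>!f. f \<in> edges \<Omega> \<and> p f = e \<and> set (fs @ [f]) \<in> balanced \<Omega>)"
    using assms unfolding biased_expansion_def by - (elim conjE, assumption)+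
  show "verts \<Omega> = V" "p ` edges \<Omega> = E" "\<And>f. f \<in> edges \<Omega> \<Longrightarrow> ends \<Omega> f = p f" "is_biased_graph \<Omega>"
    using b(1-4) by simp_all
  show c: "\<And>C. C \<in> balanced \<Omega> \<Longrightarrow> C \<in> circles \<Omega>" using \<open>is_biased_graph \<Omega>\<close> unfolding is_biased_graph_def by blast
  show "\<And>C. C \<in> balanced \<Omega> \<Longrightarrow> C \<subseteq> edges \<Omega>" using c unfolding circles_def circle_seq_def by blast
  show "\<And>f g. f \<in> edges \<Omega> \<Longrightarrow> g \<in> edges \<Omega> \<Longrightarrow> f \<noteq> g \<Longrightarrow> p f = p g \<Longrightarrow> {f, g} \<notin> balanced \<Omega>"
    using b(5) by simp
  show "\<And>es e fs. circle_seq (link_graph V E) (es @ [e]) \<Longrightarrow> set fs \<subseteq> edges \<Omega> \<Longrightarrow> map p fs = es \<Longrightarrow>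
        \<exists>!f. f \<in> edges \<Omega> \<and> p f = e \<and> set (fs @ [f]) \<in> balanced \<Omega>"
    by (rule b(6)[rule_format], intro conjI)
qed

lemma thetaI:
  assumes "u \<noteq> v" "path_seq G vs1 es1" "hd vs1 = u" "last vs1 = v" "path_seq G vs2 es2" "hd vs2 = u" "last vs2 = v"
    "path_seq G vs3 es3" "hd vs3 = u" "last vs3 = v"
    "set vs1 \<inter> set vs2 = {u, v}" "set vs1 \<inter> set vs3 = {u, v}" "set vs2 \<inter> set vs3 = {u, v}"
    "set es1 \<inter> set es2 = {}" "set es1 \<inter> set es3 = {}" "set es2 \<inter> set es3 = {}"
  shows "theta G (set es1 \<union> set es2 \<union> set es3)"
  unfolding theta_def
  by (intro exI[of _ u] exI[of _ v] exI[of _ vs1] exI[of _ es1] exI[of _ vs2] exI[of _ es2] exI[of _ vs3] exI[of _ es3])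
    (simp add: assms)

text \<open>\<open>l\<close> names the edges within each fibre. It is the identity when edges are
  their own labels, and a map to the edges of the smaller expansion when an extension is
  encoded.\<close>

locale labelled_expansion =
  fixes \<Omega> :: "('v, 'f) biased_graph" and p :: "'f \<Rightarrow> 'v set" and l :: "'f \<Rightarrow> 'k" and V :: "'v set" and E
  assumes expansion: "biased_expansion \<Omega> p (link_graph V E)" and links: "link_set V E"
    and inj: "inj_on (\<lambda>f. (p f, l f)) (edges \<Omega>)"
begin

abbreviation "K \<equiv> fibre \<Omega> p l E"

lemmas facts = expansion_facts[OF expansion]

definition "edge_at s d = (SOME f. f \<in> edges \<Omega> \<and> p f = d \<and> l f = s d)"

lemma edge_at:
  assumes "d \<in> E" "s d \<in> K d"
  shows "edge_at s d \<in> edges \<Omega>" "p (edge_at s d) = d" "l (edge_at s d) = s d"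
proof -
  have "\<exists>f. f \<in> edges \<Omega> \<and> p f = d \<and> l f = s d" using assms unfolding fibre_def by auto
  from someI_ex[OF this] show "edge_at s d \<in> edges \<Omega>" "p (edge_at s d) = d" "l (edge_at s d) = s d"
    unfolding edge_at_def by auto
qed

lemma p_in: "f \<in> edges \<Omega> \<Longrightarrow> p f \<in> E" using facts(2) by auto

lemma l_in: "f \<in> edges \<Omega> \<Longrightarrow> l f \<in> K (p f)" using p_in unfolding fibre_def by auto

lemma edge_at_eq:
  assumes "f \<in> edges \<Omega>" "l f = s (p f)"
  shows "edge_at s (p f) = f"
proof -
  have "s (p f) \<in> K (p f)" using l_in[OF assms(1)] assms(2) by simp
  note * = edge_at[where s = s, OF p_in[OF assms(1)] this]
  show ?thesis using inj_onD[OF inj, of "edge_at s (p f)" f] * assms by simp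
qed

lemma select_image:
  assumes "C \<subseteq> E" "\<And>d. d \<in> C \<Longrightarrow> s d \<in> K d"
  shows "select \<Omega> p l s C = edge_at s ` C"
proof
  show "select \<Omega> p l s C \<subseteq> edge_at s ` C"
  proof
    fix f assume "f \<in> select \<Omega> p l s C"
    then have "f \<in> edges \<Omega>" "p f \<in> C" "l f = s (p f)" unfolding select_def by auto
    then show "f \<in> edge_at s ` C" using edge_at_eq by (metis imageI)
  qed
  show "edge_at s ` C \<subseteq> select \<Omega> p l s C"
  proof
    fix f assume "f \<in> edge_at s ` C"
    then obtain d where d: "d \<in> C" "f = edge_at s d" by auto
    then show "f \<in> select \<Omega> p l s C" using edge_at[of d s] assms unfolding select_def by auto
  qed
qed

text \<open>Two parallel edges would make the circle a digon in one fibre, and such a digon is not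
  balanced.\<close>

lemma balanced_circ:
  assumes "C \<in> balanced \<Omega>"
  shows "inj_on p C" "circ (p ` C)"
proof -
  obtain es where es: "circle_seq \<Omega> es" "C = set es" using facts(5)[OF assms] unfolding circles_def by auto
  have CE: "C \<subseteq> edges \<Omega>" using facts(6)[OF assms] .
  show i: "inj_on p C"
  proof (rule inj_onI, rule ccontr)
    fix f g assume fg: "f \<in> C" "g \<in> C" "p f = p g" "f \<noteq> g"
    have fgE: "f \<in> edges \<Omega>" "g \<in> edges \<Omega>" using fg CE by auto
    then have "ends \<Omega> f = ends \<Omega> g" using facts(3) fg(3) by simp
    then have "C = {f, g}" using circle_seq_parallel[OF es(1)] fg es(2) by metis
    then show False using facts(7)[OF fgE fg(4,3)] assms by simp
  qed
  have "ends \<Omega> f = p f \<and> card (p f) = 2" if "f \<in> edges \<Omega>" for f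
    using facts(3)[OF that] p_in[OF that] links unfolding link_set_def by auto
  from circle_seq_circ[OF es(1) this] i es(2) show "circ (p ` C)" by simp
qed

lemma K_ne: "K d \<noteq> {}"
  using facts(2) unfolding fibre_def by auto

text \<open>For the theta property, the theta is lifted by \<open>s\<close>. A balanced circle in
  the lift projects to one of the three circles of the theta; were the third lift unbalanced,
  exactly two circles would be balanced.\<close>

lemma bexp: "bexp K E (balance \<Omega> p l)"
proof (rule bexpI[OF K_ne])
  fix C :: "'v set set" and s t :: "'v set \<Rightarrow> 'k" assume "\<And>e. e \<in> C \<Longrightarrow> s e = t e"
  then have "select \<Omega> p l s C = select \<Omega> p l t C" unfolding select_def by auto
  then show "balance \<Omega> p l C s = balance \<Omega> p l C t" unfolding balance_def by simp
next
  fix C e and s :: "'v set \<Rightarrow> 'k" assume C: "circ C" "C \<subseteq> E" "e \<in> C" and s: "\<And>d. s d \<in> K d"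
  have "\<Union>C \<subseteq> V" using C(2) link_set_Union[OF links] by auto
  moreover have "\<And>d. d \<in> C \<Longrightarrow> d \<in> edges (link_graph V E) \<and> ends (link_graph V E) d = d" using C(2) by auto
  ultimately obtain ds where ds: "set (ds @ [e]) = C" "distinct (ds @ [e])" "circle_seq (link_graph V E) (ds @ [e])"
    using circ_circle_seq[OF C(1,3), of "\<lambda>d. d" "link_graph V E"] unfolding list.map_ident link_graph_simps by metis
  define fs where "fs = map (edge_at s) ds"
  have dsE: "\<And>d. d \<in> set ds \<Longrightarrow> d \<in> E" using ds(1) C(2) by auto
  have fs: "set fs \<subseteq> edges \<Omega>" "map p fs = ds"
    unfolding fs_def using edge_at[where s = s, OF dsE s] by (auto simp: map_idI)
  have eE: "e \<in> E" using C by auto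
  have sel: "set (fs @ [f]) = select \<Omega> p l (s(e := l f)) C" if f: "f \<in> edges \<Omega>" "p f = e" for f
  proof -
    have "(s(e := l f)) d \<in> K d" for d using s l_in[OF f(1)] f(2) by auto
    then have "select \<Omega> p l (s(e := l f)) C = edge_at (s(e := l f)) ` C" using select_image[OF C(2)] by metis
    moreover have "edge_at (s(e := l f)) d = edge_at s d" if "d \<in> set ds" for d
      using that ds(2) unfolding edge_at_def by auto
    moreover have "edge_at (s(e := l f)) e = f" using edge_at_eq[OF f(1), of "s(e := l f)"] f(2) by simp
    ultimately show ?thesis unfolding ds(1)[symmetric] fs_def by auto
  qed
  obtain f where f: "f \<in> edges \<Omega>" "p f = e" "set (fs @ [f]) \<in> balanced \<Omega>"
    and f': "\<And>g. g \<in> edges \<Omega> \<Longrightarrow> p g = e \<Longrightarrow> set (fs @ [g]) \<in> balanced \<Omega> \<Longrightarrow> g = f"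
    using facts(8)[OF ds(3) fs] by metis
  show "\<exists>!k. k \<in> K e \<and> balance \<Omega> p l C (s(e := k))"
  proof (rule ex1I[of _ "l f"])
    show "l f \<in> K e \<and> balance \<Omega> p l C (s(e := l f))"
      using l_in[OF f(1)] f(2,3) sel[OF f(1,2)] unfolding balance_def by simp
    fix k assume k: "k \<in> K e \<and> balance \<Omega> p l C (s(e := k))"
    then obtain g where g: "g \<in> edges \<Omega>" "p g = e" "k = l g" using eE unfolding fibre_def by auto
    then have "set (fs @ [g]) \<in> balanced \<Omega>" using k sel[OF g(1,2)] unfolding balance_def by metis
    then show "k = l f" using f'[OF g(1,2)] g(3) by simp
  qed
next
  fix x y W1 D1 W2 D2 W3 D3 and s :: "'v set \<Rightarrow> 'k"
  assume th: "utheta x y W1 D1 W2 D2 W3 D3" and sub: "D1 \<union> D2 \<union> D3 \<subseteq> E" and s: "\<And>d. s d \<in> K d"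
    and b: "balance \<Omega> p l (D1 \<union> D2) s" "balance \<Omega> p l (D1 \<union> D3) s"
  let ?l = "edge_at s"
  have P: "upath x y W1 D1" "upath x y W2 D2" "upath x y W3 D3" "x \<noteq> y"
    "W1 \<inter> W2 = {x, y}" "W1 \<inter> W3 = {x, y}" "W2 \<inter> W3 = {x, y}" "D1 \<inter> D2 = {}" "D1 \<inter> D3 = {}" "D2 \<inter> D3 = {}"
    using th by (auto simp: utheta_def)
  have el: "?l d \<in> edges \<Omega>" "p (?l d) = d" "ends \<Omega> (?l d) = d" if "d \<in> E" for d
    using edge_at[where s = s, OF that s] facts(3) by auto
  have ps: "\<exists>vs es. path_seq \<Omega> vs es \<and> hd vs = x \<and> last vs = y \<and> set vs = W \<and> set es = ?l ` D"
    if W: "upath x y W D" "D \<subseteq> E" for W D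
  proof -
    have "\<Union>D \<subseteq> V" using W(2) link_set_Union[OF links] by auto
    moreover obtain d where "d \<in> D" "x \<in> d" using upath_edge_at[OF W(1) P(4)] by metis
    ultimately have "W \<subseteq> verts \<Omega>" using upath_verts[OF W(1)] facts(1) by auto
    from upath_path_seq[OF W(1) _ this, of ?l] el W(2) show ?thesis by (metis subsetD)
  qed
  have DE: "D1 \<subseteq> E" "D2 \<subseteq> E" "D3 \<subseteq> E" using sub by auto
  obtain vs1 es1 where 1: "path_seq \<Omega> vs1 es1" "hd vs1 = x" "last vs1 = y" "set vs1 = W1" "set es1 = ?l ` D1"
    using ps[OF P(1) DE(1)] by metis
  obtain vs2 es2 where 2: "path_seq \<Omega> vs2 es2" "hd vs2 = x" "last vs2 = y" "set vs2 = W2" "set es2 = ?l ` D2"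
    using ps[OF P(2) DE(2)] by metis
  obtain vs3 es3 where 3: "path_seq \<Omega> vs3 es3" "hd vs3 = x" "last vs3 = y" "set vs3 = W3" "set es3 = ?l ` D3"
    using ps[OF P(3) DE(3)] by metis
  have injl: "inj_on ?l E" by (rule inj_onI) (metis el(2))
  have disj: "?l ` A \<inter> ?l ` B = {}" if "A \<subseteq> E" "B \<subseteq> E" "A \<inter> B = {}" for A B
    using inj_on_image_Int[OF injl that(1,2)] that(3) by simp
  let ?T = "?l ` D1 \<union> ?l ` D2 \<union> ?l ` D3"
  have "theta \<Omega> ?T"
    using thetaI[OF P(4) 1(1-3) 2(1-3) 3(1-3)] P(5-7) disj[OF DE(1,2) P(8)] disj[OF DE(1,3) P(9)] disj[OF DE(2,3) P(10)]
    unfolding 1(4,5) 2(4,5) 3(4,5) by metis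
  then have card: "card {C \<in> balanced \<Omega>. C \<subseteq> ?T} \<noteq> 2" using facts(4) unfolding is_biased_graph_def by blast
  have sel: "select \<Omega> p l s C = ?l ` C" if "C \<subseteq> E" for C using select_image[OF that] s by blast
  have DD: "D1 \<union> D2 \<subseteq> E" "D1 \<union> D3 \<subseteq> E" "D2 \<union> D3 \<subseteq> E" using sub by auto
  have b': "?l ` (D1 \<union> D2) \<in> balanced \<Omega>" "?l ` (D1 \<union> D3) \<in> balanced \<Omega>"
    using b unfolding balance_def sel[OF DD(1)] sel[OF DD(2)] by auto
  show "balance \<Omega> p l (D2 \<union> D3) s"
  proof (rule ccontr)
    assume "\<not> balance \<Omega> p l (D2 \<union> D3) s"
    then have n: "?l ` (D2 \<union> D3) \<notin> balanced \<Omega>" unfolding balance_def sel[OF DD(3)] .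
    have "{C \<in> balanced \<Omega>. C \<subseteq> ?T} = {?l ` (D1 \<union> D2), ?l ` (D1 \<union> D3)}"
    proof
      show "{?l ` (D1 \<union> D2), ?l ` (D1 \<union> D3)} \<subseteq> {C \<in> balanced \<Omega>. C \<subseteq> ?T}" using b' by auto
      show "{C \<in> balanced \<Omega>. C \<subseteq> ?T} \<subseteq> {?l ` (D1 \<union> D2), ?l ` (D1 \<union> D3)}"
      proof
        fix C assume C: "C \<in> {C \<in> balanced \<Omega>. C \<subseteq> ?T}"
        then have "C \<subseteq> ?l ` (D1 \<union> D2 \<union> D3)" by auto
        then obtain D where D: "D \<subseteq> D1 \<union> D2 \<union> D3" "C = ?l ` D" by (metis subset_imageE)
        have "p ` C = (\<lambda>d. d) ` D" unfolding D(2) image_image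
        proof (rule image_cong[OF refl])
          fix d assume "d \<in> D"
          then have "d \<in> E" using D(1) sub by (meson subsetD)
          then show "p (edge_at s d) = d" by (rule el(2))
        qed
        then have "p ` C = D" by simp
        then have "circ D" using balanced_circ(2) C by auto
        then have "D = D1 \<union> D2 \<or> D = D1 \<union> D3 \<or> D = D2 \<union> D3" using utheta_circles[OF th _ D(1)] by simp
        then show "C \<in> {?l ` (D1 \<union> D2), ?l ` (D1 \<union> D3)}" using n C D(2) by auto
      qed
    qed
    moreover have "?l ` (D1 \<union> D2) \<noteq> ?l ` (D1 \<union> D3)"
    proof
      assume "?l ` (D1 \<union> D2) = ?l ` (D1 \<union> D3)"
      then have "D1 \<union> D2 = D1 \<union> D3" using inj_on_image_eq_iff[OF injl DD(1,2)] by simp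
      moreover obtain d where "d \<in> D2" using upath_nonempty[OF P(2,4)] by auto
      ultimately show False using P(8,10) by auto
    qed
    ultimately show False using card by simp
  qed
qed

lemma iso: "expansion_iso (\<lambda>f. (p f, l f)) \<Omega> p (section_graph V E K (balance \<Omega> p l)) fst"
proof -
  let ?i = "\<lambda>f. (p f, l f)" and ?O = "section_graph V E K (balance \<Omega> p l)"
  have "?i ` edges \<Omega> = edges ?O"
  proof
    show "?i ` edges \<Omega> \<subseteq> edges ?O" using p_in l_in by auto
    show "edges ?O \<subseteq> ?i ` edges \<Omega>" unfolding fibre_def by auto
  qed
  then have bij: "bij_betw ?i (edges \<Omega>) (edges ?O)" using inj unfolding bij_betw_def by blast
  have sel_lift: "?i ` select \<Omega> p l s C = section_lift s C" if C: "C \<subseteq> E" "\<And>d. d \<in> C \<Longrightarrow> s d \<in> K d" for s C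
  proof -
    have "?i (edge_at s d) = (d, s d)" if "d \<in> C" for d using edge_at[of d s] C that by auto
    moreover have "select \<Omega> p l s C = edge_at s ` C" using select_image[where s = s, OF C(1)] C(2) by blast
    ultimately show ?thesis unfolding section_lift_def image_image by (simp add: image_image)
  qed
  have "balanced ?O = (`) ?i ` balanced \<Omega>"
  proof
    show "balanced ?O \<subseteq> (`) ?i ` balanced \<Omega>"
    proof
      fix C assume "C \<in> balanced ?O"
      then obtain s D where D: "C = section_lift s D" "circ D" "D \<subseteq> E" "\<And>d. d \<in> D \<Longrightarrow> s d \<in> K d" "balance \<Omega> p l D s" by auto
      have eq: "?i ` select \<Omega> p l s D = section_lift s D" using sel_lift[where s = s, OF D(3)] D(4) by blast
      show "C \<in> (`) ?i ` balanced \<Omega>"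
        using D(5) unfolding D(1) eq[symmetric] balance_def by (rule imageI)
    qed
    show "(`) ?i ` balanced \<Omega> \<subseteq> balanced ?O"
    proof
      fix C' assume "C' \<in> (`) ?i ` balanced \<Omega>"
      then obtain C where C: "C \<in> balanced \<Omega>" "C' = ?i ` C" by auto
      note c = balanced_circ[OF C(1)]
      have CE: "C \<subseteq> edges \<Omega>" using facts(6)[OF C(1)] .
      define s where "s d = l (inv_into C p d)" for d
      have s: "s (p f) = l f" if "f \<in> C" for f unfolding s_def using inv_into_f_f[OF c(1) that] by simp
      have K: "s d \<in> K d" if "d \<in> p ` C" for d using that s l_in CE by auto
      have pE: "p ` C \<subseteq> E" using CE p_in by auto
      have "select \<Omega> p l s (p ` C) = C"
      proof
        show "C \<subseteq> select \<Omega> p l s (p ` C)" unfolding select_def using CE s by auto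
        show "select \<Omega> p l s (p ` C) \<subseteq> C"
        proof
          fix f assume "f \<in> select \<Omega> p l s (p ` C)"
          then obtain g where f: "f \<in> edges \<Omega>" "g \<in> C" "p f = p g" "l f = s (p f)" unfolding select_def by auto
          then have "f = g" using inj_onD[OF inj, of f g] s[OF f(2)] CE by auto
          then show "f \<in> C" using f(2) by simp
        qed
      qed
      then have "C' = section_lift s (p ` C)" "balance \<Omega> p l (p ` C) s"
        using sel_lift[where s = s, OF pE K] C unfolding balance_def by auto
      then show "C' \<in> balanced ?O" unfolding section_graph_simps using c(2) pE K by blast
    qed
  qed
  then show ?thesis unfolding expansion_iso_def using bij facts(1,3) by simp
qed

end

subsection \<open>Extensions\<close>

lemma expansion_iso_trans:
  assumes "expansion_iso \<phi> A p B q" "expansion_iso \<psi> B q C r"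
  shows "expansion_iso (\<psi> \<circ> \<phi>) A p C r"
  unfolding expansion_iso_def
proof (intro conjI ballI)
  have A: "verts A = verts B" "bij_betw \<phi> (edges A) (edges B)" "\<And>f. f \<in> edges A \<Longrightarrow> ends B (\<phi> f) = ends A f \<and> q (\<phi> f) = p f"
    "balanced B = (`) \<phi> ` balanced A" using assms(1) unfolding expansion_iso_def by auto
  have B: "verts B = verts C" "bij_betw \<psi> (edges B) (edges C)" "\<And>f. f \<in> edges B \<Longrightarrow> ends C (\<psi> f) = ends B f \<and> r (\<psi> f) = q f"
    "balanced C = (`) \<psi> ` balanced B" using assms(2) unfolding expansion_iso_def by auto
  show "verts A = verts C" using A(1) B(1) by simp
  show "bij_betw (\<psi> \<circ> \<phi>) (edges A) (edges C)" using bij_betw_trans[OF A(2) B(2)] .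
  show "balanced C = (`) (\<psi> \<circ> \<phi>) ` balanced A" unfolding B(4) A(4) image_image by (simp add: image_comp comp_def)
  fix f assume f: "f \<in> edges A"
  then have "\<phi> f \<in> edges B" using A(2) bij_betwE by metis
  then show "ends C ((\<psi> \<circ> \<phi>) f) = ends A f" "r ((\<psi> \<circ> \<phi>) f) = p f" using A(3)[OF f] B(3)[of "\<phi> f"] by simp_all
qed

lemma expansion_iso_inv:
  assumes i: "expansion_iso \<phi> A p B q" and A: "\<And>C. C \<in> balanced A \<Longrightarrow> C \<subseteq> edges A"
  shows "expansion_iso (inv_into (edges A) \<phi>) B q A p"
  unfolding expansion_iso_def
proof (intro conjI ballI)
  let ?i = "inv_into (edges A) \<phi>"
  have a: "verts A = verts B" "bij_betw \<phi> (edges A) (edges B)" "\<And>f. f \<in> edges A \<Longrightarrow> ends B (\<phi> f) = ends A f \<and> q (\<phi> f) = p f"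
    "balanced B = (`) \<phi> ` balanced A" using i unfolding expansion_iso_def by auto
  show "verts B = verts A" using a(1) by simp
  show "bij_betw ?i (edges B) (edges A)" using bij_betw_inv_into[OF a(2)] .
  have inj: "inj_on \<phi> (edges A)" using a(2) bij_betw_imp_inj_on by auto
  have "?i ` (\<phi> ` C) = C" if "C \<in> balanced A" for C using inv_into_image_cancel[OF inj A[OF that]] .
  then show "balanced A = (`) ?i ` balanced B" unfolding a(4) image_image by simp
  fix f assume f: "f \<in> edges B"
  then have "?i f \<in> edges A" "\<phi> (?i f) = f" using a(2) by (metis bij_betwE bij_betw_inv_into, metis bij_betw_inv_into_right)
  then show "ends A (?i f) = ends B f" "p (?i f) = q f" using a(3)[of "?i f"] by simp_all
qed

lemma preimage_simps [simp]:
  "verts (proj_preimage A p \<Delta>) = verts \<Delta>" "edges (proj_preimage A p \<Delta>) = {f \<in> edges A. p f \<in> edges \<Delta>}"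
  "ends (proj_preimage A p \<Delta>) = ends A"
  "balanced (proj_preimage A p \<Delta>) = {C \<in> balanced A. C \<subseteq> {f \<in> edges A. p f \<in> edges \<Delta>}}"
  by (simp_all add: proj_preimage_def)

lemma expansion_iso_restrict:
  assumes i: "expansion_iso \<phi> A p B q" and A: "\<And>C. C \<in> balanced A \<Longrightarrow> C \<subseteq> edges A"
  shows "expansion_iso \<phi> (proj_preimage A p \<Delta>) p (proj_preimage B q \<Delta>) q"
  unfolding expansion_iso_def
proof (intro conjI ballI)
  have a: "verts A = verts B" "bij_betw \<phi> (edges A) (edges B)" "\<And>f. f \<in> edges A \<Longrightarrow> ends B (\<phi> f) = ends A f \<and> q (\<phi> f) = p f"
    "balanced B = (`) \<phi> ` balanced A" using i unfolding expansion_iso_def by auto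
  have inj: "inj_on \<phi> (edges A)" and im: "\<phi> ` edges A = edges B" using a(2) unfolding bij_betw_def by auto
  have im': "\<phi> ` {f \<in> edges A. p f \<in> edges \<Delta>} = {f \<in> edges B. q f \<in> edges \<Delta>}"
  proof
    show "\<phi> ` {f \<in> edges A. p f \<in> edges \<Delta>} \<subseteq> {f \<in> edges B. q f \<in> edges \<Delta>}" using a(3) im by auto
    show "{f \<in> edges B. q f \<in> edges \<Delta>} \<subseteq> \<phi> ` {f \<in> edges A. p f \<in> edges \<Delta>}"
    proof
      fix g assume g: "g \<in> {f \<in> edges B. q f \<in> edges \<Delta>}"
      then obtain f where "f \<in> edges A" "g = \<phi> f" using im by auto
      then show "g \<in> \<phi> ` {f \<in> edges A. p f \<in> edges \<Delta>}" using g a(3)[of f] by auto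
    qed
  qed
  show "verts (proj_preimage A p \<Delta>) = verts (proj_preimage B q \<Delta>)" by simp
  show "bij_betw \<phi> (edges (proj_preimage A p \<Delta>)) (edges (proj_preimage B q \<Delta>))"
    unfolding bij_betw_def preimage_simps im' using inj by (auto intro: inj_on_subset)
  show "balanced (proj_preimage B q \<Delta>) = (`) \<phi> ` balanced (proj_preimage A p \<Delta>)"
    unfolding preimage_simps a(4)
  proof
    show "(`) \<phi> ` {C \<in> balanced A. C \<subseteq> {f \<in> edges A. p f \<in> edges \<Delta>}} \<subseteq>
      {C \<in> (`) \<phi> ` balanced A. C \<subseteq> {f \<in> edges B. q f \<in> edges \<Delta>}}" unfolding im'[symmetric] by auto
    show "{C \<in> (`) \<phi> ` balanced A. C \<subseteq> {f \<in> edges B. q f \<in> edges \<Delta>}} \<subseteq>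
      (`) \<phi> ` {C \<in> balanced A. C \<subseteq> {f \<in> edges A. p f \<in> edges \<Delta>}}"
    proof
      fix C' assume C': "C' \<in> {C \<in> (`) \<phi> ` balanced A. C \<subseteq> {f \<in> edges B. q f \<in> edges \<Delta>}}"
      then obtain C where C: "C \<in> balanced A" "C' = \<phi> ` C" by auto
      have "C \<subseteq> {f \<in> edges A. p f \<in> edges \<Delta>}"
      proof
        fix f assume f: "f \<in> C"
        then have "f \<in> edges A" "q (\<phi> f) \<in> edges \<Delta>" using A[OF C(1)] C' C(2) by auto
        then show "f \<in> {f \<in> edges A. p f \<in> edges \<Delta>}" using a(3)[of f] by simp
      qed
      then show "C' \<in> (`) \<phi> ` {C \<in> balanced A. C \<subseteq> {f \<in> edges A. p f \<in> edges \<Delta>}}" using C by blast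
    qed
  qed
  fix f assume "f \<in> edges (proj_preimage A p \<Delta>)"
  then have "f \<in> edges A" by simp
  then show "ends (proj_preimage B q \<Delta>) (\<phi> f) = ends (proj_preimage A p \<Delta>) f" "q (\<phi> f) = p f" using a(3)[of f] by simp_all
qed

lemma preimage_preimage:
  "edges \<Delta> \<subseteq> edges \<Delta>1 \<Longrightarrow> proj_preimage (proj_preimage A p \<Delta>1) p \<Delta> = proj_preimage A p \<Delta>"
  unfolding proj_preimage_def by auto

lemma extension_trans:
  assumes 1: "extension i \<Omega> p (link_graph V E) \<Omega>1 p1 (link_graph V F)" and 2: "extension j \<Omega>1 p1 (link_graph V F) \<Omega>2 p2 (link_graph V G)"
  shows "extension (j \<circ> i) \<Omega> p (link_graph V E) \<Omega>2 p2 (link_graph V G)"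
proof -
  have EF: "E \<subseteq> F" "F \<subseteq> G" and b2: "biased_expansion \<Omega>2 p2 (link_graph V G)" and b1: "biased_expansion \<Omega>1 p1 (link_graph V F)"
    using 1 2 unfolding extension_def spanning_subgraph_def by auto
  have i: "expansion_iso i \<Omega> p (proj_preimage \<Omega>1 p1 (link_graph V E)) p1" using 1 unfolding extension_def by simp
  have "expansion_iso j \<Omega>1 p1 (proj_preimage \<Omega>2 p2 (link_graph V F)) p2" using 2 unfolding extension_def by simp
  from expansion_iso_restrict[OF this, of "link_graph V E"] expansion_facts(6)[OF b1]
  have "expansion_iso j (proj_preimage \<Omega>1 p1 (link_graph V E)) p1 (proj_preimage \<Omega>2 p2 (link_graph V E)) p2"
    unfolding preimage_preimage[of "link_graph V E" "link_graph V F", unfolded link_graph_simps, OF EF(1)] by blast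
  from expansion_iso_trans[OF i this] show ?thesis unfolding extension_def spanning_subgraph_def using b2 EF by auto
qed

lemma section_graph_restrict:
  assumes "E \<subseteq> F"
  shows "proj_preimage (section_graph V F K b) fst (link_graph V E) = section_graph V E K b"
proof -
  have "{f \<in> edges (section_graph V F K b). fst f \<in> E} = edges (section_graph V E K b)" using assms by auto
  moreover have "{C \<in> balanced (section_graph V F K b). C \<subseteq> edges (section_graph V E K b)} = balanced (section_graph V E K b)"
  proof
    show "{C \<in> balanced (section_graph V F K b). C \<subseteq> edges (section_graph V E K b)} \<subseteq> balanced (section_graph V E K b)"
    proof
      fix C assume C: "C \<in> {C \<in> balanced (section_graph V F K b). C \<subseteq> edges (section_graph V E K b)}"
      then obtain s D where D: "C = section_lift s D" "circ D" "\<forall>d\<in>D. s d \<in> K d" "b D s" by auto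
      have "D \<subseteq> E" using C unfolding D(1) by (auto simp: section_lift_def)
      then show "C \<in> balanced (section_graph V E K b)" unfolding section_graph_simps using D by blast
    qed
    show "balanced (section_graph V E K b) \<subseteq> {C \<in> balanced (section_graph V F K b). C \<subseteq> edges (section_graph V E K b)}"
    proof
      fix C assume "C \<in> balanced (section_graph V E K b)"
      then obtain s D where D: "C = section_lift s D" "circ D" "D \<subseteq> E" "\<forall>d\<in>D. s d \<in> K d" "b D s" by auto
      have "C \<subseteq> edges (section_graph V E K b)" unfolding D(1) using D(3,4) by (auto simp: section_lift_def)
      moreover have "C \<in> balanced (section_graph V F K b)" unfolding section_graph_simps using D assms by blast
      ultimately show "C \<in> {C \<in> balanced (section_graph V F K b). C \<subseteq> edges (section_graph V E K b)}" by blast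
    qed
  qed
  ultimately show ?thesis unfolding proj_preimage_def link_graph_simps by (simp add: section_graph_def)
qed

lemma section_graph_cong:
  assumes "\<And>e. e \<in> E \<Longrightarrow> K e = K' e" "agree K E b b'"
  shows "section_graph V E K b = section_graph V E K' b'"
proof -
  have "(circ C \<and> C \<subseteq> E \<and> (\<forall>d\<in>C. s d \<in> K d) \<and> b C s) = (circ C \<and> C \<subseteq> E \<and> (\<forall>d\<in>C. s d \<in> K' d) \<and> b' C s)" for C s
  proof (cases "circ C \<and> C \<subseteq> E")
    case True
    then have "(s d \<in> K d) = (s d \<in> K' d)" if "d \<in> C" for d using that assms(1) by auto
    then have "(\<forall>d\<in>C. s d \<in> K d) = (\<forall>d\<in>C. s d \<in> K' d)" by simp
    then show ?thesis using assms(2) True unfolding agree_def by metis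
  qed auto
  moreover have "{(e, k). e \<in> E \<and> k \<in> K e} = {(e, k). e \<in> E \<and> k \<in> K' e}" using assms(1) by auto
  ultimately show ?thesis unfolding section_graph_def by simp
qed

lemma section_graph_relabel_iso:
  assumes \<phi>: "\<And>e. e \<in> E \<Longrightarrow> bij_betw (\<phi> e) (K1 e) (K2 e)" and b2: "theta_prop K2 E b2"
    and ag: "agree K1 E b1 (\<lambda>C s. b2 C (\<lambda>d. \<phi> d (s d)))"
  shows "expansion_iso (\<lambda>(e, k). (e, \<phi> e k)) (section_graph V E K1 b1) fst (section_graph V E K2 b2) fst"
proof -
  let ?f = "\<lambda>(e, k). (e, \<phi> e k)"
  have \<phi>': "inj_on (\<phi> e) (K1 e)" "\<phi> e ` K1 e = K2 e" if "e \<in> E" for e using \<phi>[OF that] unfolding bij_betw_def by auto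
  have "inj_on ?f (edges (section_graph V E K1 b1))" using \<phi>'(1) by (auto simp: inj_on_def)
  moreover have "?f ` edges (section_graph V E K1 b1) = edges (section_graph V E K2 b2)" using \<phi>'(2) by (force simp: image_iff)
  ultimately have bij: "bij_betw ?f (edges (section_graph V E K1 b1)) (edges (section_graph V E K2 b2))" unfolding bij_betw_def by blast
  have fl: "?f ` section_lift s C = section_lift (\<lambda>d. \<phi> d (s d)) C" for s C unfolding section_lift_def image_image by simp
  have "balanced (section_graph V E K2 b2) = (`) ?f ` balanced (section_graph V E K1 b1)"
  proof
    show "balanced (section_graph V E K2 b2) \<subseteq> (`) ?f ` balanced (section_graph V E K1 b1)"
    proof
      fix C assume "C \<in> balanced (section_graph V E K2 b2)"
      then obtain t D where D: "C = section_lift t D" "circ D" "D \<subseteq> E" "\<And>d. d \<in> D \<Longrightarrow> t d \<in> K2 d" "b2 D t" by auto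
      define s where "s d = inv_into (K1 d) (\<phi> d) (t d)" for d
      have s: "s d \<in> K1 d" "\<phi> d (s d) = t d" if "d \<in> D" for d
        using \<phi>'(2)[of d] D(3,4) that unfolding s_def by (auto intro: inv_into_into simp: f_inv_into_f)
      have "b2 D (\<lambda>d. \<phi> d (s d)) = b2 D t" by (rule theta_prop_cong[OF b2]) (use s in simp)
      then have "b1 D s" using ag D(2,3,5) s(1) unfolding agree_def by blast
      then have "section_lift s D \<in> balanced (section_graph V E K1 b1)" unfolding section_graph_simps using D(2,3) s(1) by blast
      moreover have "?f ` section_lift s D = C" unfolding fl D(1) section_lift_eq_iff using s(2) by simp
      ultimately show "C \<in> (`) ?f ` balanced (section_graph V E K1 b1)" by blast
    qed
    show "(`) ?f ` balanced (section_graph V E K1 b1) \<subseteq> balanced (section_graph V E K2 b2)"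
    proof
      fix C' assume "C' \<in> (`) ?f ` balanced (section_graph V E K1 b1)"
      then obtain s D where D: "C' = ?f ` section_lift s D" "circ D" "D \<subseteq> E" "\<forall>d\<in>D. s d \<in> K1 d" "b1 D s" by auto
      have "b2 D (\<lambda>d. \<phi> d (s d))" using ag D(2-5) unfolding agree_def by blast
      moreover have "\<forall>d\<in>D. \<phi> d (s d) \<in> K2 d" using \<phi>'(2) D(3,4) by blast
      ultimately show "C' \<in> balanced (section_graph V E K2 b2)" unfolding D(1) fl section_graph_simps using D(2,3) by blast
    qed
  qed
  then show ?thesis unfolding expansion_iso_def using bij by auto
qed

section \<open>Normal forms of extensions\<close>

lemma agree_common:
  assumes "agree K1 E b1 b0" "agree K2 E b2 b0" "\<And>e. e \<in> E \<Longrightarrow> K1 e = K2 e"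
  shows "agree K1 E b1 b2"
  unfolding agree_def
proof (intro allI impI)
  fix C s assume C: "circ C" "C \<subseteq> E" "\<forall>d\<in>C. s d \<in> K1 d"
  then have "\<forall>d\<in>C. s d \<in> K2 d" using assms(3) by auto
  then show "b1 C s = b2 C s" using assms(1,2) C unfolding agree_def by metis
qed

text \<open>With the other labels fixed, each label over \<open>e\<close> is sent to the label over
  \<open>d\<close> that makes \<open>C\<close> balanced; unique lifting at \<open>e\<close> makes
  this injective.\<close>

lemma fibre_injection:
  assumes b: "bexp K F b" and C: "circ C" "C \<subseteq> F" "e \<in> C" "d \<in> C" "e \<noteq> d" and ne: "\<And>d. K d \<noteq> {}"
  shows "\<exists>h. inj_on h (K e) \<and> h ` K e \<subseteq> K d"
proof -
  define s where "s = (\<lambda>d. SOME k. k \<in> K d)"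
  have s: "s d \<in> K d" for d unfolding s_def using ne some_in_eq by auto
  have "\<exists>h. h \<in> K d \<and> b C (s(e := k, d := h))" if "k \<in> K e" for k
  proof -
    have "(s(e := k)) x \<in> K x" for x using s that by simp
    then show ?thesis using bexp_lift[where s = "s(e := k)", OF b C(1,2,4)] by metis
  qed
  then obtain h where h: "\<And>k. k \<in> K e \<Longrightarrow> h k \<in> K d" "\<And>k. k \<in> K e \<Longrightarrow> b C (s(e := k, d := h k))" by metis
  have "inj_on h (K e)"
  proof (rule inj_onI)
    fix k k' assume k: "k \<in> K e" "k' \<in> K e" "h k = h k'"
    have tw: "s(e := k, d := x) = (s(d := x))(e := k)" for k x using C(5) by (rule fun_upd_twist)
    have "(s(d := h k')) x \<in> K x" for x using s h(1)[OF k(2)] by simp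
    then have "\<exists>!k. k \<in> K e \<and> b C ((s(d := h k'))(e := k))"
      using bexp_lift[where s = "s(d := h k')", OF b C(1,2,3)] by metis
    then show "k = k'" using h(2)[OF k(1)] h(2)[OF k(2)] k unfolding tw by metis
  qed
  then show ?thesis using h(1) by blast
qed

text \<open>The fibre over a new link embeds in the fibre over a link of the base with which it lies on a
  circle, so that the labels can be taken from the edges of \<open>\<Omega>\<close>.\<close>

lemma normal_form:
  assumes co: "conn V E" and E: "link_set V E" and b\<Omega>: "biased_expansion \<Omega> p (link_graph V E)"
    and ext: "extension i \<Omega> p (link_graph V E) \<Omega>' p' (link_graph V F)" and F: "link_set V F"
  obtains l K b where "\<And>d. K d \<noteq> {}" "\<And>d. d \<in> E \<Longrightarrow> K d = fibre \<Omega> p (\<lambda>f. f) E d" "bexp K F b"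
    "agree K E b (balance \<Omega> p (\<lambda>f. f))" "\<And>f. f \<in> edges \<Omega> \<Longrightarrow> l (i f) = f"
    "expansion_iso (\<lambda>g. (p' g, l g)) \<Omega>' p' (section_graph V F K b) fst" "E \<subseteq> F"
    "\<And>f. f \<in> edges \<Omega> \<Longrightarrow> i f \<in> edges \<Omega>' \<and> p' (i f) = p f"
proof -
  have EF: "E \<subseteq> F" and b': "biased_expansion \<Omega>' p' (link_graph V F)"
    and iso: "expansion_iso i \<Omega> p (proj_preimage \<Omega>' p' (link_graph V E)) p'"
    using ext unfolding extension_def spanning_subgraph_def by auto
  have i: "bij_betw i (edges \<Omega>) {g \<in> edges \<Omega>'. p' g \<in> E}" and ip: "\<And>f. f \<in> edges \<Omega> \<Longrightarrow> p' (i f) = p f"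
    and ib: "{C \<in> balanced \<Omega>'. C \<subseteq> {g \<in> edges \<Omega>'. p' g \<in> E}} = (`) i ` balanced \<Omega>"
    using iso unfolding expansion_iso_def by auto
  have inji: "inj_on i (edges \<Omega>)" and imi: "i ` edges \<Omega> = {g \<in> edges \<Omega>'. p' g \<in> E}" using i unfolding bij_betw_def by auto
  \<comment> \<open>The identity labelling gives unique lifting in \<open>\<Omega>'\<close>, from
    which the labelling by edges of \<Omega> is then constructed.\<close>
  interpret L0: labelled_expansion \<Omega>' p' "\<lambda>g. g" V F
    by unfold_locales (use b' F in \<open>auto simp: inj_on_def\<close>)
  have "\<exists>h. inj_on h {g \<in> edges \<Omega>'. p' g = e} \<and> h ` {g \<in> edges \<Omega>'. p' g = e} \<subseteq> {g \<in> edges \<Omega>'. p' g \<in> E}"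
    if e: "e \<in> F" "e \<notin> E" for e
  proof -
    obtain u v where uv: "e = {u, v}" "u \<noteq> v" "u \<in> V" "v \<in> V" using F e(1) unfolding link_set_def by (auto simp: card_2_iff)
    obtain W D where W: "upath u v W D" "D \<subseteq> E" using co uv unfolding conn_def by metis
    have "{u, v} \<notin> D" using e(2) uv(1) W(2) by auto
    then have C: "circ (insert e D)" unfolding circ_def using W(1) uv by metis
    obtain d where d: "d \<in> D" using upath_nonempty[OF W(1) uv(2)] by auto
    have "insert e D \<subseteq> F" "e \<in> insert e D" "d \<in> insert e D" "e \<noteq> d" "d \<in> E" "d \<in> F" using W(2) EF e d by auto
    from fibre_injection[OF L0.bexp C this(1-4) L0.K_ne] this(5,6) e(1) show ?thesis unfolding fibre_def by (auto simp: subset_iff)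
  qed
  then have "\<forall>e\<in>F - E. \<exists>h. inj_on h {g \<in> edges \<Omega>'. p' g = e} \<and> h ` {g \<in> edges \<Omega>'. p' g = e} \<subseteq> {g \<in> edges \<Omega>'. p' g \<in> E}"
    by simp
  from bchoice[OF this] obtain h where h0: "\<forall>e\<in>F - E. inj_on (h e) {g \<in> edges \<Omega>'. p' g = e} \<and>
    h e ` {g \<in> edges \<Omega>'. p' g = e} \<subseteq> {g \<in> edges \<Omega>'. p' g \<in> E}" ..
  have h: "inj_on (h e) {g \<in> edges \<Omega>'. p' g = e}" if "e \<in> F - E" for e using h0 that by simp
  have h': "h (p' g) g \<in> {g \<in> edges \<Omega>'. p' g \<in> E}" if "g \<in> edges \<Omega>'" "p' g \<in> F - E" for g
    using h0[rule_format, OF that(2)] that(1) by auto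
  \<comment> \<open>An old edge stays, an edge over a new link goes to an edge over
    \<open>E\<close>; in both cases the result lies in the image of \<open>i\<close> and is read as
    an edge of \<Omega>. Edges over different links may share a label, as \<open>p'\<close> tells
    them apart.\<close>
  define m where "m g = (if p' g \<in> E then g else h (p' g) g)" for g
  define l where "l g = inv_into (edges \<Omega>) i (m g)" for g
  have m: "m g \<in> i ` edges \<Omega>" if "g \<in> edges \<Omega>'" for g
    unfolding imi m_def using h'[OF that] that L0.p_in[OF that] by auto
  have "inj_on (\<lambda>g. (p' g, l g)) (edges \<Omega>')"
  proof (rule inj_onI)
    fix g g' assume g: "g \<in> edges \<Omega>'" "g' \<in> edges \<Omega>'" and "(p' g, l g) = (p' g', l g')"
    then have pg: "p' g = p' g'" "l g = l g'" by auto
    then have "m g = m g'" unfolding l_def using inv_into_injective m g by metis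
    then show "g = g'" using h[of "p' g"] pg(1) g L0.p_in[OF g(1)] unfolding m_def by (auto split: if_splits dest: inj_onD)
  qed
  then interpret L: labelled_expansion \<Omega>' p' l V F
    by unfold_locales (use b' F in auto)
  have li: "l (i f) = f" if "f \<in> edges \<Omega>" for f
  proof -
    have "i f \<in> {g \<in> edges \<Omega>'. p' g \<in> E}" using imi that by auto
    then show ?thesis unfolding l_def m_def using inv_into_f_f[OF inji that] by simp
  qed
  have K: "fibre \<Omega>' p' l F d = fibre \<Omega> p (\<lambda>f. f) E d" if d: "d \<in> E" for d
  proof -
    have "{g \<in> edges \<Omega>'. p' g = d} = i ` {f \<in> edges \<Omega>. p f = d}"
    proof
      show "i ` {f \<in> edges \<Omega>. p f = d} \<subseteq> {g \<in> edges \<Omega>'. p' g = d}" using ip imi by auto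
      show "{g \<in> edges \<Omega>'. p' g = d} \<subseteq> i ` {f \<in> edges \<Omega>. p f = d}"
      proof
        fix g assume g: "g \<in> {g \<in> edges \<Omega>'. p' g = d}"
        then have "g \<in> i ` edges \<Omega>" using imi d by auto
        then obtain f where "f \<in> edges \<Omega>" "g = i f" by auto
        then show "g \<in> i ` {f \<in> edges \<Omega>. p f = d}" using g ip by auto
      qed
    qed
    moreover have "l ` i ` {f \<in> edges \<Omega>. p f = d} = (\<lambda>f. f) ` {f \<in> edges \<Omega>. p f = d}"
      unfolding image_image by (rule image_cong) (use li in auto)
    ultimately show ?thesis unfolding fibre_def using d EF by auto
  qed
  have "agree (fibre \<Omega>' p' l F) E (balance \<Omega>' p' l) (balance \<Omega> p (\<lambda>f. f))"
    unfolding agree_def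
  proof (intro allI impI)
    fix C s assume C: "circ C" "C \<subseteq> E"
    have sel: "select \<Omega>' p' l s C = i ` select \<Omega> p (\<lambda>f. f) s C"
    proof
      show "i ` select \<Omega> p (\<lambda>f. f) s C \<subseteq> select \<Omega>' p' l s C" using imi ip li unfolding select_def by auto
      show "select \<Omega>' p' l s C \<subseteq> i ` select \<Omega> p (\<lambda>f. f) s C"
      proof
        fix g assume g: "g \<in> select \<Omega>' p' l s C"
        then have "g \<in> i ` edges \<Omega>" using imi C(2) unfolding select_def by auto
        then obtain f where "f \<in> edges \<Omega>" "g = i f" by auto
        then show "g \<in> i ` select \<Omega> p (\<lambda>f. f) s C" using g ip li unfolding select_def by auto
      qed
    qed
    have S: "select \<Omega> p (\<lambda>f. f) s C \<subseteq> edges \<Omega>" unfolding select_def by auto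
    have "i ` select \<Omega> p (\<lambda>f. f) s C \<subseteq> {g \<in> edges \<Omega>'. p' g \<in> E}" using S imi by auto
    then have "select \<Omega>' p' l s C \<in> balanced \<Omega>' \<longleftrightarrow> i ` select \<Omega> p (\<lambda>f. f) s C \<in> (`) i ` balanced \<Omega>"
      unfolding sel ib[symmetric] by simp
    also have "\<dots> \<longleftrightarrow> select \<Omega> p (\<lambda>f. f) s C \<in> balanced \<Omega>"
    proof
      assume "i ` select \<Omega> p (\<lambda>f. f) s C \<in> (`) i ` balanced \<Omega>"
      then obtain D where D: "D \<in> balanced \<Omega>" "i ` select \<Omega> p (\<lambda>f. f) s C = i ` D" by auto
      then have "select \<Omega> p (\<lambda>f. f) s C = D"
        using inj_on_image_eq_iff[OF inji S expansion_facts(6)[OF b\<Omega> D(1)]] by simp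
      then show "select \<Omega> p (\<lambda>f. f) s C \<in> balanced \<Omega>" using D(1) by simp
    qed (rule imageI)
    finally show "balance \<Omega>' p' l C s = balance \<Omega> p (\<lambda>f. f) C s" unfolding balance_def .
  qed
  moreover have "i f \<in> edges \<Omega>' \<and> p' (i f) = p f" if "f \<in> edges \<Omega>" for f using that imi ip by auto
  ultimately show thesis
    by (intro that[of "fibre \<Omega>' p' l F" "balance \<Omega>' p' l" l] L.K_ne K L.bexp li L.iso EF)
qed

text \<open>Over \<open>E\<close> labels and balance are those of \<Omega>, so the preimage of the
  old base equals the section graph of \<Omega>.\<close>

lemma section_graph_extension:
  assumes b\<Omega>: "biased_expansion \<Omega> p (link_graph V E)" and F: "link_set V F" "E \<subseteq> F"
    and K: "\<And>d. K d \<noteq> {}" "\<And>d. d \<in> E \<Longrightarrow> K d = fibre \<Omega> p (\<lambda>f. f) E d" and b: "bexp K F b"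
    and ag: "agree K E b (balance \<Omega> p (\<lambda>f. f))"
  shows "extension (\<lambda>f. (p f, f)) \<Omega> p (link_graph V E) (section_graph V F K b) fst (link_graph V F)"
proof -
  have E: "link_set V E" using F unfolding link_set_def by auto
  interpret L: labelled_expansion \<Omega> p "\<lambda>f. f" V E
    by unfold_locales (use b\<Omega> E in \<open>auto simp: inj_on_def\<close>)
  have "section_graph V E K b = section_graph V E (fibre \<Omega> p (\<lambda>f. f) E) (balance \<Omega> p (\<lambda>f. f))"
    by (rule section_graph_cong[OF _ ag]) (rule K(2))
  then have "expansion_iso (\<lambda>f. (p f, f)) \<Omega> p (proj_preimage (section_graph V F K b) fst (link_graph V E)) fst"
    using L.iso unfolding section_graph_restrict[OF F(2)] by simp
  then show ?thesis unfolding extension_def spanning_subgraph_def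
    using section_graph_biased_expansion[OF b F(1) K(1)] F(2) by simp
qed

lemma extension_link_graph:
  assumes "extension i \<Omega> p (link_graph V E) \<Omega>' p' \<Delta>'" "simple_graph \<Delta>'"
  obtains F where "\<Delta>' = link_graph V F" "link_set V F" "E \<subseteq> F"
proof -
  note s = simple_graph_link_graph[OF assms(2)]
  have "verts \<Delta>' = V" "E \<subseteq> edges \<Delta>'" using assms(1) unfolding extension_def spanning_subgraph_def by auto
  then show thesis using that[of "edges \<Delta>'"] s by metis
qed

lemma add_links_link_graph: "add_links (link_graph V E) X = link_graph V (E \<union> X)"
  by (simp add: add_links_def link_graph_def)

text \<open>The normal form of the extension, restricted to \<open>E\<close> and \<open>e\<close>,
  is an extension to \<open>e\<close> with the edge type prescribed in
  \<open>extends_to\<close>.\<close>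

lemma extends_to_edge:
  assumes co: "conn V E" and E: "link_set V E" and b\<Omega>: "biased_expansion \<Omega> p (link_graph V E)"
    and ext: "extension i \<Omega> p (link_graph V E) \<Omega>' p' (link_graph V F)" and F: "link_set V F" and e: "e \<in> F" "e \<notin> E"
  shows "nonadjacent_link (link_graph V E) e \<and> extends_to \<Omega> p (link_graph V E) e"
proof
  have "e \<subseteq> V" "card e = 2" using F e(1) unfolding link_set_def by auto
  moreover from this obtain u v where "e = {u, v}" "u \<noteq> v" by (auto simp: card_2_iff)
  ultimately show "nonadjacent_link (link_graph V E) e" unfolding nonadjacent_link_def link_graph_simps using e(2) by blast
  obtain l K b where n: "\<And>d. K d \<noteq> {}" "\<And>d. d \<in> E \<Longrightarrow> K d = fibre \<Omega> p (\<lambda>f. f) E d" "bexp K F b"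
    "agree K E b (balance \<Omega> p (\<lambda>f. f))" "\<And>f. f \<in> edges \<Omega> \<Longrightarrow> l (i f) = f"
    "expansion_iso (\<lambda>g. (p' g, l g)) \<Omega>' p' (section_graph V F K b) fst" "E \<subseteq> F"
    "\<And>f. f \<in> edges \<Omega> \<Longrightarrow> i f \<in> edges \<Omega>' \<and> p' (i f) = p f"
    by (rule normal_form[OF co E b\<Omega> ext F]) (rule that)
  have "link_set V (insert e E)" using E F e(1) unfolding link_set_def by auto
  moreover have "bexp K (insert e E) b" by (rule bexp_mono[OF n(3)]) (use n(7) e(1) in auto)
  ultimately have "extension (\<lambda>f. (p f, f)) \<Omega> p (link_graph V E) (section_graph V (insert e E) K b) fst (link_graph V (insert e E))"
    by (intro section_graph_extension[OF b\<Omega> _ _ n(1,2) _ n(4)]) auto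
  then show "extends_to \<Omega> p (link_graph V E) e" unfolding extends_to_def add_links_link_graph by auto
qed

text \<open>If \<open>F\<close> were smaller, uniqueness would identify \<open>\<Omega>1\<close>
  with the part over \<open>F\<close> of the section graph on \<open>E \<union> X\<close>, which
  would then be a proper simple extension of it.\<close>

lemma maximal_extension_unique_graph:
  assumes co: "conn V E" and tw: "\<forall>e\<in>E. \<forall>f\<in>E. e \<noteq> f \<longrightarrow> (\<exists>C. circ C \<and> C \<subseteq> E \<and> e \<in> C \<and> f \<in> C)"
    and E: "link_set V E" and b\<Omega>: "biased_expansion \<Omega> p (link_graph V E)"
    and K: "\<And>d. K d \<noteq> {}" "\<And>d. d \<in> E \<Longrightarrow> K d = fibre \<Omega> p (\<lambda>f. f) E d" and B: "bexp K (E \<union> X) B"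
    and ag: "agree K E B (balance \<Omega> p (\<lambda>f. f))"
    and X: "X = {e. nonadjacent_link (link_graph V E) e \<and> extends_to \<Omega> p (link_graph V E) e}" "link_set V (E \<union> X)"
    and max: "maximal_extension i \<Omega> p (link_graph V E) \<Omega>1 p1 \<Delta>1"
  shows "\<Delta>1 = link_graph V (E \<union> X)"
proof -
  have ext: "extension i \<Omega> p (link_graph V E) \<Omega>1 p1 \<Delta>1" "simple_graph \<Delta>1" and nox: "\<not> has_proper_simple_extension \<Omega>1 p1 \<Delta>1"
    using max unfolding maximal_extension_def by auto
  obtain F where F: "\<Delta>1 = link_graph V F" "link_set V F" "E \<subseteq> F" using extension_link_graph[OF ext] by metis
  note ext1 = ext(1)[unfolded F(1)]
  have b1: "biased_expansion \<Omega>1 p1 (link_graph V F)" using ext1 unfolding extension_def by simp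
  have FX: "F \<subseteq> E \<union> X" using extends_to_edge[OF co E b\<Omega> ext1 F(2)] unfolding X(1) by blast
  have "F = E \<union> X"
  proof (rule ccontr)
    assume ne: "F \<noteq> E \<union> X"
    obtain l K1 c1 where n: "\<And>d. K1 d \<noteq> {}" "\<And>d. d \<in> E \<Longrightarrow> K1 d = fibre \<Omega> p (\<lambda>f. f) E d" "bexp K1 F c1"
      "agree K1 E c1 (balance \<Omega> p (\<lambda>f. f))" "\<And>f. f \<in> edges \<Omega> \<Longrightarrow> l (i f) = f"
      "expansion_iso (\<lambda>g. (p1 g, l g)) \<Omega>1 p1 (section_graph V F K1 c1) fst" "E \<subseteq> F"
      "\<And>f. f \<in> edges \<Omega> \<Longrightarrow> i f \<in> edges \<Omega>1 \<and> p1 (i f) = p f"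
      by (rule normal_form[OF co E b\<Omega> ext1 F(2)]) (rule that)
    have BF: "bexp K F B" by (rule bexp_mono[OF B FX]) simp
    have KK: "\<And>d. d \<in> E \<Longrightarrow> K1 d = K d" using n(2) K(2) by simp
    have ag1: "agree K1 E c1 B" by (rule agree_common[OF n(4) ag KK])
    have c2: "\<And>e. e \<in> F \<Longrightarrow> card e = 2" using F(2) unfolding link_set_def by auto
    obtain \<phi> where \<phi>: "\<And>e. e \<in> F \<Longrightarrow> bij_betw (\<phi> e) (K1 e) (K e)" "\<And>e. e \<in> E \<Longrightarrow> \<phi> e = id"
      "agree K1 F c1 (\<lambda>C s. B C (\<lambda>d. \<phi> d (s d)))"
      by (rule extension_unique[OF n(3) BF KK ag1 F(3) link_set_Union[OF F(2)] c2 co tw n(1)]) (assumption, assumption, rule that)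
    have "expansion_iso (\<lambda>(e, k). (e, \<phi> e k)) (section_graph V F K1 c1) fst (section_graph V F K B) fst"
      by (rule section_graph_relabel_iso[OF \<phi>(1) bexp_theta_prop[OF BF] \<phi>(3)])
    from expansion_iso_trans[OF n(6) this]
    have extB: "extension ((\<lambda>(e, k). (e, \<phi> e k)) \<circ> (\<lambda>g. (p1 g, l g))) \<Omega>1 p1 (link_graph V F) (section_graph V (E \<union> X) K B) fst (link_graph V (E \<union> X))"
      unfolding extension_def spanning_subgraph_def section_graph_restrict[OF FX]
      using section_graph_biased_expansion[OF B X(2) K(1)] FX by simp
    \<comment> \<open>The extension just found is labelled by edges of \<Omega>, while
      \<open>has_proper_simple_extension\<close> asks for edges of \<open>\<Omega>1\<close>; a
      second normal form, over \<open>\<Omega>1\<close>, makes the change.\<close>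
    obtain l' K' b' where n': "\<And>d. K' d \<noteq> {}" "\<And>d. d \<in> F \<Longrightarrow> K' d = fibre \<Omega>1 p1 (\<lambda>f. f) F d" "bexp K' (E \<union> X) b'"
      "agree K' F b' (balance \<Omega>1 p1 (\<lambda>f. f))"
      "\<And>f. f \<in> edges \<Omega>1 \<Longrightarrow> l' (((\<lambda>(e, k). (e, \<phi> e k)) \<circ> (\<lambda>g. (p1 g, l g))) f) = f"
      "expansion_iso (\<lambda>g. (fst g, l' g)) (section_graph V (E \<union> X) K B) fst (section_graph V (E \<union> X) K' b') fst" "F \<subseteq> E \<union> X"
      "\<And>f. f \<in> edges \<Omega>1 \<Longrightarrow> ((\<lambda>(e, k). (e, \<phi> e k)) \<circ> (\<lambda>g. (p1 g, l g))) f \<in> edges (section_graph V (E \<union> X) K B) \<and>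
         fst (((\<lambda>(e, k). (e, \<phi> e k)) \<circ> (\<lambda>g. (p1 g, l g))) f) = p1 f"
      by (rule normal_form[OF conn_mono[OF co F(3)] F(2) b1 extB X(2)]) (rule that)
    have "has_proper_simple_extension \<Omega>1 p1 \<Delta>1" unfolding has_proper_simple_extension_def F(1)
    proof (intro exI conjI)
      show "extension (\<lambda>f. (p1 f, f)) \<Omega>1 p1 (link_graph V F) (section_graph V (E \<union> X) K' b') fst (link_graph V (E \<union> X))"
        by (rule section_graph_extension[OF b1 X(2) FX n'(1-4)])
      show "simple_graph (link_graph V (E \<union> X))" using simple_link_graph[OF X(2)] .
      show "link_graph V (E \<union> X) \<noteq> link_graph V F" using ne by (metis link_graph_simps(2))
    qed
    then show False using nox by simp
  qed
  then show ?thesis using F(1) by simp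
qed

theorem theorem3p3:
  fixes \<Delta> :: "('v, 'v set) mgraph"
    and \<Omega> :: "('v, 'f) biased_graph"
    and p :: "'f \<Rightarrow> 'v set"
    and X :: "'v set set"
  assumes "simple_graph \<Delta>"
    and "two_connected \<Delta>"
    and "biased_expansion \<Omega> p \<Delta>"
    and "X = {e. nonadjacent_link \<Delta> e \<and> extends_to \<Omega> p \<Delta> e}"
  shows "(\<exists>i (\<Omega>' :: ('v, 'v set \<times> 'f) biased_graph) p'.
            maximal_extension i \<Omega> p \<Delta> \<Omega>' p' (add_links \<Delta> X)) \<and>
         (\<forall>i1 (\<Omega>1 :: ('v, 'g) biased_graph) p1 \<Delta>1 i2 (\<Omega>2 :: ('v, 'h) biased_graph) p2 \<Delta>2.
            maximal_extension i1 \<Omega> p \<Delta> \<Omega>1 p1 \<Delta>1 \<and> maximal_extension i2 \<Omega> p \<Delta> \<Omega>2 p2 \<Delta>2 \<longrightarrow>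
            \<Delta>1 = add_links \<Delta> X \<and> \<Delta>2 = add_links \<Delta> X \<and>
            (\<exists>\<phi>. expansion_iso \<phi> \<Omega>1 p1 \<Omega>2 p2 \<and> (\<forall>f\<in>edges \<Omega>. \<phi> (i1 f) = i2 f)))"
proof -
  define V E where "V = verts \<Delta>" and "E = edges \<Delta>"
  have \<Delta>: "\<Delta> = link_graph V E" and E: "link_set V E" using simple_graph_link_graph[OF assms(1)] unfolding V_def E_def by auto
  have b\<Omega>: "biased_expansion \<Omega> p (link_graph V E)" using assms(3) \<Delta> by simp
  have X: "X = {e. nonadjacent_link (link_graph V E) e \<and> extends_to \<Omega> p (link_graph V E) e}" using assms(4) \<Delta> by simp
  have co: "conn V E" unfolding conn_def
  proof (intro ballI)
    fix a b assume "a \<in> V" "b \<in> V"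
    then obtain vs es where p: "path_seq (link_graph V E) vs es" "hd vs = a" "last vs = b"
      using assms(2) unfolding \<Delta> two_connected_def connected_graph_def link_graph_simps by metis
    have "upath a b (set vs) ((\<lambda>e. e) ` set es)" using path_seq_upath[OF p(1), of "\<lambda>e. e"] p(2,3) by simp
    moreover have "set es \<subseteq> E" using p(1) unfolding path_seq_def by simp
    ultimately show "\<exists>W D. upath a b W D \<and> D \<subseteq> E" by auto
  qed
  have tw: "\<forall>e\<in>E. \<forall>f\<in>E. e \<noteq> f \<longrightarrow> (\<exists>C. circ C \<and> C \<subseteq> E \<and> e \<in> C \<and> f \<in> C)"
  proof (intro ballI impI)
    fix e f assume "e \<in> E" "f \<in> E" "e \<noteq> f"
    then obtain C where C: "C \<in> circles (link_graph V E)" "e \<in> C" "f \<in> C"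
      using assms(2) unfolding \<Delta> two_connected_def link_graph_simps by metis
    then obtain es where es: "C = set es" "circle_seq (link_graph V E) es" unfolding circles_def by auto
    have "circ C" using circle_seq_circ[OF es(2), of "\<lambda>e. e"] E es(1) unfolding link_set_def by simp
    moreover have "C \<subseteq> E" using es unfolding circle_seq_def by simp
    ultimately show "\<exists>C. circ C \<and> C \<subseteq> E \<and> e \<in> C \<and> f \<in> C" using C by auto
  qed
  interpret L: labelled_expansion \<Omega> p "\<lambda>f. f" V E
    by unfold_locales (use b\<Omega> E in \<open>auto simp: inj_on_def\<close>)
  let ?K0 = "fibre \<Omega> p (\<lambda>f. f) E" and ?b0 = "balance \<Omega> p (\<lambda>f. f)"
  have Xlink: "e \<subseteq> V \<and> card e = 2 \<and> e \<notin> E" if "e \<in> X" for e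
    using that unfolding X nonadjacent_link_def by auto
  then have EX: "link_set V (E \<union> X)" using E unfolding link_set_def by auto
  have "\<exists>K b. (\<forall>d. K d \<noteq> {}) \<and> (\<forall>d\<in>E. K d = ?K0 d) \<and> bexp K (insert e E) b \<and> agree K E b ?b0" if e: "e \<in> X" for e
  proof -
    obtain i and \<Omega>' :: "('v, 'v set \<times> 'f) biased_graph" and p' where
      "extension i \<Omega> p (link_graph V E) \<Omega>' p' (link_graph V (E \<union> {e}))"
      using e unfolding X extends_to_def add_links_link_graph by auto
    then have ext: "extension i \<Omega> p (link_graph V E) \<Omega>' p' (link_graph V (insert e E))" by simp
    have li: "link_set V (insert e E)" using E Xlink[OF e] unfolding link_set_def by auto
    obtain l K b where n: "\<And>d. K d \<noteq> {}" "\<And>d. d \<in> E \<Longrightarrow> K d = ?K0 d" "bexp K (insert e E) b" "agree K E b ?b0"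
      "\<And>f. f \<in> edges \<Omega> \<Longrightarrow> l (i f) = f" "expansion_iso (\<lambda>g. (p' g, l g)) \<Omega>' p' (section_graph V (insert e E) K b) fst" "E \<subseteq> insert e E"
      "\<And>f. f \<in> edges \<Omega> \<Longrightarrow> i f \<in> edges \<Omega>' \<and> p' (i f) = p f"
      by (rule normal_form[OF co E b\<Omega> ext li]) (rule that)
    show ?thesis using n(1-4) by (intro exI[of _ K] exI[of _ b]) simp
  qed
  then obtain Ke be where ke: "\<And>e d. e \<in> X \<Longrightarrow> Ke e d \<noteq> {}" "\<And>e d. e \<in> X \<Longrightarrow> d \<in> E \<Longrightarrow> Ke e d = ?K0 d"
    "\<And>e. e \<in> X \<Longrightarrow> bexp (Ke e) (insert e E) (be e)" "\<And>e. e \<in> X \<Longrightarrow> agree (Ke e) E (be e) ?b0" by metis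
  \<comment> \<open>The extensions to different links may use different labels. Over
    \<open>E\<close> they all agree, and the label set over a new link is taken from its own
    extension.\<close>
  define K where "K = (\<lambda>d. if d \<in> X then Ke d d else ?K0 d)"
  have K: "K d \<noteq> {}" "d \<in> E \<Longrightarrow> K d = ?K0 d" for d unfolding K_def using ke(1) L.K_ne Xlink by auto
  have bX: "e \<subseteq> V \<and> card e = 2 \<and> e \<notin> E \<and> bexp K (insert e E) (be e) \<and> agree K E (be e) ?b0" if e: "e \<in> X" for e
  proof -
    have KK: "K d = Ke e d" if "d \<in> insert e E" for d using that e ke(2) K(2) unfolding K_def by auto
    have "bexp K (insert e E) (be e)" by (rule bexp_mono[OF ke(3)[OF e]]) (use KK in auto)
    moreover have "agree K E (be e) ?b0" using ke(4)[OF e] KK unfolding agree_def by (metis insertI2 subsetD)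
    ultimately show ?thesis using Xlink[OF e] by simp
  qed
  have bE0: "bexp K E ?b0" by (rule bexp_mono[OF L.bexp]) (use K(2) in auto)
  obtain B where B: "bexp K (E \<union> X) B" "agree K E B ?b0"
    by (rule amalgam_all[where X = X and b = be, OF K(1) bE0 co three_conn_pathI[OF co tw] link_set_Union[OF E]])
      (rule bX, assumption, rule that)
  have ext: "extension (\<lambda>f. (p f, f)) \<Omega> p (link_graph V E) (section_graph V (E \<union> X) K B) fst (link_graph V (E \<union> X))"
    by (rule section_graph_extension[OF b\<Omega> EX _ K B]) auto
  \<comment> \<open>A proper simple extension, composed with \<open>ext\<close>, would extend
    \<Omega> to a link outside \<open>E \<union> X\<close>, against the choice of
    \<open>X\<close>.\<close>
  have "\<not> has_proper_simple_extension (section_graph V (E \<union> X) K B) fst (link_graph V (E \<union> X))"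
  proof
    assume "has_proper_simple_extension (section_graph V (E \<union> X) K B) fst (link_graph V (E \<union> X))"
    then obtain j and \<Omega>2 :: "('v, 'v set \<times> 'v set \<times> 'f) biased_graph" and p2 \<Delta>2 where
      2: "extension j (section_graph V (E \<union> X) K B) fst (link_graph V (E \<union> X)) \<Omega>2 p2 \<Delta>2" "simple_graph \<Delta>2" "\<Delta>2 \<noteq> link_graph V (E \<union> X)"
      unfolding has_proper_simple_extension_def by auto
    obtain F where F: "\<Delta>2 = link_graph V F" "link_set V F" "E \<union> X \<subseteq> F" using extension_link_graph[OF 2(1,2)] by metis
    have "extension (j \<circ> (\<lambda>f. (p f, f))) \<Omega> p (link_graph V E) \<Omega>2 p2 (link_graph V F)"
      using extension_trans[OF ext] 2(1) F(1) by simp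
    from extends_to_edge[OF co E b\<Omega> this F(2)] have "F \<subseteq> E \<union> X" unfolding X by blast
    then show False using 2(3) F by auto
  qed
  then have "maximal_extension (\<lambda>f. (p f, f)) \<Omega> p \<Delta> (section_graph V (E \<union> X) K B) fst (add_links \<Delta> X)"
    unfolding maximal_extension_def \<Delta> add_links_link_graph using ext simple_link_graph[OF EX] by simp
  moreover have "\<Delta>1 = add_links \<Delta> X \<and> \<Delta>2 = add_links \<Delta> X \<and>
      (\<exists>\<phi>. expansion_iso \<phi> \<Omega>1 p1 \<Omega>2 p2 \<and> (\<forall>f\<in>edges \<Omega>. \<phi> (i1 f) = i2 f))"
    if max: "maximal_extension i1 \<Omega> p \<Delta> \<Omega>1 p1 \<Delta>1" "maximal_extension i2 \<Omega> p \<Delta> \<Omega>2 p2 \<Delta>2"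
    for i1 and \<Omega>1 :: "('v, 'g) biased_graph" and p1 \<Delta>1 i2 and \<Omega>2 :: "('v, 'h) biased_graph" and p2 \<Delta>2
  proof -
    note link_graph = maximal_extension_unique_graph[OF co tw E b\<Omega> K B X EX]
    have D: "\<Delta>1 = link_graph V (E \<union> X)" "\<Delta>2 = link_graph V (E \<union> X)" using link_graph max unfolding \<Delta> by blast+
    have e1: "extension i1 \<Omega> p (link_graph V E) \<Omega>1 p1 (link_graph V (E \<union> X))" and e2: "extension i2 \<Omega> p (link_graph V E) \<Omega>2 p2 (link_graph V (E \<union> X))"
      using max unfolding maximal_extension_def D \<Delta> by auto
    have B2: "biased_expansion \<Omega>2 p2 (link_graph V (E \<union> X))" using e2 unfolding extension_def by simp
    obtain l1 K1 b1 where n1: "\<And>d. K1 d \<noteq> {}" "\<And>d. d \<in> E \<Longrightarrow> K1 d = ?K0 d" "bexp K1 (E \<union> X) b1" "agree K1 E b1 ?b0"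
      "\<And>f. f \<in> edges \<Omega> \<Longrightarrow> l1 (i1 f) = f" "expansion_iso (\<lambda>g. (p1 g, l1 g)) \<Omega>1 p1 (section_graph V (E \<union> X) K1 b1) fst" "E \<subseteq> E \<union> X"
      "\<And>f. f \<in> edges \<Omega> \<Longrightarrow> i1 f \<in> edges \<Omega>1 \<and> p1 (i1 f) = p f"
      by (rule normal_form[OF co E b\<Omega> e1 EX]) (rule that)
    obtain l2 K2 b2 where n2: "\<And>d. K2 d \<noteq> {}" "\<And>d. d \<in> E \<Longrightarrow> K2 d = ?K0 d" "bexp K2 (E \<union> X) b2" "agree K2 E b2 ?b0"
      "\<And>f. f \<in> edges \<Omega> \<Longrightarrow> l2 (i2 f) = f" "expansion_iso (\<lambda>g. (p2 g, l2 g)) \<Omega>2 p2 (section_graph V (E \<union> X) K2 b2) fst" "E \<subseteq> E \<union> X"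
      "\<And>f. f \<in> edges \<Omega> \<Longrightarrow> i2 f \<in> edges \<Omega>2 \<and> p2 (i2 f) = p f"
      by (rule normal_form[OF co E b\<Omega> e2 EX]) (rule that)
    have KK: "\<And>d. d \<in> E \<Longrightarrow> K1 d = K2 d" using n1(2) n2(2) by simp
    have ag: "agree K1 E b1 b2" by (rule agree_common[OF n1(4) n2(4) KK])
    have c2: "\<And>e. e \<in> E \<union> X \<Longrightarrow> card e = 2" using EX unfolding link_set_def by auto
    obtain \<phi> where \<phi>: "\<And>e. e \<in> E \<union> X \<Longrightarrow> bij_betw (\<phi> e) (K1 e) (K2 e)" "\<And>e. e \<in> E \<Longrightarrow> \<phi> e = id"
      "agree K1 (E \<union> X) b1 (\<lambda>C s. b2 C (\<lambda>d. \<phi> d (s d)))"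
      by (rule extension_unique[OF n1(3) n2(3) KK ag Un_upper1 link_set_Union[OF EX] c2 co tw n1(1)]) (assumption, assumption, rule that)
    let ?j = "\<lambda>g. (p2 g, l2 g)"
    \<comment> \<open>Both encodings send the copy of \<open>f\<close> to \<open>(p f, f)\<close>,
      and the relabelling is the identity over \<open>E\<close>; so the composition takes
      \<open>i1 f\<close> to \<open>i2 f\<close>.\<close>
    let ?\<Phi> = "inv_into (edges \<Omega>2) ?j \<circ> ((\<lambda>(e, k). (e, \<phi> e k)) \<circ> (\<lambda>g. (p1 g, l1 g)))"
    have "expansion_iso ?\<Phi> \<Omega>1 p1 \<Omega>2 p2"
      by (rule expansion_iso_trans[OF expansion_iso_trans[OF n1(6) section_graph_relabel_iso[OF \<phi>(1) bexp_theta_prop[OF n2(3)] \<phi>(3)]]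
            expansion_iso_inv[OF n2(6) expansion_facts(6)[OF B2]]])
    moreover have "?\<Phi> (i1 f) = i2 f" if f: "f \<in> edges \<Omega>" for f
    proof -
      have "inj_on ?j (edges \<Omega>2)" using n2(6) unfolding expansion_iso_def bij_betw_def by blast
      moreover have "?j (i2 f) = (p f, f)" using n2(5,8)[OF f] by simp
      ultimately have "inv_into (edges \<Omega>2) ?j (p f, f) = i2 f" using inv_into_f_f[of ?j "edges \<Omega>2" "i2 f"] n2(8)[OF f] by simp
      then show ?thesis using n1(5,8)[OF f] \<phi>(2)[OF L.p_in[OF f]] by simp
    qed
    ultimately show ?thesis unfolding D \<Delta> add_links_link_graph by blast
  qed
  ultimately show ?thesis by blast
qed

end
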